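(* Consider the distributed locally equality-constrained problem $\mathcal P_{\mathrm d}$ of the context, and assume: (1) the graph $\mathcal G$ is undirected and connected; (2) each $f_i:\mathbb R^d\to\mathbb R$ and each $\mathbf h_i^{\mathrm d}:\mathbb R^d\to\mathbb R^{r_i}$ is twice continuously differentiable, and $\nabla^2 f_i$ and the Jacobian $\mathbf J_i^{\mathrm d}=\partial\mathbf h_i^{\mathrm d}/\partial\mathbf x_i$ are locally Lipschitz continuous; (3) there exist $\mathbf s_{\mathrm d}^{\ast}\in\Omega_{\mathrm d}$, an open neighborhood $\mathcal U_{\mathrm d}\subset\mathbb R^d$ of $\mathbf s_{\mathrm d}^{\ast}$ and $\rho_{\mathrm d}>0$ such that $\mathbf s_{\mathrm d}^{\ast}$ is a local minimizer of $F$ on $\Omega_{\mathrm d}\cap\mathcal U_{\mathrm d}$ and $F(\mathbf s)\ge F(\mathbf s_{\mathrm d}^{\ast})+\frac{\rho_{\mathrm d}}{2}\|\mathbf s-\mathbf s_{\mathrm d}^{\ast}\|^2$ for all $\mathbf s\in\Omega_{\mathrm d}\cap\mathcal U_{\mathrm d}$; (4) for every $\mathbf x=\operatorname{col}(\mathbf x_1,\ldots,\mathbf x_N)\in\mathcal X_{\mathrm d}\cap(\mathbf 1_N\otimes\mathcal U_{\mathrm d})$, $\operatorname{rank}\operatorname{col}(\mathbf J_1^{\mathrm d}(\mathbf x_1),\ldots,\mathbf J_N^{\mathrm d}(\mathbf x_N))=r$. Let $\mathbf x_{\mathrm d}^{\ast}:=\mathbf 1_N\otimes\mathbf s_{\mathrm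 d}^{\ast}$. Then the singular-perturbation (SP) realization $$\begin{aligned}\dot{\mathbf x}&=-\nabla f(\mathbf x)-\mathbf v-\tilde{\mathbf J}^{\mathrm d}(\mathbf x)^{\top}\bm\mu,\quad \mathbf v=K_{pc}\mathbf L\mathbf x+\mathbf z_c,\quad \bm\mu=K_{ph}\mathbf h^{\mathrm d}(\mathbf x)+\mathbf z_h,\\ \dot{\mathbf z}_c&=-K_{pc}\mathbf G_g(\mathbf L\mathbf x),\quad \dot{\mathbf z}_h=-K_{ph}\mathbf G_h(\mathbf h^{\mathrm d}(\mathbf x)),\end{aligned}$$ with $\mathbf z=\operatorname{col}(\mathbf z_c,\mathbf z_h)$, $\mathbf z_c(0)\in\operatorname{Im}\mathbf L$, admits a locally unique equilibrium $(\mathbf x_{\mathrm d}^{\ast},\mathbf z^\ast)$, which is locally exponentially stable in the following sense. Let $\alpha_{\mathrm{FL}}\in(0,\min\{\rho_{\mathrm d}/N,\alpha_G\})$. For any $\alpha_{\mathrm{SP}}\in(0,\alpha_{\mathrm{FL}})$ there exists $\tau^\ast>0$ such that, for every fixed $\tau\in(0,\tau^\ast)$, there exist constants $C_{\mathrm{SP}}>0$ and $\delta_{\mathrm{SP}}>0$ such that whenever $\|\mathbf x(0)-\mathbf x_{\mathrm d}^{\ast}\|+\|\mathbf z(0)-\mathbf z^\ast\|<\delta_{\mathrm{SP}}$, the corresponding solution satisfies, for all $t\ge0$, $$\|\mathbf x(t)-\mathbf x_{\mathrm d}^{\ast}\|+\|\mathbf z(t)-\mathbf z^\ast\|+\|\mathbf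 L\mathbf x(t)\|+\|\mathbf h^{\mathrm d}(\mathbf x(t))\|\le C_{\mathrm{SP}}e^{-\alpha_{\mathrm{SP}}t}\big(\|\mathbf x(0)-\mathbf x_{\mathrm d}^{\ast}\|+\|\mathbf z(0)-\mathbf z^\ast\|\big).$$
   Context: Network: agents $\mathcal V=\{1,\ldots,N\}$ communicate over an undirected weighted graph $\mathcal G$ with symmetric adjacency matrix $[a_{ij}]$, $a_{ij}>0$ if $i,j$ can exchange information and $a_{ij}=0$ otherwise. The Laplacian $\mathbf L_{\mathcal G}$ has entries $[\mathbf L_{\mathcal G}]_{ij}=-a_{ij}$ ($i\ne j$) and $[\mathbf L_{\mathcal G}]_{ii}=\sum_j a_{ij}$. Put $\mathbf L:=\mathbf L_{\mathcal G}\otimes\mathbf I_d$. $\operatorname{col}$ denotes vertical concatenation, $\operatorname{blkdiag}$ the block-diagonal matrix, $\mathbf 1_N$ the all-ones vector, and $\mathbf 1_N\otimes\mathcal U:=\{\mathbf 1_N\otimes\mathbf s:\mathbf s\in\mathcal U\}$. Norms are Euclidean. Problem $\mathcal P_{\mathrm d}$: minimize $\sum_{i=1}^N f_i(\mathbf x_i)$ over $\mathbf x_1,\ldots,\mathbf x_N\in\mathbb R^d$ subject to $\mathbf x_i=\mathbf x_j$ for all $i,j$ and $\mathbf h_i^{\mathrm d}(\mathbf x_i)=\mathbf 0$ for all $i$, where $f_i:\mathbb R^d\to\mathbb R$, $\mathbf h_i^{\mathrm d}:\mathbb R^d\to\mathbb R^{r_i}$. Put $r:=\sum_i r_i$, $F(\mathbf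 s):=\sum_i f_i(\mathbf s)$, $\Omega_{\mathrm d}:=\{\mathbf s\in\mathbb R^d:\mathbf h_i^{\mathrm d}(\mathbf s)=\mathbf 0,\ i=1,\ldots,N\}$, $\mathcal X_{\mathrm d}:=\{\mathbf 1_N\otimes\mathbf s:\mathbf s\in\Omega_{\mathrm d}\}$. For $\mathbf x=\operatorname{col}(\mathbf x_1,\ldots,\mathbf x_N)\in\mathbb R^{Nd}$: $f(\mathbf x):=\sum_i f_i(\mathbf x_i)$, $\mathbf h^{\mathrm d}(\mathbf x):=\operatorname{col}(\mathbf h_1^{\mathrm d}(\mathbf x_1),\ldots,\mathbf h_N^{\mathrm d}(\mathbf x_N))$, $\tilde{\mathbf J}^{\mathrm d}(\mathbf x):=\operatorname{blkdiag}(\mathbf J_1^{\mathrm d}(\mathbf x_1),\ldots,\mathbf J_N^{\mathrm d}(\mathbf x_N))$. Assigned output vector field: $\mathbf G_{\mathrm d}:\operatorname{Im}\mathbf L\times\mathbb R^r\to\operatorname{Im}\mathbf L\times\mathbb R^r$ is a fixed continuously differentiable map with $\mathbf G_{\mathrm d}(\mathbf 0)=\mathbf 0$ such that the origin of $\dot{\mathbf y}=\mathbf G_{\mathrm d}(\mathbf y)$ is globally exponentially stable with convergence rate $\alpha_G>0$ (i.e. $\|\mathbf y(t)\|\le c\,e^{-\alpha_G t}\|\mathbf y(0)\|$ for some constant $c$ and all solutions). For distributed implementation it is block-separable: $\mathbf G_{\mathrm d}(\operatorname{col}(\mathbf y_g,\mathbf y_h))=\operatorname{col}(\mathbf G_g(\mathbf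 y_g),\mathbf G_h(\mathbf y_h))$ with $\mathbf G_g(\mathbf y_g)=\operatorname{col}(\mathbf G_{g,1}(\mathbf y_{g,1}),\ldots,\mathbf G_{g,N}(\mathbf y_{g,N}))$ and $\mathbf G_h(\mathbf y_h)=\operatorname{col}(\mathbf G_{h,1}(\mathbf y_{h,1}),\ldots,\mathbf G_{h,N}(\mathbf y_{h,N}))$. Gains: $K_{0c},K_{0h}>0$ are fixed constants, $\tau>0$ is the singular-perturbation parameter, $K_{pc}:=K_{0c}/\tau$, $K_{ph}:=K_{0h}/\tau$. The admissible state space of the SP realization is $\{(\mathbf x,\mathbf z_c,\mathbf z_h):\mathbf x\in\mathbb R^{Nd},\ \mathbf z_c\in\operatorname{Im}\mathbf L,\ \mathbf z_h\in\mathbb R^r\}$, which is invariant; "locally unique equilibrium" means the only equilibrium in some neighborhood of it in this space. *)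

theory Defs
  imports "HOL-Analysis.Analysis"
begin

section \<open>Calculus\<close>

definition grad :: "('a::real_inner \<Rightarrow> real) \<Rightarrow> 'a \<Rightarrow> 'a" where
  "grad f x = (THE D. GDERIV f x :> D)"

text \<open>On a linear subspace \<open>S\<close> the derivative is only determined along \<open>S\<close>; since it can be
  composed with the orthogonal projection onto \<open>S\<close>, this is the usual notion for maps on \<open>S\<close>.\<close>
definition C1_on :: "'a set \<Rightarrow> ('a::real_normed_vector \<Rightarrow> 'b::real_normed_vector) \<Rightarrow> bool" where
  "C1_on S g \<longleftrightarrow> (\<exists>g' :: 'a \<Rightarrow> 'a \<Rightarrow>\<^sub>L 'b.
     (\<forall>x\<in>S. (g has_derivative blinfun_apply (g' x)) (at x within S)) \<and> continuous_on S g')"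

definition C2 :: "('a::real_normed_vector \<Rightarrow> 'b::real_normed_vector) \<Rightarrow> bool" where
  "C2 g \<longleftrightarrow> (\<exists>g' :: 'a \<Rightarrow> 'a \<Rightarrow>\<^sub>L 'b.
     (\<forall>x. (g has_derivative blinfun_apply (g' x)) (at x)) \<and> C1_on UNIV g')"

definition locally_lipschitz :: "('a::metric_space \<Rightarrow> 'b::metric_space) \<Rightarrow> bool" where
  "locally_lipschitz g \<longleftrightarrow> (\<forall>x. \<exists>u>0. \<exists>l. l-lipschitz_on (ball x u) g)"

definition local_minimizer_on :: "('a::metric_space \<Rightarrow> real) \<Rightarrow> 'a set \<Rightarrow> 'a \<Rightarrow> bool" where
  "local_minimizer_on F S s \<longleftrightarrow> s \<in> S \<and> (\<exists>e>0. \<forall>t\<in>S \<inter> ball s e. F s \<le> F t)"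


section \<open>Autonomous differential equations\<close>

definition is_solution :: "('a::real_normed_vector \<Rightarrow> 'a) \<Rightarrow> 'a set \<Rightarrow> (real \<Rightarrow> 'a) \<Rightarrow> bool" where
  "is_solution V S y \<longleftrightarrow>
     (\<forall>t\<ge>0. y t \<in> S \<and> (y has_vector_derivative V (y t)) (at t within {0..}))"

text \<open>The first conjunct rules out finite escape times, which a bound on the solutions
  over \<open>[0,\<infinity>)\<close> alone would not see.\<close>
definition globally_exp_stable :: "('a::real_normed_vector \<Rightarrow> 'a) \<Rightarrow> 'a set \<Rightarrow> real \<Rightarrow> bool" where
  "globally_exp_stable V S \<alpha> \<longleftrightarrow>
     (\<forall>y0\<in>S. \<exists>y. is_solution V S y \<and> y 0 = y0) \<and>
     (\<exists>c. \<forall>y. is_solution V S y \<longrightarrow> (\<forall>t\<ge>0. norm (y t) \<le> c * exp (- \<alpha> * t) * norm (y 0)))"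

definition locally_unique_equilibrium ::
    "('a::real_normed_vector \<Rightarrow> 'a) \<Rightarrow> 'a set \<Rightarrow> 'a \<Rightarrow> bool" where
  "locally_unique_equilibrium V S p \<longleftrightarrow> p \<in> S \<and> V p = 0 \<and>
     (\<exists>W. open W \<and> p \<in> W \<and> (\<forall>q\<in>W \<inter> S. V q = 0 \<longrightarrow> q = p))"


section \<open>The network\<close>

definition laplacian :: "real^'n^'n \<Rightarrow> real^'n^'n" where
  "laplacian a = (\<chi> i j. if i = j then (\<Sum>k\<in>UNIV. a $ i $ k) else - a $ i $ j)"

definition connected_graph :: "real^'n^'n \<Rightarrow> bool" where
  "connected_graph a \<longleftrightarrow> (\<forall>i j. (i, j) \<in> {(i, j). a $ i $ j > 0}\<^sup>*)"

text \<open>A stacked vector \<open>col(x\<^sub>1, \<dots>, x\<^sub>N)\<close> with blocks in \<open>\<real>\<^sup>d\<close> is an element of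
  \<open>real^'d^'n\<close>, whose norm is the Euclidean norm of \<open>\<real>\<^sup>N\<^sup>d\<close>. In this block form,
  \<open>stack_op M\<close> is the action of the Kronecker product of \<open>M\<close> with the identity of size \<open>d\<close>, and
  \<open>consensus s\<close> is the Kronecker product of the all-ones vector with \<open>s\<close>.\<close>
definition stack_op :: "real^'n^'n \<Rightarrow> real^'d^'n \<Rightarrow> real^'d^'n" where
  "stack_op M x = (\<chi> i. \<Sum>j\<in>UNIV. M $ i $ j *\<^sub>R x $ j)"

definition consensus :: "real^'d \<Rightarrow> real^'d^'n" where
  "consensus s = (\<chi> i. s)"

abbreviation Lap :: "real^'n^'n \<Rightarrow> real^'d^'n \<Rightarrow> real^'d^'n" where
  "Lap a \<equiv> stack_op (laplacian a)"


section \<open>Local constraints of varying dimension\<close>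

text \<open>The dimensions \<open>r\<^sub>i\<close> depend on the agent and may be zero. They are encoded by index sets
  \<open>R i \<subseteq> 'm\<close> with \<open>r\<^sub>i = card (R i)\<close>: the space \<open>\<real>\<^sup>r\<^sup>i\<close> is the set of vectors in \<open>real^'m\<close>
  supported on \<open>R i\<close>, and \<open>\<real>\<^sup>r\<close> is the corresponding subspace \<open>constr_space R\<close> of \<open>real^'m^'n\<close>.
  Zero padding changes neither Euclidean norms nor ranks.\<close>
definition constr_space :: "('n \<Rightarrow> 'm set) \<Rightarrow> (real^'m^'n) set" where
  "constr_space R = {y. \<forall>i k. k \<notin> R i \<longrightarrow> y $ i $ k = 0}"

definition constr_dim :: "('n::finite \<Rightarrow> 'm set) \<Rightarrow> nat" where
  "constr_dim R = (\<Sum>i\<in>UNIV. card (R i))"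

definition feasible :: "('n \<Rightarrow> real^'d \<Rightarrow> real^'m) \<Rightarrow> (real^'d) set" where
  "feasible h = {s. \<forall>i. h i s = 0}"

definition stacked_cost :: "('n \<Rightarrow> real^'d \<Rightarrow> real) \<Rightarrow> real^'d^'n \<Rightarrow> real" where
  "stacked_cost f x = (\<Sum>i\<in>UNIV. f i (x $ i))"

definition block_map :: "('n \<Rightarrow> 'a \<Rightarrow> 'b) \<Rightarrow> 'a^'n \<Rightarrow> 'b^'n" where
  "block_map g x = (\<chi> i. g i (x $ i))"

text \<open>The rows of \<open>col(J\<^sub>1(x\<^sub>1), \<dots>, J\<^sub>N(x\<^sub>N))\<close> are indexed by pairs of an agent and a constraint.\<close>
definition stacked_jacobian ::
    "('n \<Rightarrow> real^'d \<Rightarrow> real^'m) \<Rightarrow> real^'d^'n \<Rightarrow> real^'d^('n \<times> 'm)" where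
  "stacked_jacobian h x = (\<chi> p. jacobian (h (fst p)) (at (x $ fst p)) $ snd p)"

text \<open>The action of the transpose of \<open>blkdiag(J\<^sub>1(x\<^sub>1), \<dots>, J\<^sub>N(x\<^sub>N))\<close> on a stacked vector.\<close>
definition blkdiag_jacobian_transpose ::
    "('n \<Rightarrow> real^'d \<Rightarrow> real^'m) \<Rightarrow> real^'d^'n \<Rightarrow> real^'m^'n \<Rightarrow> real^'d^'n" where
  "blkdiag_jacobian_transpose h x \<mu> =
     (\<chi> i. transpose (jacobian (h i) (at (x $ i))) *v (\<mu> $ i))"


section \<open>The singular-perturbation realization\<close>

text \<open>States are triples \<open>(x, z\<^sub>c, z\<^sub>h)\<close>, so \<open>snd\<close> of a state is \<open>z = col(z\<^sub>c, z\<^sub>h)\<close>.\<close>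

definition sp_space :: "real^'n^'n \<Rightarrow> ('n \<Rightarrow> 'm set)
    \<Rightarrow> ((real^'d^'n) \<times> (real^'d^'n) \<times> (real^'m^'n)) set" where
  "sp_space a R = UNIV \<times> range (Lap a) \<times> constr_space R"

definition sp_field :: "real^'n^'n \<Rightarrow> ('n \<Rightarrow> real^'d \<Rightarrow> real) \<Rightarrow> ('n \<Rightarrow> real^'d \<Rightarrow> real^'m)
    \<Rightarrow> (real^'d^'n \<Rightarrow> real^'d^'n) \<Rightarrow> (real^'m^'n \<Rightarrow> real^'m^'n) \<Rightarrow> real \<Rightarrow> real
    \<Rightarrow> (real^'d^'n) \<times> (real^'d^'n) \<times> (real^'m^'n)
    \<Rightarrow> (real^'d^'n) \<times> (real^'d^'n) \<times> (real^'m^'n)" where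
  "sp_field a f h Gg Gh Kpc Kph = (\<lambda>(x, zc, zh).
     let v = Kpc *\<^sub>R Lap a x + zc;
         \<mu> = Kph *\<^sub>R block_map h x + zh
     in (- grad (stacked_cost f) x - v - blkdiag_jacobian_transpose h x \<mu>,
         - Kpc *\<^sub>R Gg (Lap a x),
         - Kph *\<^sub>R Gh (block_map h x)))"

end

theory Submission
  imports Defs
begin

text \<open>Equilibria do not depend on \<open>\<tau>\<close>: they are the points with \<open>L x = 0\<close>, \<open>h x = 0\<close> and
  \<open>(z\<^sub>c, z\<^sub>h)\<close> a multiplier, so the KKT conditions at \<open>s_star\<close> provide one. Since \<open>C\<close> may depend
  on \<open>\<tau>\<close>, it suffices to find, for each small \<open>\<tau>\<close>, a quadratic Lyapunov form of the linearization
  with a rate above \<open>\<alpha>SP\<close>; isolation of the equilibrium then follows from stability at one \<open>\<tau>\<close>.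
  With \<open>B\<close> the derivative of \<open>(L x, h x)\<close>, the linearization splits into three parts: on the kernel
  of \<open>B\<close> it is the Hessian of the Lagrangian, which is at least \<open>\<rho> / N\<close> there by second-order
  necessity applied to the quadratic growth; transversally it follows the linearization of \<open>G\<close>, whose
  Lyapunov form comes from integrating its flow over a long finite time; and a third variable contracts
  at rate of order \<open>1 / \<tau>\<close>. A weighted sum of the three forms absorbs the coupling terms.\<close>

section \<open>Ordinary differential equations\<close>

text \<open>The feedback inserts \<open>L x\<close> itself into the x-equation, whereas the adjoint
  of \<open>B\<close> would insert \<open>L\<close> applied to it. The weight \<open>T\<close>
  repairs this: it contains an inverse of \<open>L\<close> on the range of \<open>L\<close>, the
  feedback becomes the adjoint of \<open>B\<close> applied to \<open>T y\<close>, and the form of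
  \<open>T\<close> is the right energy for the fast variable. The rate \<rho> / N arises because the
  kernel of \<open>B\<close> contains only consensus vectors: stacking N copies of v multiplies the
  squared norm by N, while the Hessian form keeps its value on v. Decay is known only for
  trajectories of the nonlinear \<open>G\<close>, with an unspecified factor c. Starting them at
  \<epsilon> v and letting \<epsilon> tend to 0 gives the same c and the same rate to the linearized
  flow; integrating up to a time at which the exponential gain outweighs c then yields a form for
  every rate below \<alpha>G. Strict gaps between rates pay for all error terms. A zero of
  \<open>G\<close> in \<open>Y\<close> is a constant trajectory, so decay forces it to be 0; this is
  why equilibria satisfy \<open>L x = 0\<close> and \<open>h x = 0\<close>, and the same argument
  turns stability into isolation.\<close>

lemma nonincreasing_on_interval:
  fixes g :: "real \<Rightarrow> real"
  assumes "0 \<le> T"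
    and der: "\<And>t. t \<in> {0..T} \<Longrightarrow> (g has_real_derivative g' t) (at t within {0..T})"
    and nonpos: "\<And>t. t \<in> {0..T} \<Longrightarrow> g' t \<le> 0"
  shows "g T \<le> g 0"
proof -
  have "\<exists>x\<in>{0..T}. g T - g 0 = g' x * (T - 0)"
    by (rule mvt_very_simple) (use assms in \<open>auto simp: has_field_derivative_def\<close>)
  then obtain x where "x \<in> {0..T}" "g T - g 0 = g' x * T" by auto
  with nonpos[of x] \<open>0 \<le> T\<close> mult_nonpos_nonneg[of "g' x" T] show ?thesis by simp
qed

text \<open>Gronwall for the squared norm, which is differentiable even where \<open>y\<close>
  vanishes. The extra 1 in the exponent pays for splitting the cross term 2 |y| k into |y|^2 +
  k^2.\<close>

lemma gronwall_square:
  fixes y :: "real \<Rightarrow> 'a::real_inner"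
  assumes "0 \<le> T" "0 \<le> L"
    and der: "\<And>t. t \<in> {0..T} \<Longrightarrow> (y has_vector_derivative y' t) (at t within {0..T})"
    and bound: "\<And>t. t \<in> {0..T} \<Longrightarrow> norm (y' t) \<le> L * norm (y t) + k"
  shows "(norm (y T))\<^sup>2 \<le> exp ((2 * L + 1) * T) * ((norm (y 0))\<^sup>2 + k\<^sup>2 * T)"
    (is "_ \<le> exp (?M * T) * _")
proof -
  have quad: "2 * (y t \<bullet> y' t) \<le> ?M * (y t \<bullet> y t) + k\<^sup>2" if "t \<in> {0..T}" for t
  proof -
    have "y t \<bullet> y' t \<le> norm (y t) * norm (y' t)" by (rule norm_cauchy_schwarz)
    also have "\<dots> \<le> norm (y t) * (L * norm (y t) + k)"
      by (intro mult_left_mono bound that) auto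
    finally have "2 * (y t \<bullet> y' t) \<le> 2 * L * (norm (y t))\<^sup>2 + 2 * norm (y t) * k"
      by (simp add: power2_eq_square algebra_simps)
    moreover have "2 * norm (y t) * k \<le> (norm (y t))\<^sup>2 + k\<^sup>2" by (rule sum_squares_bound)
    ultimately show ?thesis by (simp add: power2_norm_eq_inner algebra_simps)
  qed
  have "exp (- ?M * T) * (y T \<bullet> y T) - (k\<^sup>2 * T) \<le> exp (- ?M * 0) * (y 0 \<bullet> y 0) - (k\<^sup>2 * 0)"
  proof (rule nonincreasing_on_interval[OF \<open>0 \<le> T\<close>,
        where g = "\<lambda>t. exp (- ?M * t) * (y t \<bullet> y t) - (k\<^sup>2 * t)"
          and g' = "\<lambda>t. exp (- ?M * t) * (2 * (y t \<bullet> y' t) - ?M * (y t \<bullet> y t)) - k\<^sup>2"])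
      fix t assume t: "t \<in> {0..T}"
      show "((\<lambda>t. exp (- ?M * t) * (y t \<bullet> y t) - (k\<^sup>2 * t)) has_real_derivative
          exp (- ?M * t) * (2 * (y t \<bullet> y' t) - ?M * (y t \<bullet> y t)) - k\<^sup>2) (at t within {0..T})"
        unfolding has_field_derivative_def
        by (rule derivative_eq_intros der[OF t, unfolded has_vector_derivative_def] refl | simp)+
           (auto simp: fun_eq_iff inner_commute algebra_simps)
      have "exp (- ?M * t) * (2 * (y t \<bullet> y' t) - ?M * (y t \<bullet> y t)) \<le> exp (- ?M * t) * k\<^sup>2"
        using quad[OF t] by (intro mult_left_mono) auto
      also have "\<dots> \<le> 1 * k\<^sup>2" using t \<open>0 \<le> L\<close> by (intro mult_right_mono) (auto simp: mult_le_0_iff)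
      finally show "exp (- ?M * t) * (2 * (y t \<bullet> y' t) - ?M * (y t \<bullet> y t)) - k\<^sup>2 \<le> 0" by simp
  qed
  moreover have "exp (- ?M * T) = inverse (exp (?M * T))"
    by (simp add: exp_minus[symmetric] algebra_simps)
  ultimately have "inverse (exp (?M * T)) * (y T \<bullet> y T) \<le> y 0 \<bullet> y 0 + k\<^sup>2 * T" by simp
  then show ?thesis
    by (simp add: power2_norm_eq_inner field_simps)
qed

lemma quadratic_form_decay:
  fixes y :: "real \<Rightarrow> 'a::real_normed_vector" and \<beta> :: "'a \<Rightarrow> 'a \<Rightarrow> real"
  assumes \<beta>: "bounded_bilinear \<beta>"
    and der: "\<And>t. t \<ge> 0 \<Longrightarrow> (y has_vector_derivative y' t) (at t within {0..})"
    and decr: "\<And>t. t \<ge> 0 \<Longrightarrow> \<beta> (y t) (y' t) + \<beta> (y' t) (y t) \<le> - 2 * \<alpha> * \<beta> (y t) (y t)"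
    and "0 \<le> T"
  shows "\<beta> (y T) (y T) \<le> exp (- 2 * \<alpha> * T) * \<beta> (y 0) (y 0)"
proof -
  interpret \<beta>: bounded_bilinear \<beta> by fact
  have "exp (2 * \<alpha> * T) * \<beta> (y T) (y T) \<le> exp (2 * \<alpha> * 0) * \<beta> (y 0) (y 0)"
  proof (rule nonincreasing_on_interval[OF \<open>0 \<le> T\<close>, where g = "\<lambda>t. exp (2 * \<alpha> * t) * \<beta> (y t) (y t)"
        and g' = "\<lambda>t. exp (2 * \<alpha> * t) * (\<beta> (y t) (y' t) + \<beta> (y' t) (y t) + 2 * \<alpha> * \<beta> (y t) (y t))"])
    fix t assume t: "t \<in> {0..T}"
    have d: "(y has_derivative (\<lambda>h. h *\<^sub>R y' t)) (at t within {0..T})"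
      using der[of t] t has_vector_derivative_within_subset[of y "y' t" t "{0..}" "{0..T}"]
      by (auto simp: has_vector_derivative_def)
    show "((\<lambda>t. exp (2 * \<alpha> * t) * \<beta> (y t) (y t)) has_real_derivative
        exp (2 * \<alpha> * t) * (\<beta> (y t) (y' t) + \<beta> (y' t) (y t) + 2 * \<alpha> * \<beta> (y t) (y t))) (at t within {0..T})"
      unfolding has_field_derivative_def
      by (rule derivative_eq_intros \<beta>.FDERIV[OF d d] refl | simp)+
         (auto simp: fun_eq_iff algebra_simps \<beta>.scaleR_left \<beta>.scaleR_right)
    show "exp (2 * \<alpha> * t) * (\<beta> (y t) (y' t) + \<beta> (y' t) (y t) + 2 * \<alpha> * \<beta> (y t) (y t)) \<le> 0"
      using decr[of t] t by (simp add: mult_le_0_iff)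
  qed
  then have "exp (- 2 * \<alpha> * T) * (exp (2 * \<alpha> * T) * \<beta> (y T) (y T)) \<le> exp (- 2 * \<alpha> * T) * \<beta> (y 0) (y 0)"
    by (intro mult_left_mono) auto
  then show ?thesis
    by (simp add: mult.assoc[symmetric] exp_add[symmetric] exp_minus_inverse)
qed

text \<open>Local Lipschitz continuity in a form uniform on bounded sets: a trajectory over a
  compact time interval gets a single constant, and sums, products and compositions stay in the
  class.\<close>

definition lipschitz_on_balls :: "('a::real_normed_vector \<Rightarrow> 'b::metric_space) \<Rightarrow> bool" where
  "lipschitz_on_balls V \<longleftrightarrow> (\<forall>r. \<exists>L. L-lipschitz_on (cball 0 r) V)"

text \<open>Both trajectories stay in one ball up to time \<open>T\<close>, so the Gronwall estimate
  with k = 0 applies to their difference. The state sets may differ, which allows a comparison of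
  constrained with unconstrained solutions.\<close>

lemma solution_unique:
  fixes V :: "'a::real_inner \<Rightarrow> 'a"
  assumes V: "lipschitz_on_balls V"
    and y: "is_solution V S y" and z: "is_solution V S' z" and init: "y 0 = z 0" and "0 \<le> T"
  shows "y T = z T"
proof -
  have der: "(u has_vector_derivative V (u t)) (at t within {0..T})"
    if "is_solution V X u" "t \<in> {0..T}" for u X t
    using that has_vector_derivative_within_subset[of u _ t "{0..}" "{0..T}"]
    by (auto simp: is_solution_def)
  have bdd: "\<exists>B. u ` {0..T} \<subseteq> cball 0 B" if "is_solution V X u" for u X
  proof -
    have "continuous_on {0..T} u"
      using has_vector_derivative_continuous[OF der[OF that]]
      by (auto simp: continuous_on_eq_continuous_within)
    then have "bounded (u ` {0..T})"
      by (intro compact_imp_bounded compact_continuous_image) auto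
    then show ?thesis by (auto simp: bounded_iff subset_iff)
  qed
  obtain B where B: "y ` {0..T} \<subseteq> cball 0 B" using bdd[OF y] by auto
  obtain B' where B': "z ` {0..T} \<subseteq> cball 0 B'" using bdd[OF z] by auto
  obtain L where L: "L-lipschitz_on (cball 0 (max B B')) V"
    using V by (auto simp: lipschitz_on_balls_def)
  have "(norm (y T - z T))\<^sup>2 \<le> exp ((2 * L + 1) * T) * ((norm (y 0 - z 0))\<^sup>2 + 0\<^sup>2 * T)"
  proof (rule gronwall_square[OF \<open>0 \<le> T\<close>, where y = "\<lambda>t. y t - z t" and y' = "\<lambda>t. V (y t) - V (z t)"])
    fix t assume t: "t \<in> {0..T}"
    show "((\<lambda>t. y t - z t) has_vector_derivative V (y t) - V (z t)) (at t within {0..T})"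
      by (intro derivative_intros der[OF y t] der[OF z t])
    have "y t \<in> cball 0 (max B B')" "z t \<in> cball 0 (max B B')" using B B' t by fastforce+
    then show "norm (V (y t) - V (z t)) \<le> L * norm (y t - z t) + 0"
      using lipschitz_onD[OF L] by (simp add: dist_norm)
  qed (rule lipschitz_on_nonneg[OF L])
  with init show ?thesis by simp
qed

text \<open>Picard iteration in an exponentially weighted norm: the unknown is exp(-2Mt) (y t - y0)
  as a bounded continuous function, and the weight makes the integral operator a contraction with
  factor 1/2 on the whole half-line at once.\<close>

lemma lipschitz_global_solution:
  fixes V :: "'a::euclidean_space \<Rightarrow> 'a"
  assumes lip: "L-lipschitz_on UNIV V"
  shows "\<exists>y. is_solution V UNIV y \<and> y 0 = y0"
proof -
  define M where "M = L + 1"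
  have M: "M > 0" and VM: "norm (V p - V q) \<le> M * norm (p - q)" for p q
    using lipschitz_onD[OF lip, of p q] lipschitz_on_nonneg[OF lip]
    by (auto simp: M_def dist_norm algebra_simps intro: order_trans)
  have contV: "continuous_on X V" for X
    using lipschitz_on_continuous_on[OF lip] continuous_on_subset by blast
  define curve where "curve u s = y0 + exp (2 * M * s) *\<^sub>R apply_bcontfun u s" for u :: "real \<Rightarrow>\<^sub>C 'a" and s
  have contc: "continuous_on X (\<lambda>s. V (curve u s))" for X u
  proof -
    have "continuous_on X (curve u)"
      unfolding curve_def by (intro continuous_intros continuous_on_apply_bcontfun)
    then show ?thesis
      by (rule continuous_on_compose2[OF contV]) auto
  qed
  have intc: "(\<lambda>s. V (curve u s)) integrable_on {0..t}" for u t
    by (intro integrable_continuous_real contc)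
  have int_der: "((\<lambda>t. integral {0..t} (\<lambda>s. V (curve u s))) has_vector_derivative V (curve u t)) (at t within {0..})"
    if "t \<ge> 0" for u t
  proof -
    \<comment> \<open>The interval reaches beyond t, so that near t it looks like the
      half-line.\<close>
    have "((\<lambda>t. integral {0..t} (\<lambda>s. V (curve u s))) has_vector_derivative V (curve u t)) (at t within {0..t + 1})"
      by (rule integral_has_vector_derivative[OF contc]) (use that in auto)
    moreover have "at t within {0..t + 1} = at t within {0..}"
      by (rule at_within_nhd[of _ "{..<t + 1}"]) auto
    ultimately show ?thesis by simp
  qed
  \<comment> \<open>Bounded continuous functions live on the whole real line; \<open>max 0 t\<close>
    extends the operator constantly to negative times.\<close>
  define g where "g u t = exp (- 2 * M * max 0 t) *\<^sub>R integral {0..max 0 t} (\<lambda>s. V (curve u s))"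
    for u t
  have exp_int: "((\<lambda>s. exp (2 * M * s)) has_integral (exp (2 * M * t) - 1) / (2 * M)) {0..t}"
    if "t \<ge> 0" for t
  proof -
    have "((\<lambda>s. exp (2 * M * s)) has_integral exp (2 * M * t) / (2 * M) - exp (2 * M * 0) / (2 * M)) {0..t}"
      by (rule fundamental_theorem_of_calculus[OF that])
         (use M in \<open>auto intro!: derivative_eq_intros simp: has_real_derivative_iff_has_vector_derivative[symmetric]\<close>)
    then show ?thesis by (simp add: diff_divide_distrib)
  qed
  have half: "exp (- 2 * M * t) * ((exp (2 * M * t) - 1) / (2 * M) * (M * d)) \<le> d / 2"
    if "d \<ge> 0" for t d
  proof -
    have "exp (- 2 * M * t) * ((exp (2 * M * t) - 1) / (2 * M) * (M * d))
        = (exp (- 2 * M * t) * exp (2 * M * t) - exp (- 2 * M * t)) * (d / 2)"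
      using M by (simp add: field_simps)
    also have "exp (- 2 * M * t) * exp (2 * M * t) = 1" by (simp add: exp_add[symmetric])
    also have "(1 - exp (- 2 * M * t)) * (d / 2) \<le> 1 * (d / 2)"
      using that by (intro mult_right_mono) auto
    finally show ?thesis by simp
  qed
  have contr: "norm (g u t - g v t) \<le> dist u v / 2" for u v t
  proof -
    let ?t = "max 0 t"
    have "norm (integral {0..?t} (\<lambda>s. V (curve u s) - V (curve v s)))
        \<le> integral {0..?t} (\<lambda>s. exp (2 * M * s) * (M * dist u v))"
    proof (rule integral_norm_bound_integral)
      show "(\<lambda>s. V (curve u s) - V (curve v s)) integrable_on {0..?t}"
        by (intro integrable_diff intc)
      show "(\<lambda>s. exp (2 * M * s) * (M * dist u v)) integrable_on {0..?t}"
        by (intro integrable_continuous_real continuous_intros)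
      fix s
      have "norm (V (curve u s) - V (curve v s)) \<le> M * norm (curve u s - curve v s)" by (rule VM)
      also have "norm (curve u s - curve v s) = exp (2 * M * s) * dist (u s) (v s)"
        by (simp add: curve_def scaleR_diff_right[symmetric] dist_norm)
      also have "M * \<dots> \<le> M * (exp (2 * M * s) * dist u v)"
        using M dist_bounded[of u s v] by (intro mult_left_mono) auto
      finally show "norm (V (curve u s) - V (curve v s)) \<le> exp (2 * M * s) * (M * dist u v)"
        by (simp add: mult_ac)
    qed
    also have "\<dots> = (exp (2 * M * ?t) - 1) / (2 * M) * (M * dist u v)"
      by (rule integral_unique[OF has_integral_mult_left[OF exp_int]]) simp
    finally have "norm (g u t - g v t)
        \<le> exp (- 2 * M * ?t) * ((exp (2 * M * ?t) - 1) / (2 * M) * (M * dist u v))"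
      by (simp add: g_def scaleR_diff_right[symmetric] integral_diff[OF intc intc, symmetric] del: times_divide_eq_left times_divide_eq_right)
    also have "\<dots> \<le> dist u v / 2" by (rule half) auto
    finally show ?thesis .
  qed
  have cont_g: "continuous_on UNIV (g u)" for u
  proof -
    have *: "continuous_on {0..} (\<lambda>t. integral {0..t} (\<lambda>s. V (curve u s)))"
      using has_vector_derivative_continuous[OF int_der]
      by (auto simp: continuous_on_eq_continuous_within)
    have "continuous_on UNIV (\<lambda>t. integral {0..max 0 t} (\<lambda>s. V (curve u s)))"
      by (rule continuous_on_compose2[OF *, of UNIV "\<lambda>t. max 0 t"]) (auto intro!: continuous_intros)
    then show ?thesis
      unfolding g_def by (intro continuous_intros)
  qed
  \<comment> \<open>The image of 0 is bounded because x exp(-x) \<le> 1; by the contraction estimate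
    every other image is then bounded as well.\<close>
  have zero_bound: "norm (g 0 t) \<le> norm (V y0) * (1 / (2 * M))" for t
  proof -
    let ?t = "max 0 t"
    have "curve 0 s = y0" for s by (simp add: curve_def)
    then have "norm (g 0 t) = exp (- 2 * M * ?t) * (?t * norm (V y0))"
      by (simp add: g_def)
    also have "\<dots> = (exp (- 2 * M * ?t) * (2 * M * ?t)) * (norm (V y0) * (1 / (2 * M)))"
      using M by simp
    also have "\<dots> \<le> 1 * (norm (V y0) * (1 / (2 * M)))"
    proof (rule mult_right_mono)
      have "2 * M * ?t \<le> exp (2 * M * ?t)" using exp_ge_add_one_self[of "2 * M * ?t"] by linarith
      then show "exp (- 2 * M * ?t) * (2 * M * ?t) \<le> 1" by (simp add: exp_minus field_simps)
    qed (use M in auto)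
    finally show ?thesis by simp
  qed
  have in_bcont: "g u \<in> bcontfun" for u
  proof -
    have "norm (g u t) \<le> norm (V y0) * (1 / (2 * M)) + dist u 0 / 2" for t
      using contr[of u t 0] zero_bound[of t] norm_triangle_sub[of "g u t" "g 0 t"] by linarith
    then have "bounded (range (g u))" by (auto simp: bounded_iff)
    with cont_g show ?thesis by (simp add: bcontfun_def)
  qed
  have "\<exists>!u. Bcontfun (g u) = u"
  proof (rule banach_fix_type[where c = "1 / 2"])
    show "\<forall>u v. dist (Bcontfun (g u)) (Bcontfun (g v)) \<le> 1 / 2 * dist u v"
    proof (intro allI dist_bound)
      fix u v t
      show "dist (apply_bcontfun (Bcontfun (g u)) t) (apply_bcontfun (Bcontfun (g v)) t) \<le> 1 / 2 * dist u v"
        using contr[of u t v] unfolding Bcontfun_inverse[OF in_bcont] by (simp add: dist_norm[of "g u t"])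
    qed
  qed auto
  then obtain u where "Bcontfun (g u) = u" by blast
  then have u: "apply_bcontfun u = g u" using Bcontfun_inverse[OF in_bcont, of u] by simp
  have curve_eq: "curve u t = y0 + integral {0..t} (\<lambda>s. V (curve u s))" if "t \<ge> 0" for t
    using that unfolding curve_def[of u t] u g_def
    by (simp add: exp_add[symmetric])
  have "(curve u has_vector_derivative V (curve u t)) (at t within {0..})" if "t \<ge> 0" for t
  proof -
    have "((\<lambda>t. y0 + integral {0..t} (\<lambda>s. V (curve u s))) has_vector_derivative V (curve u t)) (at t within {0..})"
      using has_vector_derivative_add[OF has_vector_derivative_const[of y0] int_der[OF that]] by simp
    then show ?thesis
      by (rule has_vector_derivative_transform[rotated 2]) (use that curve_eq in auto)
  qed
  moreover have "curve u 0 = y0" using curve_eq[of 0] by simp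
  ultimately show ?thesis by (auto simp: is_solution_def)
qed

section \<open>Stability by linearization\<close>

text \<open>A subspace is its double orthogonal complement. Membership can thus be tested by
  functionals vanishing on \<open>S\<close>, and these commute with differentiation.\<close>

lemma mem_subspace_if_orthogonal:
  fixes S :: "'a::euclidean_space set"
  assumes "subspace S" and orth: "\<And>q. (\<And>x. x \<in> S \<Longrightarrow> x \<bullet> q = 0) \<Longrightarrow> y \<bullet> q = 0"
  shows "y \<in> S"
proof -
  obtain u v where uv: "u \<in> span S" "\<And>w. w \<in> span S \<Longrightarrow> orthogonal v w" "y = u + v"
    using orthogonal_subspace_decomp_exists[of S y] by metis
  have "x \<bullet> v = 0" if "x \<in> S" for x
    using uv(2)[of x] span_base[OF that] by (simp add: orthogonal_def inner_commute)
  then have "y \<bullet> v = 0" by (rule orth)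
  moreover have "u \<bullet> v = 0" using uv(1,2) by (simp add: orthogonal_def inner_commute)
  ultimately have "v = 0" using uv(3) by (simp add: inner_add_left)
  with uv(1,3) \<open>subspace S\<close> show ?thesis by (simp add: span_eq_iff[THEN iffD2])
qed

lemma derivative_in_subspace:
  fixes V :: "'a::real_normed_vector \<Rightarrow> 'b::euclidean_space"
  assumes "(V has_derivative A) (at p)" "\<And>p. V p \<in> S" "subspace S"
  shows "A x \<in> S"
proof (rule mem_subspace_if_orthogonal[OF \<open>subspace S\<close>])
  fix q assume q: "\<And>x. x \<in> S \<Longrightarrow> x \<bullet> q = 0"
  have "((\<lambda>p. V p \<bullet> q) has_derivative (\<lambda>x. A x \<bullet> q)) (at p)"
    by (rule has_derivative_inner_left[OF assms(1)])
  then have "((\<lambda>p. 0) has_derivative (\<lambda>x. A x \<bullet> q)) (at p)"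
    using q assms(2) by simp
  from has_derivative_unique[OF this has_derivative_const] show "A x \<bullet> q = 0"
    by (rule fun_cong)
qed

text \<open>A functional that vanishes on \<open>S\<close> has derivative zero along the trajectory,
  hence keeps its initial value 0.\<close>

lemma solution_in_subspace:
  fixes V :: "'a::euclidean_space \<Rightarrow> 'a"
  assumes y: "is_solution V UNIV y" and "\<And>p. V p \<in> S" "subspace S" "y 0 \<in> S"
  shows "is_solution V S y"
proof -
  have "y t \<in> S" if "t \<ge> 0" for t
  proof (rule mem_subspace_if_orthogonal[OF \<open>subspace S\<close>])
    fix q assume q: "\<And>x. x \<in> S \<Longrightarrow> x \<bullet> q = 0"
    have "((\<lambda>t. y t \<bullet> q) has_vector_derivative 0) (at t within {0..})" if "t \<in> {0..}" for t
      using bounded_linear.has_vector_derivative[OF bounded_linear_inner_left, of y "V (y t)" "at t within {0..}" q]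
        y that q[OF assms(2)] by (auto simp: is_solution_def)
    then obtain c where c: "\<And>t. t \<in> {0..} \<Longrightarrow> y t \<bullet> q = c"
      using has_vector_derivative_zero_constant[of "{0..}" "\<lambda>t. y t \<bullet> q"] by auto
    with q[OF \<open>y 0 \<in> S\<close>] c[of 0] that show "y t \<bullet> q = 0" by simp
  qed
  with y show ?thesis by (simp add: is_solution_def)
qed

text \<open>Compactness of the unit sphere of \<open>S\<close> gives a positive minimum, and
  homogeneity spreads it; the zero subspace is split off because its sphere is empty.\<close>

lemma coercive_on_subspace:
  fixes \<beta> :: "'a::euclidean_space \<Rightarrow> 'a \<Rightarrow> real"
  assumes \<beta>: "bounded_bilinear \<beta>" and S: "subspace S"
    and pos: "\<And>x. x \<in> S \<Longrightarrow> x \<noteq> 0 \<Longrightarrow> \<beta> x x > 0"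
  obtains c where "c > 0" "\<And>x. x \<in> S \<Longrightarrow> c * (norm x)\<^sup>2 \<le> \<beta> x x"
proof (cases "S \<inter> sphere 0 1 = {}")
  interpret \<beta>: bounded_bilinear \<beta> by fact
  case True
  have "x = 0" if "x \<in> S" for x
  proof (rule ccontr)
    assume "x \<noteq> 0"
    with subspace_scale[OF S that, of "inverse (norm x)"] True show False by auto
  qed
  then have "1 * (norm x)\<^sup>2 \<le> \<beta> x x" if "x \<in> S" for x
    using that by (metis \<beta>.zero_left mult_1 norm_zero order_refl power_zero_numeral)
  then show ?thesis using that[of 1] by simp
next
  interpret \<beta>: bounded_bilinear \<beta> by fact
  case False
  have "compact (S \<inter> sphere 0 1)"
    by (intro closed_Int_compact closed_subspace S compact_sphere)
  moreover have "continuous_on (S \<inter> sphere 0 1) (\<lambda>x. \<beta> x x)"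
    by (intro \<beta>.continuous_on continuous_intros)
  ultimately obtain m where m: "m \<in> S \<inter> sphere 0 1" "\<And>x. x \<in> S \<inter> sphere 0 1 \<Longrightarrow> \<beta> m m \<le> \<beta> x x"
    using continuous_attains_inf[of "S \<inter> sphere 0 1" "\<lambda>x. \<beta> x x"] False by blast
  show ?thesis
  proof (rule that[of "\<beta> m m"])
    show "\<beta> m m > 0" using m(1) by (intro pos) auto
    fix x assume "x \<in> S"
    show "\<beta> m m * (norm x)\<^sup>2 \<le> \<beta> x x"
    proof (cases "x = 0")
      case False
      have "\<beta> m m \<le> \<beta> (x /\<^sub>R norm x) (x /\<^sub>R norm x)"
        using m(2) subspace_scale[OF S \<open>x \<in> S\<close>] False by auto
      also have "\<dots> = \<beta> x x / (norm x)\<^sup>2"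
        by (simp add: \<beta>.scaleR_left \<beta>.scaleR_right power2_eq_square divide_simps)
      finally show ?thesis using False by (simp add: field_simps)
    qed (simp add: \<beta>.zero_left)
  qed
qed

text \<open>The field is replaced away from \<open>q\<close> by a globally Lipschitz field
  \<open>W\<close> that has global solutions and satisfies the same Lyapunov estimate everywhere.
  Trajectories that start close enough never leave the ball on which \<open>W\<close> equals
  \<open>V\<close>.\<close>

lemma stable_by_linearization:
  fixes V :: "'a::euclidean_space \<Rightarrow> 'a" and \<beta> :: "'a \<Rightarrow> 'a \<Rightarrow> real"
  assumes S: "subspace S" and V: "lipschitz_on_balls V" "\<And>p. V p \<in> S" "V q = 0" "q \<in> S"
    and A: "(V has_derivative A) (at q)"
    and \<beta>: "bounded_bilinear \<beta>" and pos: "\<And>x. x \<in> S \<Longrightarrow> x \<noteq> 0 \<Longrightarrow> \<beta> x x > 0"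
    and decr: "\<And>x. x \<in> S \<Longrightarrow> \<beta> x (A x) + \<beta> (A x) x \<le> - 2 * \<alpha> * \<beta> x x"
    and \<gamma>: "0 \<le> \<gamma>" "\<gamma> < \<alpha>"
  obtains C \<delta> where "C > 0" "\<delta> > 0"
    "\<And>p. p \<in> S \<Longrightarrow> norm (p - q) < \<delta> \<Longrightarrow> \<exists>\<phi>. is_solution V S \<phi> \<and> \<phi> 0 = p \<and>
       (\<forall>t\<ge>0. norm (\<phi> t - q) \<le> C * exp (- \<gamma> * t) * norm (p - q))"
proof -
  interpret \<beta>: bounded_bilinear \<beta> by fact
  interpret A: bounded_linear A using A by (rule has_derivative_bounded_linear)
  obtain c where c: "c > 0" "\<And>x. x \<in> S \<Longrightarrow> c * (norm x)\<^sup>2 \<le> \<beta> x x"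
    using coercive_on_subspace[OF \<beta> S pos] by blast
  obtain K where K: "K > 0" "\<And>x y. norm (\<beta> x y) \<le> norm x * norm y * K"
    using \<beta>.pos_bounded by blast
  obtain M where M: "M > 0" "\<And>x. norm (A x) \<le> norm x * M" using A.pos_bounded by blast
  have AS: "A x \<in> S" for x by (rule derivative_in_subspace[OF A V(2) S])
  \<comment> \<open>A remainder of size \<kappa> |x| changes \<beta> by at most (\<alpha> -
    \<gamma>) c |x|^2 per slot, which coercivity bounds by (\<alpha> - \<gamma>) \<beta> x x:
    exactly the rate that is given up.\<close>
  define \<kappa> where "\<kappa> = (\<alpha> - \<gamma>) * c / K"
  have "\<kappa> > 0" using c K \<gamma> by (simp add: \<kappa>_def)
  then obtain d where d: "d > 0" "\<And>y. norm (y - q) < d \<Longrightarrow> norm (V y - V q - A (y - q)) \<le> \<kappa> * norm (y - q)"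
    using A unfolding has_derivative_at_alt by blast
  define r where "r = d / 2"
  have r: "r > 0" "r < d" using d(1) by (auto simp: r_def)
  let ?cl = "closest_point (cball (0::'a) r)"
  have cl_mem: "?cl x \<in> cball 0 r" for x by (rule closest_point_in_set) (use r in auto)
  have cl_lip: "norm (?cl x - ?cl y) \<le> norm (x - y)" for x y
    using closest_point_lipschitz[of "cball (0::'a) r" x y] r by (simp add: dist_norm)
  have cl_self: "?cl x = x" if "norm x \<le> r" for x by (rule closest_point_self) (use that in auto)
  have cl_norm: "norm (?cl x) \<le> norm x" for x using cl_lip[of x 0] cl_self[of 0] r by simp
  \<comment> \<open>The linear part is kept and only the nonlinear remainder is evaluated at the
    nearest point of the ball. As this projection is nonexpansive and fixes 0, the remainder is at
    most \<kappa> |p - q| on the whole space.\<close>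
  define W where "W p = A (p - q) + (V (q + ?cl (p - q)) - A (?cl (p - q)))" for p
  have WV: "norm (p - q) \<le> r \<Longrightarrow> W p = V p" for p by (simp add: W_def cl_self)
  have WS: "W p \<in> S" for p :: 'a by (auto simp: W_def intro!: subspace_add subspace_diff S AS V(2))
  obtain L where L: "L-lipschitz_on (cball 0 (norm q + r)) V"
    using V(1) by (auto simp: lipschitz_on_balls_def)
  have "L \<ge> 0" using L by (rule lipschitz_on_nonneg)
  have "(M + (L + M))-lipschitz_on UNIV W"
  proof (rule lipschitz_onI)
    fix p p' :: 'a
    let ?d = "norm (p - p')"
    have A1: "norm (A (p - q) - A (p' - q)) \<le> M * ?d"
      using M(2)[of "p - p'"] by (simp add: A.diff[symmetric] mult.commute)
    have A2: "norm (A (?cl (p - q)) - A (?cl (p' - q))) \<le> M * ?d"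
    proof -
      have "norm (A (?cl (p - q)) - A (?cl (p' - q))) \<le> norm (?cl (p - q) - ?cl (p' - q)) * M"
        using M(2) by (simp add: A.diff[symmetric])
      also have "\<dots> \<le> norm ((p - q) - (p' - q)) * M" by (rule mult_right_mono[OF cl_lip]) (use M in simp)
      finally show ?thesis by (simp add: mult.commute)
    qed
    have "q + ?cl x \<in> cball 0 (norm q + r)" for x
      using cl_mem[of x] norm_triangle_ineq[of q "?cl x"] by auto
    then have "norm (V (q + ?cl (p - q)) - V (q + ?cl (p' - q))) \<le> L * norm (?cl (p - q) - ?cl (p' - q))"
      using lipschitz_onD[OF L] by (fastforce simp: dist_norm)
    also have "\<dots> \<le> L * norm ((p - q) - (p' - q))" by (rule mult_left_mono[OF cl_lip \<open>L \<ge> 0\<close>])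
    finally have A3: "norm (V (q + ?cl (p - q)) - V (q + ?cl (p' - q))) \<le> L * ?d" by simp
    have "W p - W p' = (A (p - q) - A (p' - q)) + ((V (q + ?cl (p - q)) - V (q + ?cl (p' - q)))
        - (A (?cl (p - q)) - A (?cl (p' - q))))"
      by (simp add: W_def)
    also have "norm \<dots> \<le> M * ?d + (L * ?d + M * ?d)"
      by (rule norm_triangle_mono[OF A1 order_trans[OF norm_triangle_ineq4 add_mono[OF A3 A2]]])
    finally show "dist (W p) (W p') \<le> (M + (L + M)) * dist p p'"
      by (simp add: dist_norm algebra_simps)
  qed (use M \<open>L \<ge> 0\<close> in auto)
  note W_solution = lipschitz_global_solution[OF this]
  \<comment> \<open>The square root of the ratio of the bounds c |x|^2 \<le> \<beta> x x \<le> K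
    |x|^2. A start within \<open>r / C\<close> therefore keeps the trajectory in the ball of radius
    \<open>r\<close>.\<close>
  define C where "C = sqrt (K / c)"
  have "C > 0" using K c by (simp add: C_def)
  show ?thesis
  proof (rule that[OF \<open>C > 0\<close>, of "r / C"])
    show "r / C > 0" using r \<open>C > 0\<close> by simp
    fix p assume p: "p \<in> S" "norm (p - q) < r / C"
    obtain \<phi> where \<phi>: "is_solution W UNIV \<phi>" "\<phi> 0 = p" using W_solution by blast
    have \<phi>S: "is_solution W S \<phi>" by (rule solution_in_subspace[OF \<phi>(1) WS S]) (use \<phi> p in simp)
    have decay: "norm (\<phi> t - q) \<le> C * exp (- \<gamma> * t) * norm (p - q)" if "t \<ge> 0" for t
    proof -
      have "\<beta> (\<phi> t - q) (\<phi> t - q) \<le> exp (- 2 * \<gamma> * t) * \<beta> (\<phi> 0 - q) (\<phi> 0 - q)"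
      proof (rule quadratic_form_decay[OF \<beta> _ _ that])
        fix t :: real assume t: "t \<ge> 0"
        show "((\<lambda>t. \<phi> t - q) has_vector_derivative W (\<phi> t)) (at t within {0..})"
          using \<phi>(1) t by (auto simp: is_solution_def intro!: derivative_eq_intros)
        define x where "x = \<phi> t - q"
        have x: "x \<in> S" using \<phi>S t V(4) S by (auto simp: x_def is_solution_def intro: subspace_diff)
        define e where "e = V (q + ?cl x) - A (?cl x)"
        have "norm e \<le> \<kappa> * norm (?cl x)"
          using d(2)[of "q + ?cl x"] cl_mem[of x] r(2) V(3) by (simp add: e_def)
        also have "\<dots> \<le> \<kappa> * norm x" using cl_norm \<open>\<kappa> > 0\<close> by (intro mult_left_mono) auto
        finally have e: "norm e \<le> \<kappa> * norm x" .
        have be: "norm x * norm e * K \<le> (\<alpha> - \<gamma>) * \<beta> x x"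
        proof -
          have "norm x * norm e * K \<le> norm x * (\<kappa> * norm x) * K"
            using e K by (intro mult_right_mono mult_left_mono) auto
          also have "\<dots> = (\<alpha> - \<gamma>) * (c * (norm x)\<^sup>2)" using K by (simp add: \<kappa>_def power2_eq_square)
          also have "\<dots> \<le> (\<alpha> - \<gamma>) * \<beta> x x" using c(2)[OF x] \<gamma> by (intro mult_left_mono) auto
          finally show ?thesis .
        qed
        have "\<beta> x e \<le> (\<alpha> - \<gamma>) * \<beta> x x" "\<beta> e x \<le> (\<alpha> - \<gamma>) * \<beta> x x"
          using K(2)[of x e] K(2)[of e x] be by (auto simp: mult_ac)
        moreover have "W (\<phi> t) = A x + e" by (simp add: W_def x_def e_def)
        ultimately show "\<beta> (\<phi> t - q) (W (\<phi> t)) + \<beta> (W (\<phi> t)) (\<phi> t - q) \<le> - 2 * \<gamma> * \<beta> (\<phi> t - q) (\<phi> t - q)"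
          using decr[OF x] by (simp add: x_def[symmetric] \<beta>.add_left \<beta>.add_right algebra_simps)
      qed
      moreover have "c * (norm (\<phi> t - q))\<^sup>2 \<le> \<beta> (\<phi> t - q) (\<phi> t - q)"
        using \<phi>S that V(4) S by (intro c(2)) (auto simp: is_solution_def intro: subspace_diff)
      moreover have "\<beta> (\<phi> 0 - q) (\<phi> 0 - q) \<le> K * (norm (p - q))\<^sup>2"
        using K(2)[of "p - q" "p - q"] by (simp add: \<phi>(2) power2_eq_square mult_ac)
      ultimately have "c * (norm (\<phi> t - q))\<^sup>2 \<le> exp (- 2 * \<gamma> * t) * (K * (norm (p - q))\<^sup>2)"
        by (meson exp_ge_zero mult_left_mono order_trans)
      then have "(norm (\<phi> t - q))\<^sup>2 \<le> K / c * exp (- 2 * \<gamma> * t) * (norm (p - q))\<^sup>2"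
        using c(1) by (simp add: field_simps)
      also have "\<dots> = (C * exp (- \<gamma> * t) * norm (p - q))\<^sup>2"
      proof -
        have "C\<^sup>2 = K / c" using K c by (simp add: C_def)
        moreover have "(exp (- \<gamma> * t))\<^sup>2 = exp (- 2 * \<gamma> * t)" by (simp add: exp_double[symmetric])
        ultimately show ?thesis by (simp add: power_mult_distrib)
      qed
      finally show ?thesis by (rule power2_le_imp_le) (use \<open>C > 0\<close> in simp)
    qed
    have "norm (\<phi> t - q) \<le> r" if "t \<ge> 0" for t
    proof -
      have "C * exp (- \<gamma> * t) * norm (p - q) \<le> C * 1 * norm (p - q)"
        using that \<gamma> \<open>C > 0\<close> by (intro mult_right_mono mult_left_mono) auto
      also have "\<dots> \<le> r" using p(2) \<open>C > 0\<close> by (simp add: field_simps)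
      finally show ?thesis using decay[OF that] by simp
    qed
    then have "is_solution V S \<phi>" using \<phi>S WV by (simp add: is_solution_def)
    with \<phi>(2) decay show "\<exists>\<phi>. is_solution V S \<phi> \<and> \<phi> 0 = p \<and>
        (\<forall>t\<ge>0. norm (\<phi> t - q) \<le> C * exp (- \<gamma> * t) * norm (p - q))" by blast
  qed
qed

section \<open>The linear flow and its Lyapunov form\<close>

lemma linear_lipschitz_on_balls:
  fixes D :: "'a::real_normed_vector \<Rightarrow> 'b::real_normed_vector"
  assumes "bounded_linear D"
  shows "\<exists>L. L-lipschitz_on UNIV D" "lipschitz_on_balls D"
proof -
  interpret D: bounded_linear D by fact
  obtain K where K: "K > 0" "\<And>x. norm (D x) \<le> norm x * K" using D.pos_bounded by blast
  have "K-lipschitz_on UNIV D"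
    using K by (intro lipschitz_onI) (auto simp: dist_norm D.diff[symmetric] mult.commute)
  then show "\<exists>L. L-lipschitz_on UNIV D" "lipschitz_on_balls D"
    by (auto simp: lipschitz_on_balls_def intro: lipschitz_on_subset)
qed

text \<open>This is exp(t D) v for t \<ge> 0. Taken as a solution of the linear equation, it gets
  its linearity in v and its commutation with \<open>D\<close> from uniqueness of solutions;
  negative times are unspecified.\<close>

definition linear_flow :: "('a::euclidean_space \<Rightarrow> 'a) \<Rightarrow> 'a \<Rightarrow> real \<Rightarrow> 'a" where
  "linear_flow D v = (SOME y. is_solution D UNIV y \<and> y 0 = v)"

context
  fixes D :: "'a::euclidean_space \<Rightarrow> 'a"
  assumes D: "bounded_linear D"
begin

interpretation D: bounded_linear D by (rule D)

lemma linear_flow_solution: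
  "is_solution D UNIV (linear_flow D v)" "linear_flow D v 0 = v"
proof -
  obtain L where "L-lipschitz_on UNIV D" using linear_lipschitz_on_balls(1)[OF D] by blast
  from someI_ex[OF lipschitz_global_solution[OF this, of v]]
  show "is_solution D UNIV (linear_flow D v)" "linear_flow D v 0 = v"
    by (auto simp: linear_flow_def)
qed

lemma linear_flow_derivative:
  "t \<ge> 0 \<Longrightarrow> (linear_flow D v has_vector_derivative D (linear_flow D v t)) (at t within {0..})"
  using linear_flow_solution by (auto simp: is_solution_def)

lemma linear_flow_unique:
  assumes "is_solution D UNIV y" "t \<ge> 0"
  shows "linear_flow D (y 0) t = y t"
  by (rule solution_unique[OF linear_lipschitz_on_balls(2)[OF D] linear_flow_solution(1) assms(1)])
     (auto simp: linear_flow_solution assms)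

lemma linear_flow_add:
  assumes "t \<ge> 0" shows "linear_flow D (v + w) t = linear_flow D v t + linear_flow D w t"
proof -
  have "is_solution D UNIV (\<lambda>t. linear_flow D v t + linear_flow D w t)"
    unfolding is_solution_def D.add
    by (auto intro!: has_vector_derivative_add linear_flow_derivative)
  from linear_flow_unique[OF this assms] show ?thesis by (simp add: linear_flow_solution)
qed

lemma linear_flow_scaleR:
  assumes "t \<ge> 0" shows "linear_flow D (c *\<^sub>R v) t = c *\<^sub>R linear_flow D v t"
proof -
  have "is_solution D UNIV (\<lambda>t. c *\<^sub>R linear_flow D v t)"
    unfolding is_solution_def D.scaleR
    by (auto intro!: bounded_linear.has_vector_derivative[OF bounded_linear_scaleR_right] linear_flow_derivative)
  from linear_flow_unique[OF this assms] show ?thesis by (simp add: linear_flow_solution)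
qed

lemma linear_flow_commute:
  assumes "t \<ge> 0" shows "linear_flow D (D v) t = D (linear_flow D v t)"
proof -
  have "is_solution D UNIV (\<lambda>t. D (linear_flow D v t))"
    unfolding is_solution_def
    by (auto intro!: D.has_vector_derivative linear_flow_derivative)
  from linear_flow_unique[OF this assms] show ?thesis by (simp add: linear_flow_solution)
qed

lemma continuous_on_linear_flow: "continuous_on {0..T} (linear_flow D v)"
proof -
  have "continuous_on {0..} (linear_flow D v)"
    using has_vector_derivative_continuous[OF linear_flow_derivative]
    by (auto simp: continuous_on_eq_continuous_within)
  then show ?thesis by (rule continuous_on_subset) auto
qed

text \<open>The nonlinear trajectory from \<epsilon> v differs from the linear one at time
  \<open>T\<close> by at most \<epsilon> e, by Gronwall. Division by \<epsilon> transfers the decay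
  bound up to e, which is arbitrary.\<close>

lemma linear_flow_decay:
  assumes G: "(G has_derivative D) (at 0 within Y)" "G 0 = 0" and Y: "subspace Y" "v \<in> Y"
    and ex: "\<And>y0. y0 \<in> Y \<Longrightarrow> \<exists>y. is_solution G Y y \<and> y 0 = y0"
    and decay: "\<And>y t. is_solution G Y y \<Longrightarrow> t \<ge> 0 \<Longrightarrow> norm (y t) \<le> c * exp (- \<alpha> * t) * norm (y 0)"
    and "\<alpha> \<ge> 0" "T \<ge> 0"
  shows "norm (linear_flow D v T) \<le> c * exp (- \<alpha> * T) * norm v"
proof (rule field_le_epsilon)
  fix e :: real assume "e > 0"
  obtain K where K: "K > 0" "\<And>x. norm (D x) \<le> norm x * K" using D.pos_bounded by blast
  \<comment> \<open>The Gronwall factor times the size of the nonlinear trajectory, per unit of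
    \<epsilon>; \<kappa> is then chosen with \<kappa> M \<le> e.\<close>
  define M where "M = sqrt (exp ((2 * K + 1) * T) * T) * (\<bar>c\<bar> * norm v)"
  have "M \<ge> 0" using \<open>T \<ge> 0\<close> by (simp add: M_def)
  define \<kappa> where "\<kappa> = e / (M + 1)"
  have "\<kappa> > 0" using \<open>M \<ge> 0\<close> \<open>e > 0\<close> by (simp add: \<kappa>_def)
  have "\<kappa> * M \<le> e" using \<open>M \<ge> 0\<close> \<open>e > 0\<close> by (simp add: \<kappa>_def field_simps)
  obtain d where d: "d > 0" "\<And>y. y \<in> Y \<Longrightarrow> norm y < d \<Longrightarrow> norm (G y - D y) \<le> \<kappa> * norm y"
    using G(1) \<open>\<kappa> > 0\<close> unfolding has_derivative_within_alt by (auto simp: G(2))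
  \<comment> \<open>Keeps the trajectory from \<epsilon> v, whose norm never exceeds |c| \<epsilon>
    |v|, inside the ball where \<open>G\<close> is \<kappa>-close to \<open>D\<close>.\<close>
  define \<epsilon> where "\<epsilon> = d / (\<bar>c\<bar> * norm v + 1)"
  have ge: "\<bar>c\<bar> * norm v \<ge> 0" by simp
  have "\<epsilon> > 0" using d(1) ge by (simp add: \<epsilon>_def add_nonneg_pos del: mult_nonneg_nonneg)
  have small: "\<bar>c\<bar> * (\<epsilon> * norm v) < d" 
  proof -
    have "\<bar>c\<bar> * norm v + 1 \<noteq> 0" using ge by linarith
    then have "\<epsilon> * (\<bar>c\<bar> * norm v + 1) = d" by (simp add: \<epsilon>_def)
    with \<open>\<epsilon> > 0\<close> show ?thesis by (simp add: algebra_simps)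
  qed
  obtain y where y: "is_solution G Y y" "y 0 = \<epsilon> *\<^sub>R v" using ex subspace_scale[OF Y] by blast
  have y_bound: "norm (y t) \<le> \<bar>c\<bar> * (\<epsilon> * norm v)" if "t \<ge> 0" for t
  proof -
    have "norm (y t) \<le> (c * exp (- \<alpha> * t)) * norm (y 0)" by (rule decay[OF y(1) that])
    also have "\<dots> \<le> (\<bar>c\<bar> * 1) * norm (y 0)"
    proof (rule mult_right_mono)
      have "c * exp (- \<alpha> * t) \<le> \<bar>c\<bar> * exp (- \<alpha> * t)" by (intro mult_right_mono) auto
      also have "\<dots> \<le> \<bar>c\<bar> * 1" using that \<open>\<alpha> \<ge> 0\<close> by (intro mult_left_mono) auto
      finally show "c * exp (- \<alpha> * t) \<le> \<bar>c\<bar> * 1" .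
    qed simp
    finally show ?thesis using y(2) \<open>\<epsilon> > 0\<close> by simp
  qed
  let ?z = "\<lambda>t. linear_flow D (\<epsilon> *\<^sub>R v) t"
  have sub: "(u has_vector_derivative u') (at t within {0..T})"
    if "(u has_vector_derivative u') (at t within {0..})" for u :: "real \<Rightarrow> 'a" and u' t
    by (rule has_vector_derivative_within_subset[OF that]) auto
  have "(norm (y T - ?z T))\<^sup>2 \<le> exp ((2 * K + 1) * T) *
      ((norm (y 0 - ?z 0))\<^sup>2 + (\<kappa> * (\<bar>c\<bar> * (\<epsilon> * norm v)))\<^sup>2 * T)"
  proof (rule gronwall_square[OF \<open>T \<ge> 0\<close>, where y' = "\<lambda>t. G (y t) - D (?z t)"])
    fix t assume t: "t \<in> {0..T}"
    show "((\<lambda>t. y t - ?z t) has_vector_derivative G (y t) - D (?z t)) (at t within {0..T})"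
      using y(1) t linear_flow_derivative[of t]
      by (auto intro!: has_vector_derivative_diff sub simp: is_solution_def)
    have "norm (G (y t) - D (y t)) \<le> \<kappa> * norm (y t)"
      using d(2)[of "y t"] y(1) y_bound[of t] small t by (auto simp: is_solution_def)
    also have "\<dots> \<le> \<kappa> * (\<bar>c\<bar> * (\<epsilon> * norm v))"
      using y_bound[of t] t \<open>\<kappa> > 0\<close> by (intro mult_left_mono) auto
    finally have 1: "norm (G (y t) - D (y t)) \<le> \<kappa> * (\<bar>c\<bar> * (\<epsilon> * norm v))" .
    have 2: "norm (D (y t - ?z t)) \<le> K * norm (y t - ?z t)" using K(2)[of "y t - ?z t"] by (simp add: mult.commute)
    have "G (y t) - D (?z t) = D (y t - ?z t) + (G (y t) - D (y t))" by (simp add: D.diff)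
    then show "norm (G (y t) - D (?z t)) \<le> K * norm (y t - ?z t) + \<kappa> * (\<bar>c\<bar> * (\<epsilon> * norm v))"
      using norm_triangle_mono[OF 2 1] by (simp only:)
  qed (use K in simp)
  also have "\<dots> = exp ((2 * K + 1) * T) * T * (\<epsilon> * (\<kappa> * (\<bar>c\<bar> * norm v)))\<^sup>2"
    using y(2) by (simp add: linear_flow_solution algebra_simps)
  also have "\<dots> = (\<epsilon> * (\<kappa> * M))\<^sup>2"
    using \<open>T \<ge> 0\<close> by (simp add: M_def power_mult_distrib)
  finally have "norm (y T - ?z T) \<le> \<epsilon> * (\<kappa> * M)"
    by (rule power2_le_imp_le) (use \<open>\<epsilon> > 0\<close> \<open>\<kappa> > 0\<close> \<open>M \<ge> 0\<close> in simp)
  also have "\<dots> \<le> \<epsilon> * e" using \<open>\<kappa> * M \<le> e\<close> \<open>\<epsilon> > 0\<close> by simp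
  finally have "norm (?z T) \<le> norm (y T) + \<epsilon> * e"
    using norm_triangle_ineq2[of "?z T" "y T"] by (simp add: norm_minus_commute)
  also have "norm (y T) \<le> c * exp (- \<alpha> * T) * (\<epsilon> * norm v)"
    using decay[OF y(1) \<open>T \<ge> 0\<close>] y(2) \<open>\<epsilon> > 0\<close> by simp
  finally have "\<epsilon> * norm (linear_flow D v T) \<le> \<epsilon> * (c * exp (- \<alpha> * T) * norm v + e)"
    using \<open>\<epsilon> > 0\<close> \<open>T \<ge> 0\<close> by (simp add: linear_flow_scaleR algebra_simps)
  then show "norm (linear_flow D v T) \<le> c * exp (- \<alpha> * T) * norm v + e"
    using \<open>\<epsilon> > 0\<close> by simp
qed

text \<open>Lyapunov's integral, cut off at a finite time so that no convergence is at issue. Since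
  \<open>D\<close> commutes with its flow, the derivative of the form in direction
  \<open>D v\<close> integrates a total time derivative: only the boundary values at 0 and
  \<open>T\<close> and the contribution of the weight remain.\<close>

lemma truncated_lyapunov_form:
  fixes T \<alpha> :: real
  assumes "T > 0"
  defines "b \<equiv> \<lambda>v w. integral {0..T} (\<lambda>t. exp (2 * \<alpha> * t) * (linear_flow D v t \<bullet> linear_flow D w t))"
  shows "bounded_bilinear b" and "v \<noteq> 0 \<Longrightarrow> b v v > 0"
    and "b v (D v) + b (D v) v = exp (2 * \<alpha> * T) * (norm (linear_flow D v T))\<^sup>2 - (norm v)\<^sup>2 - 2 * \<alpha> * b v v"
proof -
  let ?f = "\<lambda>v w t. exp (2 * \<alpha> * t) * (linear_flow D v t \<bullet> linear_flow D w t)"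
  have cont: "continuous_on {0..T} (?f v w)" for v w
    by (intro continuous_intros continuous_on_linear_flow)
  have int: "?f v w integrable_on {0..T}" for v w
    by (intro integrable_continuous_real cont)
  have add1: "b (v + v') w = b v w + b v' w" for v v' w
  proof -
    have "b (v + v') w = integral {0..T} (\<lambda>t. ?f v w t + ?f v' w t)"
      unfolding b_def by (intro integral_cong) (simp add: linear_flow_add inner_add_left distrib_left)
    then show ?thesis unfolding b_def by (simp add: integral_add[OF int int])
  qed
  have scale1: "b (r *\<^sub>R v) w = r * b v w" for r v w
  proof -
    have "b (r *\<^sub>R v) w = integral {0..T} (\<lambda>t. r * ?f v w t)"
      unfolding b_def by (intro integral_cong) (simp add: linear_flow_scaleR)
    then show ?thesis unfolding b_def by simp
  qed
  have sym: "b v w = b w v" for v w unfolding b_def by (simp add: inner_commute)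
  have lin: "linear (\<lambda>v. b v w)" for w by (intro linearI) (simp_all add: add1 scale1)
  moreover have "linear (\<lambda>w. b v w)" for v using lin[of v] by (simp add: sym[of v])
  ultimately have "bilinear b" by (simp add: bilinear_def)
  then show "bounded_bilinear b" by (simp add: bilinear_conv_bounded_bilinear)
  show "b v v > 0" if "v \<noteq> 0"
  proof -
    have "b v v \<ge> 0" unfolding b_def by (intro integral_nonneg int) auto
    moreover have "b v v \<noteq> 0"
    proof
      assume "b v v = 0"
      then have "\<forall>t\<in>{0..T}. ?f v v t = 0"
        unfolding b_def using integral_eq_0_iff[OF cont[of v v] \<open>T > 0\<close>] by simp
      from bspec[OF this, of 0] \<open>T > 0\<close> that show False by (simp add: linear_flow_solution)
    qed
    ultimately show ?thesis by simp
  qed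
  have "((\<lambda>t. ?f v (D v) t + ?f (D v) v t + 2 * \<alpha> * ?f v v t) has_integral (?f v v T - ?f v v 0)) {0..T}"
  proof (rule fundamental_theorem_of_calculus)
    fix t assume t: "t \<in> {0..T}"
    have d: "(linear_flow D v has_derivative (\<lambda>h. h *\<^sub>R D (linear_flow D v t))) (at t within {0..T})"
      using has_vector_derivative_within_subset[OF linear_flow_derivative, of t "{0..T}"] t
      by (auto simp: has_vector_derivative_def)
    show "(?f v v has_vector_derivative ?f v (D v) t + ?f (D v) v t + 2 * \<alpha> * ?f v v t) (at t within {0..T})"
      unfolding has_vector_derivative_def
      by (rule derivative_eq_intros d refl | simp)+
         (use t in \<open>auto simp: fun_eq_iff linear_flow_commute algebra_simps\<close>)
  qed (use \<open>T > 0\<close> in simp)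
  moreover have "((\<lambda>t. ?f v (D v) t + ?f (D v) v t + 2 * \<alpha> * ?f v v t) has_integral
      (b v (D v) + b (D v) v + 2 * \<alpha> * b v v)) {0..T}"
    unfolding b_def by (intro has_integral_add has_integral_mult_right integrable_integral int)
  ultimately have "b v (D v) + b (D v) v + 2 * \<alpha> * b v v = ?f v v T - ?f v v 0"
    by (rule has_integral_unique[symmetric])
  then show "b v (D v) + b (D v) v = exp (2 * \<alpha> * T) * (norm (linear_flow D v T))\<^sup>2 - (norm v)\<^sup>2 - 2 * \<alpha> * b v v"
    by (simp add: linear_flow_solution power2_norm_eq_inner)
qed

end

text \<open>For starts in \<open>Y\<close>, the weighted flow at the cut-off time is no longer than
  its start, so the two boundary terms of the truncated integral add up to something
  nonpositive.\<close>

lemma exp_stable_lyapunov_form: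
  fixes G :: "'a::euclidean_space \<Rightarrow> 'a"
  assumes G: "(G has_derivative D) (at 0 within Y)" "G 0 = 0" and Y: "subspace Y"
    and stable: "globally_exp_stable G Y \<alpha>G" and \<alpha>: "0 < \<alpha>G" "\<alpha> < \<alpha>G"
  obtains b where "bounded_bilinear b" "\<And>y. y \<noteq> 0 \<Longrightarrow> b y y > 0"
    "\<And>y. y \<in> Y \<Longrightarrow> b y (D y) + b (D y) y \<le> - 2 * \<alpha> * b y y"
proof -
  have D: "bounded_linear D" using G(1) by (rule has_derivative_bounded_linear)
  obtain c where ex: "\<And>y0. y0 \<in> Y \<Longrightarrow> \<exists>y. is_solution G Y y \<and> y 0 = y0"
    and decay: "\<And>y t. is_solution G Y y \<Longrightarrow> t \<ge> 0 \<Longrightarrow> norm (y t) \<le> c * exp (- \<alpha>G * t) * norm (y 0)"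
    using stable unfolding globally_exp_stable_def by blast
  \<comment> \<open>By 1 + x \<le> exp x this makes c \<le> exp((\<alpha>G - \<alpha>) T), so the
    gap between the rates absorbs c.\<close>
  define T where "T = (\<bar>c\<bar> + 1) / (\<alpha>G - \<alpha>)"
  have "T > 0" using \<alpha> by (simp add: T_def add_nonneg_pos)
  have "c \<le> exp ((\<alpha>G - \<alpha>) * T)"
    using exp_ge_add_one_self[of "(\<alpha>G - \<alpha>) * T"] \<alpha> by (simp add: T_def)
  then have "exp (\<alpha> * T) * (c * exp (- \<alpha>G * T)) \<le> exp (\<alpha> * T) * (exp ((\<alpha>G - \<alpha>) * T) * exp (- \<alpha>G * T))"
    by (intro mult_left_mono mult_right_mono) auto
  also have "\<dots> = 1" by (simp add: exp_add[symmetric] algebra_simps)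
  finally have T: "exp (\<alpha> * T) * (c * exp (- \<alpha>G * T)) \<le> 1" .
  note b = truncated_lyapunov_form[OF D \<open>T > 0\<close>, where \<alpha> = \<alpha>]
  show ?thesis
  proof (rule that[OF b(1,2)])
    fix y assume "y \<in> Y"
    have "norm (linear_flow D y T) \<le> c * exp (- \<alpha>G * T) * norm y"
      by (rule linear_flow_decay[OF D G Y \<open>y \<in> Y\<close> ex decay]) (use \<alpha> \<open>T > 0\<close> in auto)
    then have "exp (\<alpha> * T) * norm (linear_flow D y T) \<le> exp (\<alpha> * T) * (c * exp (- \<alpha>G * T) * norm y)"
      by (intro mult_left_mono) auto
    also have "\<dots> \<le> 1 * norm y" using mult_right_mono[OF T, of "norm y"] by (simp add: mult.assoc)
    finally have "(exp (\<alpha> * T) * norm (linear_flow D y T))\<^sup>2 \<le> (norm y)\<^sup>2" by (intro power_mono) auto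
    moreover have "(exp (\<alpha> * T))\<^sup>2 = exp (2 * \<alpha> * T)" by (simp add: exp_double[symmetric])
    ultimately have "exp (2 * \<alpha> * T) * (norm (linear_flow D y T))\<^sup>2 \<le> (norm y)\<^sup>2" by (simp add: power_mult_distrib)
    then show "integral {0..T} (\<lambda>t. exp (2 * \<alpha> * t) * (linear_flow D y t \<bullet> linear_flow D (D y) t))
        + integral {0..T} (\<lambda>t. exp (2 * \<alpha> * t) * (linear_flow D (D y) t \<bullet> linear_flow D y t))
        \<le> - 2 * \<alpha> * integral {0..T} (\<lambda>t. exp (2 * \<alpha> * t) * (linear_flow D y t \<bullet> linear_flow D y t))"
      using b(3)[of y] by linarith
  qed
qed

section \<open>Lyapunov forms for saddle systems\<close>

lemma bounded_bilinear_add: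
  assumes "bounded_bilinear f" "bounded_bilinear g"
  shows "bounded_bilinear (\<lambda>x y. f x y + g x y)"
proof -
  interpret f: bounded_bilinear f by fact
  interpret g: bounded_bilinear g by fact
  obtain K L where K: "\<And>x y. norm (f x y) \<le> norm x * norm y * K" and L: "\<And>x y. norm (g x y) \<le> norm x * norm y * L"
    using f.bounded g.bounded by blast
  show ?thesis
  proof
    have "norm (f x y + g x y) \<le> norm x * norm y * (K + L)" for x y
      using norm_triangle_mono[OF K L] by (simp add: distrib_left)
    then show "\<exists>K. \<forall>x y. norm (f x y + g x y) \<le> norm x * norm y * K" by blast
  qed (simp_all add: f.add_left f.add_right g.add_left g.add_right f.scaleR_left f.scaleR_right
      g.scaleR_left g.scaleR_right scaleR_add_right)
qed

lemma orthogonal_projection_exists: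
  fixes S :: "'a::euclidean_space set"
  assumes "subspace S"
  obtains P where "bounded_linear P" "\<And>x. P x \<in> S" "\<And>x y. y \<in> S \<Longrightarrow> (x - P x) \<bullet> y = 0"
proof -
  obtain B where B: "B \<subseteq> S" "pairwise orthogonal B" "\<And>x. x \<in> B \<Longrightarrow> norm x = 1"
    "independent B" "span B = S"
    using orthonormal_basis_subspace[OF assms] by metis
  have fin: "finite B" using B(4) by (rule finiteI_independent)
  define P where "P x = (\<Sum>b\<in>B. (x \<bullet> b) *\<^sub>R b)" for x
  show ?thesis
  proof (rule that[of P])
    show "bounded_linear P" unfolding P_def
      by (intro bounded_linear_sum bounded_linear_scaleR_const bounded_linear_inner_left)
    show "P x \<in> S" for x unfolding P_def using B(1) assms by (intro subspace_sum subspace_scale) auto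
    fix x y assume "y \<in> S"
    have "orthogonal (x - P x) c" if "c \<in> B" for c
    proof -
      have "P x \<bullet> c = (\<Sum>b\<in>B. if b = c then x \<bullet> c else 0)"
        unfolding P_def inner_sum_left
        using B(2,3) that by (intro sum.cong) (auto simp: pairwise_def orthogonal_def norm_eq_1)
      then show ?thesis using fin that by (simp add: orthogonal_def inner_diff_left)
    qed
    then have "orthogonal (x - P x) y" using orthogonal_to_span[of y B] B(5) \<open>y \<in> S\<close> by blast
    then show "(x - P x) \<bullet> y = 0" by (simp add: orthogonal_def)
  qed
qed

lemma weighted_am_gm:
  fixes c :: real
  assumes "e > 0"
  shows "c * x * y \<le> e / 2 * x\<^sup>2 + c\<^sup>2 / (2 * e) * y\<^sup>2"
proof -
  have "0 \<le> (e * x - c * y)\<^sup>2 / (2 * e)" using assms by simp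
  also have "\<dots> = e / 2 * x\<^sup>2 + c\<^sup>2 / (2 * e) * y\<^sup>2 - c * x * y"
    using assms by (simp add: field_simps power2_eq_square)
  finally show ?thesis by simp
qed

text \<open>The weight \<open>a\<close> absorbs the one-sided coupling of \<open>n\<close> to \<open>p\<close>; only then is \<open>k\<close> chosen,
  which absorbs every term that contains the fast variable \<open>u\<close>.\<close>
lemma cascade_weights:
  fixes c e1 e2 :: real
  assumes "e1 > 0" "e2 > 0" "c \<ge> 0"
  obtains a k where "a > 0" "k > 0"
    "\<And>s n p u. s \<ge> k \<Longrightarrow> c * n * p + c * n * u + (a + 1) * c * p * u + c * u\<^sup>2
        \<le> e1 * n\<^sup>2 + a * (e2 * p\<^sup>2) + s * u\<^sup>2"
proof -
  \<comment> \<open>Large enough that c^2 / (2 e1) \<le> a e2 / 2: the p^2 left over from the n-p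
    coupling uses half of the budget for p.\<close>
  define a where "a = c\<^sup>2 / (e1 * e2) + 1"
  have a: "a > 0" using assms by (simp add: a_def add_nonneg_pos)
  \<comment> \<open>The sum of all u^2 terms left over from the n-u and p-u couplings and from the
    term c u^2.\<close>
  define k where "k = c\<^sup>2 / (2 * e1) + ((a + 1) * c)\<^sup>2 / (2 * (a * e2)) + c + 1"
  have k: "k > 0" using assms a by (simp add: k_def add_nonneg_pos)
  show ?thesis
  proof (rule that[OF a k])
    fix s n p u :: real assume "s \<ge> k"
    have "c\<^sup>2 / (2 * e1) \<le> a * e2 / 2" using assms by (simp add: a_def field_simps)
    then have "c\<^sup>2 / (2 * e1) * p\<^sup>2 \<le> a * e2 / 2 * p\<^sup>2" by (rule mult_right_mono) simp
    then have 1: "c * n * p \<le> e1 / 2 * n\<^sup>2 + a * e2 / 2 * p\<^sup>2"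
      using weighted_am_gm[OF assms(1), of c n p] by linarith
    have 2: "c * n * u \<le> e1 / 2 * n\<^sup>2 + c\<^sup>2 / (2 * e1) * u\<^sup>2" by (rule weighted_am_gm[OF assms(1)])
    have 3: "(a + 1) * c * p * u \<le> a * e2 / 2 * p\<^sup>2 + ((a + 1) * c)\<^sup>2 / (2 * (a * e2)) * u\<^sup>2"
      using weighted_am_gm[of "a * e2" "(a + 1) * c" p u] a assms by simp
    have "k * u\<^sup>2 \<le> s * u\<^sup>2" using \<open>s \<ge> k\<close> by (rule mult_right_mono) simp
    then have 4: "c\<^sup>2 / (2 * e1) * u\<^sup>2 + ((a + 1) * c)\<^sup>2 / (2 * (a * e2)) * u\<^sup>2 + c * u\<^sup>2 + u\<^sup>2 \<le> s * u\<^sup>2"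
      by (simp add: k_def algebra_simps)
    have "u\<^sup>2 \<ge> 0" by simp
    have "e1 * n\<^sup>2 = e1 / 2 * n\<^sup>2 + e1 / 2 * n\<^sup>2" "a * (e2 * p\<^sup>2) = a * e2 / 2 * p\<^sup>2 + a * e2 / 2 * p\<^sup>2"
      by simp_all
    with 1 2 3 4 \<open>u\<^sup>2 \<ge> 0\<close>
    show "c * n * p + c * n * u + (a + 1) * c * p * u + c * u\<^sup>2 \<le> e1 * n\<^sup>2 + a * (e2 * p\<^sup>2) + s * u\<^sup>2"
      by linarith
  qed
qed

lemma injective_coercive:
  fixes F :: "'a::euclidean_space \<Rightarrow> 'b::euclidean_space"
  assumes F: "bounded_linear F" and S: "subspace S" and inj: "\<And>x. x \<in> S \<Longrightarrow> x \<noteq> 0 \<Longrightarrow> F x \<noteq> 0"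
  obtains c where "c > 0" "\<And>x. x \<in> S \<Longrightarrow> c * (norm x)\<^sup>2 \<le> (norm (F x))\<^sup>2"
proof -
  obtain c where "c > 0" "\<And>x. x \<in> S \<Longrightarrow> c * (norm x)\<^sup>2 \<le> F x \<bullet> F x"
    using coercive_on_subspace[OF bounded_bilinear.comp[OF bounded_bilinear_inner F F] S] inj
    by (auto simp: inner_gt_zero_iff)
  then show ?thesis by (intro that) (auto simp: power2_norm_eq_inner)
qed

text \<open>In the coordinates \<open>n\<close> (the projection of \<open>x\<close> to the kernel of \<open>B\<close>), \<open>p = - \<tau> \<zeta>\<close> and
  \<open>u = B x + \<tau> \<zeta>\<close>, the system is a cascade: \<open>p\<close> obeys \<open>p' = D p + D u\<close>, \<open>u\<close> contracts at
  rate of order \<open>1 / \<tau>\<close>, and \<open>n\<close> obeys the projected dynamics \<open>n' = - H n\<close> up to terms in \<open>p, u\<close>.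
  The weighted sum of the three quadratic forms is the Lyapunov function.\<close>
lemma saddle_lyapunov_form:
  fixes B :: "'x::euclidean_space \<Rightarrow> 'y::euclidean_space"
  assumes B: "bounded_linear B" "\<And>x. B x \<in> Y" and Y: "subspace Y"
    and T: "bounded_linear T" "\<And>u w. u \<bullet> T w = T u \<bullet> w" "\<And>y. y \<noteq> 0 \<Longrightarrow> y \<bullet> T y > 0"
    and inj: "\<And>y. y \<in> Y \<Longrightarrow> y \<noteq> 0 \<Longrightarrow> adjoint B (T y) \<noteq> 0"
    and D: "bounded_linear D" and H: "bounded_linear H"
    and b: "bounded_bilinear b" "\<And>y. y \<noteq> 0 \<Longrightarrow> b y y > (0::real)"
      "\<And>y. y \<in> Y \<Longrightarrow> b y (D y) + b (D y) y \<le> - 2 * \<mu> * b y y"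
    and H_pos: "\<And>n. B n = 0 \<Longrightarrow> \<rho> * (norm n)\<^sup>2 \<le> n \<bullet> H n"
    and \<alpha>: "\<alpha> < \<rho>" "\<alpha> < \<mu>"
  obtains \<tau>s where "\<tau>s > 0"
    "\<And>\<tau>. 0 < \<tau> \<Longrightarrow> \<tau> < \<tau>s \<Longrightarrow> \<exists>\<beta>. bounded_bilinear \<beta> \<and> (\<forall>\<xi>. \<xi> \<noteq> 0 \<longrightarrow> \<beta> \<xi> \<xi> > (0::real)) \<and>
      (\<forall>x \<zeta> \<xi>'. \<zeta> \<in> Y \<longrightarrow> \<xi>' = (- H x - adjoint B (T ((1 / \<tau>) *\<^sub>R B x + \<zeta>)), - (1 / \<tau>) *\<^sub>R D (B x))
        \<longrightarrow> \<beta> (x, \<zeta>) \<xi>' + \<beta> \<xi>' (x, \<zeta>) \<le> - 2 * \<alpha> * \<beta> (x, \<zeta>) (x, \<zeta>))"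
proof -
  interpret B: bounded_linear B by fact
  interpret T: bounded_linear T by fact
  interpret D: bounded_linear D by fact
  interpret H: bounded_linear H by fact
  interpret b: bounded_bilinear b by fact
  have linB: "linear B" using B(1) by (rule bounded_linear.linear)
  define B' where "B' = adjoint B"
  have adj: "x \<bullet> B' y = B x \<bullet> y" for x y by (simp add: B'_def adjoint_works[OF linB])
  have B': "bounded_linear B'"
    unfolding B'_def using adjoint_linear[OF linB] by (simp add: linear_conv_bounded_linear)
  interpret B': bounded_linear B' by (rule B')
  let ?N = "{x. B x = 0}"
  have N: "subspace ?N" by (rule linear_subspace_kernel[OF linB])
  obtain P where P: "bounded_linear P" "\<And>x. P x \<in> ?N" "\<And>x y. y \<in> ?N \<Longrightarrow> (x - P x) \<bullet> y = 0"
    using orthogonal_projection_exists[OF N] by blast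
  interpret P: bounded_linear P by (rule P)
  have BP: "B (P x) = 0" for x using P(2)[of x] by simp
  have Pin: "P x \<bullet> P y = P x \<bullet> y" for x y
    using P(3)[OF P(2), of y x] by (metis eq_iff_diff_eq_0 inner_commute inner_diff_left)
  \<comment> \<open>On the orthogonal complement of the kernel, \<open>B\<close> is injective. Hence
    the part of x outside the kernel is controlled by |B x|, that is, by p and u.\<close>
  let ?E = "{x. \<forall>n\<in>?N. x \<bullet> n = 0}"
  have E: "subspace ?E" by (auto simp: subspace_def inner_add_left)
  obtain c1 where c1: "c1 > 0" "\<And>x. x \<in> ?E \<Longrightarrow> c1 * (norm x)\<^sup>2 \<le> (norm (B x))\<^sup>2"
    by (rule injective_coercive[OF B(1) E]) auto
  define k where "k = 1 / sqrt c1"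
  have k: "k > 0" using c1 by (simp add: k_def)
  have e_bound: "norm (x - P x) \<le> k * norm (B x)" for x
  proof -
    have "c1 * (norm (x - P x))\<^sup>2 \<le> (norm (B x))\<^sup>2"
      using c1(2)[of "x - P x"] P(3) by (simp add: B.diff BP)
    then have "(sqrt c1 * norm (x - P x))\<^sup>2 \<le> (norm (B x))\<^sup>2" using c1(1) by (simp add: power_mult_distrib)
    then have "sqrt c1 * norm (x - P x) \<le> norm (B x)" by (rule power2_le_imp_le) simp
    then show ?thesis using c1(1) by (simp add: k_def field_simps)
  qed
  \<comment> \<open>This is where injectivity on \<open>Y\<close> enters: it makes the dissipation
    of the fast variable at least (\<sigma> / \<tau>) |u|^2.\<close>
  obtain \<sigma> where \<sigma>: "\<sigma> > 0" "\<And>y. y \<in> Y \<Longrightarrow> \<sigma> * (norm y)\<^sup>2 \<le> (norm (B' (T y)))\<^sup>2"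
    by (rule injective_coercive[OF bounded_linear_compose[OF B' T(1)] Y]) (use inj B'_def in auto)
  obtain c2 where c2: "c2 > 0" "\<And>y. c2 * (norm y)\<^sup>2 \<le> b y y"
    using coercive_on_subspace[OF b(1) subspace_UNIV] b(2) by auto
  obtain hH where hH: "hH > 0" "\<And>x. norm (H x) \<le> norm x * hH" using H.pos_bounded by blast
  obtain hB where hB: "hB > 0" "\<And>x. norm (B x) \<le> norm x * hB" using B.pos_bounded by blast
  obtain hD where hD: "hD > 0" "\<And>x. norm (D x) \<le> norm x * hD" using D.pos_bounded by blast
  obtain hT where hT: "hT > 0" "\<And>x. norm (T x) \<le> norm x * hT" using T.pos_bounded by blast
  obtain hb where hb: "hb > 0" "\<And>x y. norm (b x y) \<le> norm x * norm y * hb" using b.pos_bounded by blast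
  \<comment> \<open>One constant dominating every coupling coefficient in the estimates
    \<open>t1\<close> to \<open>t4\<close>; it does not involve \<tau>.\<close>
  define c where "c = hH * k + hb * hD + hT * (hB * hH + hB * hH * k + hD) + \<bar>\<alpha>\<bar> * hT"
  have pos: "hH * k > 0" "hb * hD > 0" "hT * (hB * hH) > 0" "hT * (hB * hH * k) > 0" "hT * hD > 0" "\<bar>\<alpha>\<bar> * hT \<ge> 0"
    using hH hB hD hT hb k by auto
  have c_def': "c = hH * k + hb * hD + hT * (hB * hH) + hT * (hB * hH * k) + hT * hD + \<bar>\<alpha>\<bar> * hT"
    by (simp add: c_def algebra_simps)
  have c: "c \<ge> 0" "hH * k \<le> c" "hb * hD \<le> c" "hT * (hB * hH) \<le> c" "hT * (hB * hH * k + hD) \<le> c" "\<bar>\<alpha>\<bar> * hT \<le> c"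
    using pos unfolding c_def' distrib_left by linarith+
  have ac: "\<rho> - \<alpha> > 0" "(\<mu> - \<alpha>) * c2 > 0" "2 * c \<ge> 0" using \<alpha> c2 c by auto
  \<comment> \<open>The constant is doubled because the n-u coupling appears in both the slow and
    the fast estimate, and u^2 appears in both \<open>t3\<close> and \<open>t4\<close>.\<close>
  obtain a K where a: "a > 0" and K: "K > 0"
    and young: "\<And>s n p u. s \<ge> K \<Longrightarrow> 2 * c * n * p + 2 * c * n * u + (a + 1) * (2 * c) * p * u + 2 * c * u\<^sup>2
        \<le> (\<rho> - \<alpha>) * n\<^sup>2 + a * ((\<mu> - \<alpha>) * c2 * p\<^sup>2) + s * u\<^sup>2"
    using cascade_weights[OF ac] by metis
  show ?thesis
  proof (rule that[of "\<sigma> / K"])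
    show "\<sigma> / K > 0" using \<sigma> K by simp
    fix \<tau> :: real assume \<tau>: "0 < \<tau>" "\<tau> < \<sigma> / K"
    then have s: "K \<le> \<sigma> / \<tau>" using K by (simp add: field_simps)
    \<comment> \<open>The weight \<open>a\<close> is written as \<open>sqrt a\<close> in both slots,
      so that each summand is a bilinear form composed with linear maps.\<close>
    define \<beta> where "\<beta> \<xi> \<xi>' = P (fst \<xi>) \<bullet> P (fst \<xi>') + (b (sqrt a *\<^sub>R \<tau> *\<^sub>R snd \<xi>) (sqrt a *\<^sub>R \<tau> *\<^sub>R snd \<xi>')
        + (B (fst \<xi>) + \<tau> *\<^sub>R snd \<xi>) \<bullet> T (B (fst \<xi>') + \<tau> *\<^sub>R snd \<xi>'))" for \<xi> \<xi>' :: "'x \<times> 'y"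
    have \<beta>_eq: "\<beta> (x, \<zeta>) (x', \<zeta>') = P x \<bullet> P x' + (a * b (\<tau> *\<^sub>R \<zeta>) (\<tau> *\<^sub>R \<zeta>')
        + (B x + \<tau> *\<^sub>R \<zeta>) \<bullet> T (B x' + \<tau> *\<^sub>R \<zeta>'))" for x x' \<zeta> \<zeta>'
      using a by (simp add: \<beta>_def b.scaleR_left b.scaleR_right mult.assoc[symmetric])
    have \<beta>: "bounded_bilinear \<beta>"
      unfolding \<beta>_def
      by (intro bounded_bilinear_add bounded_bilinear.comp[OF bounded_bilinear_inner]
          bounded_bilinear.comp[OF b(1)] bounded_linear_compose[OF P(1)] bounded_linear_compose[OF T(1)]
          bounded_linear_add bounded_linear_compose[OF B(1)] bounded_linear_fst bounded_linear_snd
          bounded_linear_const_scaleR bounded_linear_compose[OF bounded_linear_scaleR_right])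
    have T_nonneg: "y \<bullet> T y \<ge> 0" for y using T(3)[of y] by (cases "y = 0") (auto simp: T.zero less_imp_le)
    have b_nonneg: "b y y \<ge> 0" for y using b(2)[of y] by (cases "y = 0") (auto simp: b.zero_left less_imp_le)
    have \<beta>_pos: "\<beta> \<xi> \<xi> > 0" if "\<xi> \<noteq> 0" for \<xi>
    proof (rule ccontr)
      obtain x \<zeta> where [simp]: "\<xi> = (x, \<zeta>)" by (cases \<xi>)
      assume "\<not> \<beta> \<xi> \<xi> > 0"
      moreover have "P x \<bullet> P x \<ge> 0" "a * b (\<tau> *\<^sub>R \<zeta>) (\<tau> *\<^sub>R \<zeta>) \<ge> 0" "(B x + \<tau> *\<^sub>R \<zeta>) \<bullet> T (B x + \<tau> *\<^sub>R \<zeta>) \<ge> 0"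
        using a b_nonneg T_nonneg by auto
      ultimately have 0: "P x \<bullet> P x = 0" "a * b (\<tau> *\<^sub>R \<zeta>) (\<tau> *\<^sub>R \<zeta>) = 0" "(B x + \<tau> *\<^sub>R \<zeta>) \<bullet> T (B x + \<tau> *\<^sub>R \<zeta>) = 0"
        unfolding \<open>\<xi> = (x, \<zeta>)\<close> \<beta>_eq by linarith+
      have "\<tau> *\<^sub>R \<zeta> = 0" using 0(2) b(2)[of "\<tau> *\<^sub>R \<zeta>"] a by auto
      then have "\<zeta> = 0" using \<tau> by simp
      moreover have "B x = 0" using 0(3) T(3)[of "B x"] \<open>\<zeta> = 0\<close> by auto
      moreover have "P x = 0" using 0(1) by simp
      ultimately show False using e_bound[of x] that by (simp add: zero_prod_def)
    qed
    have "\<beta> (x, \<zeta>) \<xi>' + \<beta> \<xi>' (x, \<zeta>) \<le> - 2 * \<alpha> * \<beta> (x, \<zeta>) (x, \<zeta>)"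
      if \<zeta>: "\<zeta> \<in> Y" and \<xi>': "\<xi>' = (- H x - B' (T ((1 / \<tau>) *\<^sub>R B x + \<zeta>)), - (1 / \<tau>) *\<^sub>R D (B x))" for x \<zeta> \<xi>'
    proof -
      define n p u where "n = P x" and "p = - \<tau> *\<^sub>R \<zeta>" and "u = B x + \<tau> *\<^sub>R \<zeta>"
      have Bx: "B x = p + u" by (simp add: p_def u_def)
      have mem: "p \<in> Y" "u \<in> Y" using B(2) \<zeta> Y by (auto simp: p_def u_def intro!: subspace_scale subspace_add subspace_neg)
      define x' where "x' = - H x - B' (T ((1 / \<tau>) *\<^sub>R B x + \<zeta>))"
      \<comment> \<open>The whole feedback is a function of u divided by \<tau>, which is what makes
        u the fast variable.\<close>
      have scaled: "(1 / \<tau>) *\<^sub>R B x + \<zeta> = (1 / \<tau>) *\<^sub>R u" using \<tau> by (simp add: u_def scaleR_add_right)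
      have x': "x' = - H x - (1 / \<tau>) *\<^sub>R B' (T u)" by (simp only: x'_def scaled T.scaleR B'.scaleR)
      define u' where "u' = B x' + - D (B x)"
      have u'_eq: "B x' + \<tau> *\<^sub>R (- (1 / \<tau>) *\<^sub>R D (B x)) = u'" using \<tau> by (simp add: u'_def)
      have p'_eq: "\<tau> *\<^sub>R (- (1 / \<tau>) *\<^sub>R D (B x)) = - D (B x)" using \<tau> by simp
      have \<tau>\<zeta>: "\<tau> *\<^sub>R \<zeta> = - p" by (simp add: p_def)
      have \<xi>'': "\<xi>' = (x', - (1 / \<tau>) *\<^sub>R D (B x))" by (simp add: \<xi>' x'_def)
      have lhs: "\<beta> (x, \<zeta>) \<xi>' + \<beta> \<xi>' (x, \<zeta>) = 2 * (n \<bullet> x') + a * (b p (D (B x)) + b (D (B x)) p) + 2 * (T u \<bullet> u')"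
      proof -
        have 1: "\<beta> (x, \<zeta>) \<xi>' = n \<bullet> x' + (a * b p (D (B x)) + T u \<bullet> u')"
          unfolding \<xi>'' \<beta>_eq u'_eq p'_eq u_def[symmetric] Pin T(2)
          unfolding \<tau>\<zeta> n_def by (simp add: b.minus_left b.minus_right u'_def)
        have comm: "P x' \<bullet> P x = n \<bullet> x'" by (metis Pin inner_commute n_def)
        have 2: "\<beta> \<xi>' (x, \<zeta>) = n \<bullet> x' + (a * b (D (B x)) p + T u \<bullet> u')"
          unfolding \<xi>'' \<beta>_eq u'_eq p'_eq u_def[symmetric] comm
          unfolding \<tau>\<zeta> n_def by (simp add: b.minus_left b.minus_right inner_commute u'_def)
        show ?thesis unfolding 1 2 by (simp add: distrib_left)
      qed
      have rhs: "\<beta> (x, \<zeta>) (x, \<zeta>) = (norm n)\<^sup>2 + a * b p p + u \<bullet> T u"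
        unfolding \<beta>_eq u_def[symmetric] unfolding \<tau>\<zeta> n_def
        by (simp add: b.minus_left b.minus_right power2_norm_eq_inner)
      define e where "e = x - n"
      let ?n = "norm n" and ?p = "norm p" and ?u = "norm u"
      have Bx_norm: "norm (B x) \<le> ?p + ?u" using norm_triangle_ineq[of p u] by (simp add: Bx)
      have e: "norm e \<le> k * (?p + ?u)"
        unfolding e_def n_def by (rule order_trans[OF e_bound mult_left_mono[OF Bx_norm]]) (use k in simp)
      have Hx: "norm (H e) \<le> hH * k * (?p + ?u)"
        using order_trans[OF hH(2) mult_right_mono[OF e]] hH(1) by (simp add: mult_ac)
      have t1: "n \<bullet> x' \<le> - \<rho> * ?n\<^sup>2 + c * ?n * (?p + ?u)"
      proof -
        \<comment> \<open>The adjoint of \<open>B\<close> maps into the orthogonal complement of the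
          kernel, so the term of size 1 / \<tau> does not act on n.\<close>
        have "n \<bullet> B' (T u) = 0" by (simp add: adj n_def BP)
        then have "n \<bullet> x' = - (n \<bullet> H n) - n \<bullet> H e"
          by (simp add: x' inner_diff_right e_def H.diff inner_minus_right)
        moreover have "\<rho> * ?n\<^sup>2 \<le> n \<bullet> H n" by (rule H_pos) (simp add: n_def BP)
        moreover have "- (n \<bullet> H e) \<le> ?n * (c * (?p + ?u))"
        proof -
          have "- (n \<bullet> H e) \<le> ?n * norm (H e)" using norm_cauchy_schwarz[of "-n" "H e"] by simp
          also have "\<dots> \<le> ?n * (c * (?p + ?u))"
            by (intro mult_left_mono order_trans[OF Hx mult_right_mono[OF c(2)]]) auto
          finally show ?thesis .
        qed
        ultimately show ?thesis by (simp add: mult_ac)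
      qed
      have t2: "b p (D (B x)) + b (D (B x)) p \<le> - 2 * \<mu> * b p p + 2 * c * ?p * ?u"
      proof -
        have Du: "norm (D u) * hb \<le> c * ?u"
        proof -
          have "norm (D u) * hb \<le> ?u * hD * hb" using hD(2) hb(1) by (intro mult_right_mono) auto
          also have "\<dots> \<le> c * ?u" using mult_right_mono[OF c(3), of ?u] by (simp add: mult_ac)
          finally show ?thesis .
        qed
        have "b p (D u) \<le> ?p * norm (D u) * hb" "b (D u) p \<le> ?p * norm (D u) * hb"
          using hb(2)[of p "D u"] hb(2)[of "D u" p] by (auto simp: mult_ac)
        moreover have "?p * norm (D u) * hb \<le> ?p * (c * ?u)"
          using mult_left_mono[OF Du, of ?p] by (simp add: mult_ac)
        ultimately show ?thesis
          using b(3)[OF mem(1)] by (simp add: Bx D.add b.add_left b.add_right mult_ac)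
      qed
      have t3: "T u \<bullet> u' \<le> - (\<sigma> / \<tau>) * ?u\<^sup>2 + c * ?u * (?n + (?p + ?u))"
      proof -
        \<comment> \<open>Measuring u with \<open>T\<close> turns the stiff term into minus a
          square; with the plain norm it would have no definite sign.\<close>
        have "T u \<bullet> B (B' (T u)) = (norm (B' (T u)))\<^sup>2"
          by (simp add: adj[symmetric] inner_commute[of "T u"] power2_norm_eq_inner)
        then have "T u \<bullet> u' = - (1 / \<tau>) * (norm (B' (T u)))\<^sup>2 - T u \<bullet> (B (H x) + D (B x))"
          by (simp add: u'_def x' B.diff B.neg B.scaleR inner_diff_right inner_add_right)
        moreover have "(1 / \<tau>) * (\<sigma> * ?u\<^sup>2) \<le> (1 / \<tau>) * (norm (B' (T u)))\<^sup>2"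
          by (rule mult_left_mono[OF \<sigma>(2)[OF mem(2)]]) (use \<tau> in simp)
        moreover have "- (T u \<bullet> (B (H x) + D (B x))) \<le> c * ?u * (?n + (?p + ?u))"
        proof -
          have "H x = H n + H e" by (simp add: e_def H.diff)
          then have "norm (H x) \<le> ?n * hH + hH * k * (?p + ?u)"
            using norm_triangle_mono[OF hH(2)[of n] Hx] by simp
          then have 1: "norm (B (H x)) \<le> (?n * hH + hH * k * (?p + ?u)) * hB"
            by (rule order_trans[OF hB(2) mult_right_mono]) (use hB(1) in simp)
          have 2: "norm (D (B x)) \<le> (?p + ?u) * hD"
            by (rule order_trans[OF hD(2) mult_right_mono[OF Bx_norm]]) (use hD(1) in simp)
          let ?R = "(?n * hH + hH * k * (?p + ?u)) * hB + (?p + ?u) * hD"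
          have "- (T u \<bullet> (B (H x) + D (B x))) \<le> norm (T u) * norm (B (H x) + D (B x))"
            using norm_cauchy_schwarz[of "- T u"] by (metis inner_minus_left norm_minus_cancel)
          also have "\<dots> \<le> (?u * hT) * ?R"
            by (rule mult_mono[OF hT(2) norm_triangle_mono[OF 1 2]]) (use hT(1) in auto)
          also have "\<dots> = ?u * (hT * (hB * hH) * ?n + hT * (hB * hH * k + hD) * (?p + ?u))"
            by (simp add: algebra_simps)
          also have "\<dots> \<le> ?u * (c * ?n + c * (?p + ?u))"
            by (intro mult_left_mono add_mono mult_right_mono c) auto
          finally show ?thesis by (simp add: algebra_simps)
        qed
        ultimately show ?thesis by simp
      qed
      have t4: "\<alpha> * (u \<bullet> T u) \<le> c * ?u\<^sup>2"
      proof -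
        have "\<alpha> * (u \<bullet> T u) \<le> \<bar>\<alpha>\<bar> * (u \<bullet> T u)" using T_nonneg by (intro mult_right_mono) auto
        also have "\<dots> \<le> \<bar>\<alpha>\<bar> * (?u * (?u * hT))"
          by (intro mult_left_mono order_trans[OF norm_cauchy_schwarz mult_left_mono[OF hT(2)]]) auto
        also have "\<dots> \<le> c * ?u\<^sup>2" using mult_right_mono[OF c(6), of "?u\<^sup>2"] by (simp add: power2_eq_square mult_ac)
        finally show ?thesis .
      qed
      have t5: "a * ((\<mu> - \<alpha>) * c2 * ?p\<^sup>2) \<le> a * ((\<mu> - \<alpha>) * b p p)"
        using a \<alpha> mult_left_mono[OF c2(2)[of p], of "\<mu> - \<alpha>"] by (intro mult_left_mono) (auto simp: mult.assoc)
      have t2': "a * (b p (D (B x)) + b (D (B x)) p) \<le> a * (- 2 * \<mu> * b p p + 2 * c * ?p * ?u)"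
        by (rule mult_left_mono[OF t2]) (use a in simp)
      have nonneg: "0 \<le> c * (?n * ?p)" "0 \<le> c * (?p * ?u)" "0 \<le> a * (c * (?p * ?u))" using a c(1) by auto
      show ?thesis
        unfolding lhs rhs using nonneg t1 t2' t3 t4 t5 young[OF s, of ?n ?p ?u]
        by (simp add: algebra_simps power2_eq_square)
    qed
    then show "\<exists>\<beta>. bounded_bilinear \<beta> \<and> (\<forall>\<xi>. \<xi> \<noteq> 0 \<longrightarrow> \<beta> \<xi> \<xi> > (0::real)) \<and>
      (\<forall>x \<zeta> \<xi>'. \<zeta> \<in> Y \<longrightarrow> \<xi>' = (- H x - adjoint B (T ((1 / \<tau>) *\<^sub>R B x + \<zeta>)), - (1 / \<tau>) *\<^sub>R D (B x))
        \<longrightarrow> \<beta> (x, \<zeta>) \<xi>' + \<beta> \<xi>' (x, \<zeta>) \<le> - 2 * \<alpha> * \<beta> (x, \<zeta>) (x, \<zeta>))"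
      using \<beta> \<beta>_pos unfolding B'_def[symmetric] by blast
  qed
qed

text \<open>The linear map \<open>K\<close> rescales the dual variable, \<open>z = K \<zeta>\<close>, so that the linearization takes
  the form treated in \<open>saddle_lyapunov_form\<close>.\<close>
lemma saddle_exponentially_stable:
  fixes B :: "'x::euclidean_space \<Rightarrow> 'y::euclidean_space" and V :: "real \<Rightarrow> 'x \<times> 'y \<Rightarrow> 'x \<times> 'y"
  assumes B: "bounded_linear B" "\<And>x. B x \<in> Y" and Y: "subspace Y"
    and T: "bounded_linear T" "\<And>u w. u \<bullet> T w = T u \<bullet> w" "\<And>y. y \<noteq> 0 \<Longrightarrow> y \<bullet> T y > 0"
    and inj: "\<And>y. y \<in> Y \<Longrightarrow> y \<noteq> 0 \<Longrightarrow> adjoint B (T y) \<noteq> 0"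
    and G: "(G has_derivative D) (at 0 within Y)" "G 0 = 0" "globally_exp_stable G Y \<mu>" "\<mu> > 0"
    and H: "bounded_linear H" "\<And>n. B n = 0 \<Longrightarrow> \<rho> * (norm n)\<^sup>2 \<le> n \<bullet> H n"
    and K: "bounded_linear K" "bounded_linear K'" "\<And>y. K' (K y) = y" "\<And>y. K (K' y) = y" "\<And>y. y \<in> Y \<Longrightarrow> K' y \<in> Y"
    and A: "\<And>y. y \<in> Y \<Longrightarrow> A (K y) = adjoint B (T y)"
    and V: "\<And>\<tau>. \<tau> > 0 \<Longrightarrow> lipschitz_on_balls (V \<tau>)" "\<And>\<tau> p. V \<tau> p \<in> UNIV \<times> Y"
      "\<And>\<tau>. \<tau> > 0 \<Longrightarrow> V \<tau> q = 0" "q \<in> UNIV \<times> Y"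
      "\<And>\<tau>. \<tau> > 0 \<Longrightarrow> (V \<tau> has_derivative (\<lambda>(x, z). (- H x - A ((1 / \<tau>) *\<^sub>R K (B x) + z),
         - (1 / \<tau>) *\<^sub>R K (D (B x))))) (at q)"
    and \<gamma>: "0 \<le> \<gamma>" "\<gamma> < \<rho>" "\<gamma> < \<mu>"
  obtains \<tau>s where "\<tau>s > 0" "\<And>\<tau>. 0 < \<tau> \<Longrightarrow> \<tau> < \<tau>s \<Longrightarrow> \<exists>C>0. \<exists>\<delta>>0. \<forall>p\<in>UNIV \<times> Y. norm (p - q) < \<delta> \<longrightarrow>
    (\<exists>\<phi>. is_solution (V \<tau>) (UNIV \<times> Y) \<phi> \<and> \<phi> 0 = p \<and>
       (\<forall>t\<ge>0. norm (\<phi> t - q) \<le> C * exp (- \<gamma> * t) * norm (p - q)))"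
proof -
  interpret K: bounded_linear K by fact
  interpret K': bounded_linear K' by fact
  have D: "bounded_linear D" using G(1) by (rule has_derivative_bounded_linear)
  \<comment> \<open>Three strict losses of rate are provided for: \<gamma> < \<alpha> for the
    nonlinear remainder, \<alpha> < min \<rho> \<eta> for the coupling terms, and \<eta> < \<mu> for
    the factor in front of the exponential decay of \<open>G\<close>.\<close>
  define \<alpha> where "\<alpha> = (\<gamma> + min \<rho> \<mu>) / 2"
  define \<eta> where "\<eta> = (\<alpha> + \<mu>) / 2"
  have \<alpha>: "\<gamma> < \<alpha>" "\<alpha> < \<rho>" "\<alpha> < \<eta>" "\<eta> < \<mu>"
    using \<gamma> by (auto simp: \<alpha>_def \<eta>_def min_def field_simps split: if_splits)
  obtain b where b: "bounded_bilinear b" "\<And>y. y \<noteq> 0 \<Longrightarrow> b y y > (0::real)"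
    "\<And>y. y \<in> Y \<Longrightarrow> b y (D y) + b (D y) y \<le> - 2 * \<eta> * b y y"
    using exp_stable_lyapunov_form[OF G(1,2) Y G(3,4) \<alpha>(4)] by blast
  obtain \<tau>s where \<tau>s: "\<tau>s > 0"
    "\<And>\<tau>. 0 < \<tau> \<Longrightarrow> \<tau> < \<tau>s \<Longrightarrow> \<exists>\<beta>. bounded_bilinear \<beta> \<and> (\<forall>\<xi>. \<xi> \<noteq> 0 \<longrightarrow> \<beta> \<xi> \<xi> > (0::real)) \<and>
      (\<forall>x \<zeta> \<xi>'. \<zeta> \<in> Y \<longrightarrow> \<xi>' = (- H x - adjoint B (T ((1 / \<tau>) *\<^sub>R B x + \<zeta>)), - (1 / \<tau>) *\<^sub>R D (B x))
        \<longrightarrow> \<beta> (x, \<zeta>) \<xi>' + \<beta> \<xi>' (x, \<zeta>) \<le> - 2 * \<alpha> * \<beta> (x, \<zeta>) (x, \<zeta>))"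
    using saddle_lyapunov_form[OF B Y T inj D H(1) b H(2) \<alpha>(2,3)] by blast
  show ?thesis
  proof (rule that[OF \<tau>s(1)])
    fix \<tau> :: real assume \<tau>: "0 < \<tau>" "\<tau> < \<tau>s"
    obtain \<beta> where \<beta>: "bounded_bilinear \<beta>" "\<And>\<xi>. \<xi> \<noteq> 0 \<Longrightarrow> \<beta> \<xi> \<xi> > (0::real)"
      and \<beta>_decr: "\<And>x \<zeta> \<xi>'. \<zeta> \<in> Y \<Longrightarrow>
        \<xi>' = (- H x - adjoint B (T ((1 / \<tau>) *\<^sub>R B x + \<zeta>)), - (1 / \<tau>) *\<^sub>R D (B x)) \<Longrightarrow>
        \<beta> (x, \<zeta>) \<xi>' + \<beta> \<xi>' (x, \<zeta>) \<le> - 2 * \<alpha> * \<beta> (x, \<zeta>) (x, \<zeta>)"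
      using \<tau>s(2)[OF \<tau>] by blast
    define \<Lambda> where "\<Lambda> \<xi> = (fst \<xi>, K' (snd \<xi>))" for \<xi> :: "'x \<times> 'y"
    have \<Lambda>: "bounded_linear \<Lambda>"
      unfolding \<Lambda>_def by (intro bounded_linear_Pair bounded_linear_fst bounded_linear_compose[OF K(2)] bounded_linear_snd)
    have \<Lambda>0: "\<xi> = 0" if "\<Lambda> \<xi> = 0" for \<xi>
    proof -
      have "fst \<xi> = 0" "K' (snd \<xi>) = 0" using that by (auto simp: \<Lambda>_def zero_prod_def)
      with K(4)[of "snd \<xi>"] show ?thesis by (simp add: K.zero prod_eq_iff)
    qed
    have S: "subspace (UNIV \<times> Y :: ('x \<times> 'y) set)" by (intro subspace_Times subspace_UNIV Y)
    let ?L = "\<lambda>(x, z). (- H x - A ((1 / \<tau>) *\<^sub>R K (B x) + z), - (1 / \<tau>) *\<^sub>R K (D (B x)))"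
    define \<beta>' where "\<beta>' = (\<lambda>\<xi> \<xi>'. \<beta> (\<Lambda> \<xi>) (\<Lambda> \<xi>'))"
    have \<beta>': "bounded_bilinear \<beta>'"
      unfolding \<beta>'_def by (rule bounded_bilinear.comp[OF \<beta>(1) \<Lambda> \<Lambda>])
    have \<beta>'_pos: "\<beta>' \<xi> \<xi> > 0" if "\<xi> \<noteq> 0" for \<xi>
      unfolding \<beta>'_def using \<beta>(2)[of "\<Lambda> \<xi>"] \<Lambda>0[of \<xi>] that by blast
    have decr: "\<beta>' \<xi> (?L \<xi>) + \<beta>' (?L \<xi>) \<xi> \<le> - 2 * \<alpha> * \<beta>' \<xi> \<xi>" if mem: "\<xi> \<in> UNIV \<times> Y" for \<xi>
    proof -
      obtain x z where \<xi>: "\<xi> = (x, z)" "z \<in> Y" using mem by auto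
      have "(1 / \<tau>) *\<^sub>R K (B x) + z = K ((1 / \<tau>) *\<^sub>R B x + K' z)" by (simp add: K.add K.scaleR K(4))
      moreover have "A (K ((1 / \<tau>) *\<^sub>R B x + K' z)) = adjoint B (T ((1 / \<tau>) *\<^sub>R B x + K' z))"
        by (intro A subspace_add[OF Y] subspace_scale[OF Y] B(2) K(5) \<xi>(2))
      ultimately have "\<Lambda> (?L \<xi>) = (- H x - adjoint B (T ((1 / \<tau>) *\<^sub>R B x + K' z)), - (1 / \<tau>) *\<^sub>R D (B x))"
        by (simp add: \<Lambda>_def \<xi>(1) K'.scaleR K'.neg K(3))
      moreover have "\<Lambda> \<xi> = (x, K' z)" by (simp add: \<Lambda>_def \<xi>(1))
      ultimately show ?thesis unfolding \<beta>'_def using \<beta>_decr[OF K(5)[OF \<xi>(2)]] by simp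
    qed
    show "\<exists>C>0. \<exists>\<delta>>0. \<forall>p\<in>UNIV \<times> Y. norm (p - q) < \<delta> \<longrightarrow>
      (\<exists>\<phi>. is_solution (V \<tau>) (UNIV \<times> Y) \<phi> \<and> \<phi> 0 = p \<and>
       (\<forall>t\<ge>0. norm (\<phi> t - q) \<le> C * exp (- \<gamma> * t) * norm (p - q)))"
    proof (rule stable_by_linearization[where V = "V \<tau>" and A = ?L and S = "UNIV \<times> Y" and q = q
          and \<beta> = \<beta>' and \<alpha> = \<alpha> and \<gamma> = \<gamma>])
      show "subspace (UNIV \<times> Y :: ('x \<times> 'y) set)" by (rule S)
      show "lipschitz_on_balls (V \<tau>)" by (rule V(1)[OF \<tau>(1)])
      show "V \<tau> p \<in> UNIV \<times> Y" for p by (rule V(2))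
      show "V \<tau> q = 0" by (rule V(3)[OF \<tau>(1)])
      show "q \<in> UNIV \<times> Y" by (rule V(4))
      show "(V \<tau> has_derivative ?L) (at q)" by (rule V(5)[OF \<tau>(1)])
      show "bounded_bilinear \<beta>'" by (rule \<beta>')
      show "\<beta>' \<xi> \<xi> > 0" if "\<xi> \<noteq> 0" for \<xi> by (rule \<beta>'_pos[OF that])
      show "\<beta>' \<xi> (?L \<xi>) + \<beta>' (?L \<xi>) \<xi> \<le> - 2 * \<alpha> * \<beta>' \<xi> \<xi>" if "\<xi> \<in> UNIV \<times> Y" for \<xi> by (rule decr[OF that])
      show "0 \<le> \<gamma>" "\<gamma> < \<alpha>" by (rule \<gamma>(1), rule \<alpha>(1))
    next
      fix C \<delta> assume "C > 0" "\<delta> > 0" "\<And>p. p \<in> UNIV \<times> Y \<Longrightarrow> norm (p - q) < \<delta> \<Longrightarrow>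
        \<exists>\<phi>. is_solution (V \<tau>) (UNIV \<times> Y) \<phi> \<and> \<phi> 0 = p \<and>
       (\<forall>t\<ge>0. norm (\<phi> t - q) \<le> C * exp (- \<gamma> * t) * norm (p - q))"
      then show ?thesis by blast
    qed
  qed
qed

section \<open>Equality-constrained optimization\<close>

text \<open>With J the derivative of \<open>h\<close> at \<open>s0\<close>, the inverse function
  theorem is applied to P (s - s0) + J^T h(s), where P projects onto the kernel of J. Its derivative
  P + J^T J is invertible even if J is not onto the ambient target space. The curve is the preimage
  of the line through v.\<close>

lemma feasible_curve:
  fixes h :: "'a::euclidean_space \<Rightarrow> 'b::euclidean_space" and h' :: "'a \<Rightarrow> 'a \<Rightarrow>\<^sub>L 'b"
  assumes h: "\<And>s. (h has_derivative blinfun_apply (h' s)) (at s)" "continuous_on UNIV h'"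
    and Z: "\<And>s. h s \<in> Z" and s0: "h s0 = 0"
    and inj: "\<And>z. z \<in> Z \<Longrightarrow> adjoint (h' s0) z = 0 \<Longrightarrow> z = 0"
    and v: "h' s0 v = 0"
  shows "\<exists>c e. e > 0 \<and> c 0 = s0 \<and> (c has_vector_derivative v) (at 0) \<and>
    (\<forall>t. \<bar>t\<bar> < e \<longrightarrow> h (c t) = 0)"
proof -
  let ?J = "blinfun_apply (h' s0)"
  have linJ: "linear ?J" by (simp add: blinfun.bounded_linear_right bounded_linear.linear)
  let ?A = "adjoint ?J"
  have adj: "x \<bullet> ?A y = ?J x \<bullet> y" for x y by (rule adjoint_works[OF linJ])
  have A: "bounded_linear ?A" using adjoint_linear[OF linJ] by (simp add: linear_conv_bounded_linear)
  interpret A: bounded_linear ?A by (rule A)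
  have N: "subspace {x. ?J x = 0}" by (rule linear_subspace_kernel[OF linJ])
  obtain P where P: "bounded_linear P" "\<And>x. P x \<in> {x. ?J x = 0}"
    "\<And>x y. y \<in> {x. ?J x = 0} \<Longrightarrow> (x - P x) \<bullet> y = 0"
    using orthogonal_projection_exists[OF N] by blast
  interpret P: bounded_linear P by (rule P)
  have P_id: "P x = x" if "?J x = 0" for x
  proof -
    have "x - P x \<in> {x. ?J x = 0}" using that P(2) N by (intro subspace_diff) auto
    from P(3)[OF this, of x] show ?thesis by simp
  qed
  define \<Phi> where "\<Phi> s = P (s - s0) + ?A (h s)" for s
  define \<Phi>' where "\<Phi>' s = Blinfun P + (Blinfun ?A o\<^sub>L h' s)" for s
  have \<Phi>'_apply: "\<Phi>' s x = P x + ?A (h' s x)" for s x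
    by (simp add: \<Phi>'_def blinfun.add_left bounded_linear_Blinfun_apply P(1) A)
  have der: "(\<Phi> has_derivative \<Phi>' s) (at s)" for s
  proof -
    have "(\<Phi> has_derivative (\<lambda>x. P x + ?A (h' s x))) (at s)"
      unfolding \<Phi>_def
      by (intro has_derivative_add P.has_derivative A.has_derivative h(1))
         (auto intro!: derivative_eq_intros)
    then show ?thesis by (simp add: \<Phi>'_apply[abs_def])
  qed
  have cont: "continuous_on UNIV \<Phi>'" unfolding \<Phi>'_def by (intro continuous_intros h(2))
  have inj\<Phi>: "x = 0" if "\<Phi>' s0 x = 0" for x
  proof -
    \<comment> \<open>Pairing with x turns the sum into |P x|^2 + |J x|^2, so both parts
      vanish.\<close>
    have "0 = x \<bullet> (P x + ?A (?J x))" using that by (simp add: \<Phi>'_apply)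
    also have "\<dots> = P x \<bullet> P x + ?J x \<bullet> ?J x"
      using P(3)[OF P(2), of x x] by (simp add: inner_add_right adj inner_diff_left)
    finally have "P x = 0" "?J x = 0"
      by (metis add_nonneg_eq_0_iff inner_eq_zero_iff inner_ge_zero)+
    with P_id show ?thesis by metis
  qed
  have "linear (\<Phi>' s0)" by (simp add: blinfun.bounded_linear_right bounded_linear.linear)
  moreover from this have "inj (\<Phi>' s0)" using inj\<Phi> by (auto simp: linear_injective_0)
  ultimately obtain g where g: "linear g" "g \<circ> \<Phi>' s0 = id"
    using linear_injective_left_inverse by blast
  have "Blinfun g o\<^sub>L \<Phi>' s0 = id_blinfun"
    using g by (intro blinfun_eqI) (simp add: bounded_linear_Blinfun_apply linear_conv_bounded_linear fun_eq_iff)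
  then obtain U' V G G' where inv: "open V" "\<Phi> s0 \<in> V" "s0 \<in> U'" "homeomorphism U' V \<Phi> G"
    "\<And>y. y \<in> V \<Longrightarrow> (G has_derivative (G' y)) (at y)"
    "\<And>y. y \<in> V \<Longrightarrow> G' y = Hilbert_Choice.inv (blinfun_apply (\<Phi>' (G y)))"
    "\<And>y. y \<in> V \<Longrightarrow> bij (blinfun_apply (\<Phi>' (G y)))"
    using inverse_function_theorem[OF open_UNIV der cont UNIV_I] by metis
  have \<Phi>0: "\<Phi> s0 = 0" by (simp add: \<Phi>_def s0 P.zero A.zero)
  have G0: "G 0 = s0" using inv(3,4) \<Phi>0 by (metis homeomorphism_apply1)
  have "0 \<in> V" using inv(2) \<Phi>0 by simp
  then obtain r where r: "r > 0" "ball 0 r \<subseteq> V" using inv(1) open_contains_ball by metis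
  define e where "e = r / (norm v + 1)"
  have e: "e > 0" using r by (simp add: e_def add_nonneg_pos)
  show ?thesis
  proof (intro exI[of _ "\<lambda>t. G (t *\<^sub>R v)"] exI[of _ e] conjI e allI impI)
    show "G (0 *\<^sub>R v) = s0" using G0 by simp
    have "\<Phi>' s0 v = v" using v by (simp add: \<Phi>'_apply P_id A.zero)
    then have "G' 0 v = v"
      using inv(6,7)[OF \<open>0 \<in> V\<close>] G0 by (metis bij_inv_eq_iff)
    moreover have "((\<lambda>t. G (t *\<^sub>R v)) has_derivative (\<lambda>t. G' 0 (t *\<^sub>R v))) (at 0)"
      by (rule has_derivative_compose[where g = G]) (use inv(5)[OF \<open>0 \<in> V\<close>] in \<open>auto intro!: derivative_eq_intros\<close>)
    moreover have "G' 0 (t *\<^sub>R v) = t *\<^sub>R G' 0 v" for t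
      using has_derivative_bounded_linear[OF inv(5)[OF \<open>0 \<in> V\<close>]] by (simp add: linear_simps)
    ultimately show "((\<lambda>t. G (t *\<^sub>R v)) has_vector_derivative v) (at 0)"
      by (simp add: has_vector_derivative_def)
    fix t :: real assume t: "\<bar>t\<bar> < e"
    have "\<bar>t\<bar> * norm v \<le> \<bar>t\<bar> * (norm v + 1)" by (intro mult_left_mono) auto
    also have "\<dots> < e * (norm v + 1)" using t by (intro mult_strict_right_mono) (auto simp: add_nonneg_pos)
    also have "\<dots> = r" by (simp add: e_def add_nonneg_eq_0_iff)
    finally have "t *\<^sub>R v \<in> V" using r(2) by auto
    then have "\<Phi> (G (t *\<^sub>R v)) = t *\<^sub>R v" using inv(4) by (metis homeomorphism_apply2)
    then have w: "?A (h (G (t *\<^sub>R v))) = t *\<^sub>R v - P (G (t *\<^sub>R v) - s0)" by (simp add: \<Phi>_def eq_diff_eq add.commute)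
    \<comment> \<open>J annihilates v and all values of P, hence J J^T h = 0 along the curve. Then
      J^T h = 0, and injectivity on \<open>Z\<close> gives feasibility.\<close>
    have "?J (?A (h (G (t *\<^sub>R v)))) = 0"
      unfolding w using v P(2) by (simp add: blinfun.diff_right blinfun.scaleR_right)
    then have "?A (h (G (t *\<^sub>R v))) \<bullet> ?A (h (G (t *\<^sub>R v))) = 0" by (subst adj) simp
    then show "h (G (t *\<^sub>R v)) = 0" using inj[OF Z] by simp
  qed
qed

text \<open>Minimality along feasible curves makes the gradient orthogonal to the kernel of J, and
  J^T maps \<open>Z\<close> onto the orthogonal complement of that kernel.\<close>

lemma lagrange_multiplier_exists:
  fixes h :: "'a::euclidean_space \<Rightarrow> 'b::euclidean_space" and h' :: "'a \<Rightarrow> 'a \<Rightarrow>\<^sub>L 'b"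
  assumes h: "\<And>s. (h has_derivative blinfun_apply (h' s)) (at s)" "continuous_on UNIV h'"
    and Z: "subspace Z" "\<And>s. h s \<in> Z" and s0: "h s0 = 0"
    and inj: "\<And>z. z \<in> Z \<Longrightarrow> adjoint (h' s0) z = 0 \<Longrightarrow> z = 0"
    and F: "GDERIV F s0 :> q"
    and min: "d > 0" "\<And>s. h s = 0 \<Longrightarrow> dist s s0 < d \<Longrightarrow> F s0 \<le> F s"
  obtains z where "z \<in> Z" "q + adjoint (h' s0) z = 0"
proof -
  let ?J = "blinfun_apply (h' s0)"
  have linJ: "linear ?J" by (simp add: blinfun.bounded_linear_right bounded_linear.linear)
  let ?A = "adjoint ?J"
  have adj: "x \<bullet> ?A y = ?J x \<bullet> y" for x y by (rule adjoint_works[OF linJ])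
  have tangent: "v \<bullet> q = 0" if v: "?J v = 0" for v
  proof -
    obtain c e where c: "e > 0" "c 0 = s0" "(c has_vector_derivative v) (at 0)" "\<And>t. \<bar>t\<bar> < e \<Longrightarrow> h (c t) = 0"
      using feasible_curve[OF h Z(2) s0 inj v] by blast
    have "isCont c 0" using c(3) by (rule has_vector_derivative_continuous)
    then obtain e' where e': "e' > 0" "\<And>t. \<bar>t\<bar> < e' \<Longrightarrow> dist (c t) s0 < d"
      using min(1) c(2) by (auto simp: continuous_at_eps_delta dist_real_def)
    have "((\<lambda>t. F (c t)) has_derivative (\<lambda>t. (t *\<^sub>R v) \<bullet> q)) (at 0)"
      by (rule has_derivative_compose[where g = F]) (use c(2,3) F in \<open>auto simp: gderiv_def has_vector_derivative_def\<close>)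
    then have "DERIV (\<lambda>t. F (c t)) 0 :> v \<bullet> q"
      by (simp add: has_field_derivative_def mult_commute_abs)
    moreover have "\<forall>t. \<bar>0 - t\<bar> < min e e' \<longrightarrow> F (c 0) \<le> F (c t)"
      using min(2) c(2,4) e'(2) by auto
    ultimately show ?thesis using DERIV_local_min[of "\<lambda>t. F (c t)" "v \<bullet> q" 0 "min e e'"] c(1) e'(1) by auto
  qed
  have "subspace (?A ` Z)" using adjoint_linear[OF linJ] Z(1) by (rule linear_subspace_image)
  then have "q \<in> ?A ` Z"
  proof (rule mem_subspace_if_orthogonal)
    fix p assume p: "\<And>x. x \<in> ?A ` Z \<Longrightarrow> x \<bullet> p = 0"
    \<comment> \<open>So p may be tested against J^T J p, which gives |J p|^2 = 0.\<close>
    have "?J p \<in> Z" by (rule derivative_in_subspace[OF h(1) Z(2,1)])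
    then have "p \<bullet> ?A (?J p) = 0" using p[of "?A (?J p)"] by (simp add: inner_commute)
    then have "?J p = 0" by (simp add: adj)
    then show "q \<bullet> p = 0" using tangent by (simp add: inner_commute)
  qed
  then obtain z where "z \<in> Z" "q = ?A z" by blast
  then show ?thesis
    using linear_neg[OF adjoint_linear[OF linJ]] Z(1) by (intro that[of "- z"]) (auto simp: subspace_neg)
qed

text \<open>The expansion of \<open>g\<close> at the single point \<open>s0\<close> suffices: after
  the quadratic part is subtracted along the segment, the mean value theorem leaves only the
  first-order error of \<open>g\<close>.\<close>

lemma taylor_second_order_bound:
  fixes l :: "'a::real_inner \<Rightarrow> real"
  assumes l: "\<And>s. GDERIV l s :> g s" and g: "(g has_derivative M) (at s0)" "g s0 = 0" and "\<kappa> > 0"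
  obtains d where "d > 0" "\<And>w. norm w < d \<Longrightarrow> l (s0 + w) - l s0 \<le> (w \<bullet> M w) / 2 + \<kappa> * (norm w)\<^sup>2"
proof -
  interpret M: bounded_linear M using g(1) by (rule has_derivative_bounded_linear)
  obtain d where d: "d > 0" "\<And>y. norm (y - s0) < d \<Longrightarrow> norm (g y - g s0 - M (y - s0)) \<le> \<kappa> * norm (y - s0)"
    using g(1) \<open>\<kappa> > 0\<close> unfolding has_derivative_at_alt by blast
  show ?thesis
  proof (rule that[OF d(1)])
    fix w :: 'a assume w: "norm w < d"
    let ?q = "\<lambda>\<theta>. l (s0 + \<theta> *\<^sub>R w) - \<theta>\<^sup>2 / 2 * (w \<bullet> M w)"
    let ?q' = "\<lambda>\<theta> t. (t *\<^sub>R w) \<bullet> g (s0 + \<theta> *\<^sub>R w) - t * (\<theta> * (w \<bullet> M w))"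
    have "(?q has_derivative ?q' \<theta>) (at \<theta> within {0..1})" for \<theta>
    proof -
      have "((\<lambda>\<theta>. l (s0 + \<theta> *\<^sub>R w)) has_derivative (\<lambda>t. (t *\<^sub>R w) \<bullet> g (s0 + \<theta> *\<^sub>R w))) (at \<theta> within {0..1})"
        by (rule has_derivative_compose[where g = l])
           (use l in \<open>auto simp: gderiv_def intro!: derivative_eq_intros\<close>)
      then show ?thesis by (auto intro!: derivative_eq_intros simp: fun_eq_iff)
    qed
    then obtain \<theta> where \<theta>: "\<theta> \<in> {0..1}" "?q 1 - ?q 0 = ?q' \<theta> (1 - 0)"
      using mvt_very_simple[of 0 1 ?q ?q'] by auto
    have "norm (\<theta> *\<^sub>R w) \<le> norm w" using \<theta>(1) by (simp add: mult_left_le_one_le)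
    have "?q' \<theta> (1 - 0) = w \<bullet> (g (s0 + \<theta> *\<^sub>R w) - M (\<theta> *\<^sub>R w))"
      by (simp add: inner_diff_right M.scaleR)
    also have "\<dots> \<le> norm w * norm (g (s0 + \<theta> *\<^sub>R w) - M (\<theta> *\<^sub>R w))" by (rule norm_cauchy_schwarz)
    also have "\<dots> \<le> norm w * (\<kappa> * norm w)"
    proof (rule mult_left_mono)
      have "norm (g (s0 + \<theta> *\<^sub>R w) - M (\<theta> *\<^sub>R w)) \<le> \<kappa> * norm (\<theta> *\<^sub>R w)"
        using d(2)[of "s0 + \<theta> *\<^sub>R w"] g(2) w \<open>norm (\<theta> *\<^sub>R w) \<le> norm w\<close> by simp
      also have "\<dots> \<le> \<kappa> * norm w" by (rule mult_left_mono) (use \<open>norm (\<theta> *\<^sub>R w) \<le> norm w\<close> \<open>\<kappa> > 0\<close> in auto)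
      finally show "norm (g (s0 + \<theta> *\<^sub>R w) - M (\<theta> *\<^sub>R w)) \<le> \<kappa> * norm w" .
    qed simp
    finally show "l (s0 + w) - l s0 \<le> (w \<bullet> M w) / 2 + \<kappa> * (norm w)\<^sup>2"
      using \<theta>(2) by (simp add: power2_eq_square mult_ac)
  qed
qed

text \<open>Growth and Taylor bound are compared along a feasible curve with tangent v and divided
  by t^2; first t, then the Taylor error \<kappa>, tends to 0. Since \<open>g\<close> vanishes at
  \<open>s0\<close>, the curvature of the curve contributes nothing.\<close>

lemma quadratic_growth_second_order:
  fixes h :: "'a::euclidean_space \<Rightarrow> 'b::euclidean_space" and h' :: "'a \<Rightarrow> 'a \<Rightarrow>\<^sub>L 'b"
  assumes h: "\<And>s. (h has_derivative blinfun_apply (h' s)) (at s)" "continuous_on UNIV h'"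
    and Z: "\<And>s. h s \<in> Z" and s0: "h s0 = 0"
    and inj: "\<And>z. z \<in> Z \<Longrightarrow> adjoint (h' s0) z = 0 \<Longrightarrow> z = 0"
    and l: "\<And>s. GDERIV l s :> g s" and g: "(g has_derivative M) (at s0)" "g s0 = 0"
    and growth: "d > 0" "\<And>s. h s = 0 \<Longrightarrow> dist s s0 < d \<Longrightarrow> l s0 + \<rho> / 2 * (norm (s - s0))\<^sup>2 \<le> l s"
    and v: "h' s0 v = 0"
  shows "\<rho> * (norm v)\<^sup>2 \<le> v \<bullet> M v"
proof -
  interpret M: bounded_linear M using g(1) by (rule has_derivative_bounded_linear)
  obtain c e where c: "e > 0" "c 0 = s0" "(c has_vector_derivative v) (at 0)" "\<And>t. \<bar>t\<bar> < e \<Longrightarrow> h (c t) = 0"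
    using feasible_curve[OF h Z s0 inj v] by blast
  define q where "q t = (c t - s0) /\<^sub>R t" for t
  have q_lim: "(q \<longlongrightarrow> v) (at 0)"
  proof (rule LIM_zero_cancel, rule tendsto_norm_zero_cancel)
    have "((\<lambda>t. norm (c (0 + t) - c 0 - t *\<^sub>R v) / norm t) \<longlongrightarrow> 0) (at 0)"
      using c(3) unfolding has_vector_derivative_def has_derivative_at by blast
    moreover have "\<forall>\<^sub>F t in at 0. norm (c (0 + t) - c 0 - t *\<^sub>R v) / norm t = norm (q t - v)"
    proof (intro eventually_at_filter[THEN iffD2] always_eventually allI impI)
      fix t :: real assume "t \<noteq> 0"
      then have "c t - c 0 - t *\<^sub>R v = t *\<^sub>R (q t - v)" by (simp add: q_def c(2) scaleR_diff_right)
      with \<open>t \<noteq> 0\<close> show "norm (c (0 + t) - c 0 - t *\<^sub>R v) / norm t = norm (q t - v)" by simp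
    qed
    ultimately show "((\<lambda>t. norm (q t - v)) \<longlongrightarrow> 0) (at 0)" by (rule Lim_transform_eventually)
  qed
  have ineq: "\<rho> / 2 * (norm v)\<^sup>2 \<le> (v \<bullet> M v) / 2 + \<kappa> * (norm v)\<^sup>2" if \<kappa>: "\<kappa> > 0" for \<kappa>
  proof -
    obtain d' where d': "d' > 0" "\<And>w. norm w < d' \<Longrightarrow> l (s0 + w) - l s0 \<le> (w \<bullet> M w) / 2 + \<kappa> * (norm w)\<^sup>2"
      using taylor_second_order_bound[OF l g \<kappa>] by blast
    have "(c \<longlongrightarrow> s0) (at 0)"
      using has_vector_derivative_continuous[OF c(3)] c(2) by (simp add: continuous_at)
    then have near: "\<forall>\<^sub>F t in at 0. dist (c t) s0 < min d d'"
      using growth(1) d'(1) by (intro tendstoD) auto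
    have small: "\<forall>\<^sub>F t in at (0::real). \<bar>t\<bar> < e \<and> t \<noteq> 0"
      using c(1) by (auto simp: eventually_at dist_real_def)
    have ev: "\<forall>\<^sub>F t in at 0. \<rho> / 2 * (norm (q t))\<^sup>2 \<le> (q t \<bullet> M (q t)) / 2 + \<kappa> * (norm (q t))\<^sup>2"
      using near small
    proof eventually_elim
      case (elim t)
      let ?w = "c t - s0"
      have "\<rho> / 2 * (norm ?w)\<^sup>2 \<le> (?w \<bullet> M ?w) / 2 + \<kappa> * (norm ?w)\<^sup>2"
        using growth(2)[OF c(4), of t] d'(2)[of ?w] elim by (simp add: dist_norm)
      moreover have "?w = t *\<^sub>R q t" using elim by (simp add: q_def)
      ultimately have "t\<^sup>2 * (\<rho> / 2 * (norm (q t))\<^sup>2) \<le> t\<^sup>2 * ((q t \<bullet> M (q t)) / 2 + \<kappa> * (norm (q t))\<^sup>2)"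
        by (simp add: M.scaleR power_mult_distrib power2_eq_square algebra_simps)
      then show ?case using elim by simp
    qed
    have lim1: "((\<lambda>t. \<rho> / 2 * (norm (q t))\<^sup>2) \<longlongrightarrow> \<rho> / 2 * (norm v)\<^sup>2) (at 0)"
      by (intro tendsto_intros q_lim)
    have lim2: "((\<lambda>t. (q t \<bullet> M (q t)) / 2 + \<kappa> * (norm (q t))\<^sup>2) \<longlongrightarrow> (v \<bullet> M v) / 2 + \<kappa> * (norm v)\<^sup>2) (at 0)"
      by (intro tendsto_intros q_lim M.tendsto) auto
    show ?thesis by (rule tendsto_le[OF at_neq_bot lim2 lim1 ev])
  qed
  show ?thesis
  proof (rule field_le_epsilon)
    fix \<epsilon> :: real assume "\<epsilon> > 0"
    define \<kappa> where "\<kappa> = \<epsilon> / (2 * ((norm v)\<^sup>2 + 1))"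
    have pos: "(norm v)\<^sup>2 + 1 > 0" by (simp add: add_nonneg_pos)
    have "\<kappa> > 0" using \<open>\<epsilon> > 0\<close> pos by (simp add: \<kappa>_def)
    moreover have "\<kappa> * (norm v)\<^sup>2 \<le> \<epsilon> / 2" using \<open>\<epsilon> > 0\<close> pos by (simp add: \<kappa>_def field_simps)
    ultimately show "\<rho> * (norm v)\<^sup>2 \<le> v \<bullet> M v + \<epsilon>" using ineq[of \<kappa>] by linarith
  qed
qed

section \<open>Functions that are Lipschitz on balls\<close>

lemma lipschitz_on_balls_iff:
  fixes f :: "'a::real_normed_vector \<Rightarrow> 'b::metric_space"
  shows
  "lipschitz_on_balls f \<longleftrightarrow> (\<forall>r. \<exists>L. \<forall>x y. norm x \<le> r \<longrightarrow> norm y \<le> r \<longrightarrow> dist (f x) (f y) \<le> L * norm (x - y))"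
proof
  assume *: "lipschitz_on_balls f"
  show "\<forall>r. \<exists>L. \<forall>x y. norm x \<le> r \<longrightarrow> norm y \<le> r \<longrightarrow> dist (f x) (f y) \<le> L * norm (x - y)"
  proof
    fix r
    obtain L where "L-lipschitz_on (cball 0 r) f" using * unfolding lipschitz_on_balls_def by blast
    from lipschitz_onD[OF this]
    show "\<exists>L. \<forall>x y. norm x \<le> r \<longrightarrow> norm y \<le> r \<longrightarrow> dist (f x) (f y) \<le> L * norm (x - y)"
      by (intro exI[of _ L]) (simp add: dist_norm[of x y for x y :: 'a])
  qed
next
  assume *: "\<forall>r. \<exists>L. \<forall>x y. norm x \<le> r \<longrightarrow> norm y \<le> r \<longrightarrow> dist (f x) (f y) \<le> L * norm (x - y)"
  show "lipschitz_on_balls f"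
    unfolding lipschitz_on_balls_def
  proof
    fix r
    obtain L where L: "\<And>x y. norm x \<le> r \<Longrightarrow> norm y \<le> r \<Longrightarrow> dist (f x) (f y) \<le> L * norm (x - y)"
      using * by blast
    have "\<bar>L\<bar>-lipschitz_on (cball 0 r) f"
    proof (rule lipschitz_onI)
      fix x y :: 'a assume "x \<in> cball 0 r" "y \<in> cball 0 r"
      then have "dist (f x) (f y) \<le> L * norm (x - y)" by (intro L) auto
      also have "\<dots> \<le> \<bar>L\<bar> * norm (x - y)" by (intro mult_right_mono) auto
      finally show "dist (f x) (f y) \<le> \<bar>L\<bar> * dist x y" by (simp add: dist_norm)
    qed simp
    then show "\<exists>L. L-lipschitz_on (cball 0 r) f" by blast
  qed
qed

lemma lipschitz_on_ballsD:
  fixes f :: "'a::real_normed_vector \<Rightarrow> 'b::metric_space"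
  assumes "lipschitz_on_balls f"
  obtains L where "L \<ge> 0" "\<And>x y. norm x \<le> r \<Longrightarrow> norm y \<le> r \<Longrightarrow> dist (f x) (f y) \<le> L * norm (x - y)"
proof -
  obtain L where "L-lipschitz_on (cball 0 r) f" using assms by (auto simp: lipschitz_on_balls_def)
  then show ?thesis by (intro that[of L]) (auto simp: lipschitz_on_def dist_norm)
qed

lemma lipschitz_on_balls_bounded:
  fixes f :: "'a::real_normed_vector \<Rightarrow> 'b::real_normed_vector"
  assumes "lipschitz_on_balls f"
  obtains M where "M \<ge> 0" "\<And>x. norm x \<le> r \<Longrightarrow> norm (f x) \<le> M"
proof -
  obtain L where L: "L \<ge> 0" "\<And>x y. norm x \<le> \<bar>r\<bar> \<Longrightarrow> norm y \<le> \<bar>r\<bar> \<Longrightarrow> dist (f x) (f y) \<le> L * norm (x - y)"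
    using lipschitz_on_ballsD[OF assms] by metis
  have "norm (f x) \<le> norm (f 0) + L * \<bar>r\<bar>" if "norm x \<le> r" for x
  proof -
    have "norm (f x - f 0) \<le> L * norm x" using L(2)[of x 0] that by (simp add: dist_norm)
    also have "\<dots> \<le> L * \<bar>r\<bar>" using that L(1) by (intro mult_left_mono) auto
    finally show ?thesis using norm_triangle_sub[of "f x" "f 0"] by linarith
  qed
  then show ?thesis using L(1) by (intro that[of "norm (f 0) + L * \<bar>r\<bar>"]) auto
qed

text \<open>Made for an outer map such as the output field, which is regular only on a subspace that
  contains all values of the inner map.\<close>

lemma lipschitz_on_balls_compose_on:
  fixes f :: "'a::real_normed_vector \<Rightarrow> 'b::real_normed_vector"
  assumes f: "lipschitz_on_balls f" "\<And>x. f x \<in> S"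
    and g: "\<And>r. \<exists>L. L-lipschitz_on (S \<inter> cball 0 r) g"
  shows "lipschitz_on_balls (\<lambda>x. g (f x))"
  unfolding lipschitz_on_balls_iff
proof
  fix r
  obtain M where M: "\<And>x. norm x \<le> r \<Longrightarrow> norm (f x) \<le> M"
    using lipschitz_on_balls_bounded[OF f(1)] by metis
  obtain L where L: "\<And>x y. norm x \<le> r \<Longrightarrow> norm y \<le> r \<Longrightarrow> dist (f x) (f y) \<le> L * norm (x - y)"
    using lipschitz_on_ballsD[OF f(1)] by metis
  obtain L' where L': "L'-lipschitz_on (S \<inter> cball 0 M) g" using g by blast
  have "dist (g (f x)) (g (f y)) \<le> L' * L * norm (x - y)" if "norm x \<le> r" "norm y \<le> r" for x y
  proof -
    have "dist (g (f x)) (g (f y)) \<le> L' * dist (f x) (f y)"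
      using lipschitz_onD[OF L'] f(2) M that by auto
    also have "\<dots> \<le> L' * (L * norm (x - y))"
      using L[OF that] lipschitz_on_nonneg[OF L'] by (intro mult_left_mono)
    finally show ?thesis by (simp add: mult.assoc)
  qed
  then show "\<exists>L. \<forall>x y. norm x \<le> r \<longrightarrow> norm y \<le> r \<longrightarrow> dist (g (f x)) (g (f y)) \<le> L * norm (x - y)" by blast
qed

lemma lipschitz_on_balls_compose:
  fixes f :: "'a::real_normed_vector \<Rightarrow> 'b::real_normed_vector"
  assumes "lipschitz_on_balls g" "lipschitz_on_balls f"
  shows "lipschitz_on_balls (\<lambda>x. g (f x))"
  by (rule lipschitz_on_balls_compose_on[OF assms(2) UNIV_I]) (use assms(1) in \<open>auto simp: lipschitz_on_balls_def\<close>)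

lemma lipschitz_on_balls_linear:
  fixes f :: "'a::real_normed_vector \<Rightarrow> 'b::real_normed_vector"
  assumes "bounded_linear g" "lipschitz_on_balls f"
  shows "lipschitz_on_balls (\<lambda>x. g (f x))"
  by (rule lipschitz_on_balls_compose[OF linear_lipschitz_on_balls(2)[OF assms(1)] assms(2)])

lemma lipschitz_on_balls_Pair:
  fixes f :: "'a::real_normed_vector \<Rightarrow> 'b::metric_space" and g :: "'a \<Rightarrow> 'c::metric_space"
  assumes "lipschitz_on_balls f" "lipschitz_on_balls g"
  shows "lipschitz_on_balls (\<lambda>x. (f x, g x))"
  using assms lipschitz_on_Pair unfolding lipschitz_on_balls_def by blast

lemma lipschitz_on_balls_add:
  fixes f g :: "'a::real_normed_vector \<Rightarrow> 'b::real_normed_vector"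
  assumes "lipschitz_on_balls f" "lipschitz_on_balls g"
  shows "lipschitz_on_balls (\<lambda>x. f x + g x)"
  using assms lipschitz_on_add unfolding lipschitz_on_balls_def by blast

lemma lipschitz_on_balls_const: "lipschitz_on_balls (\<lambda>x. c)"
  using lipschitz_on_constant unfolding lipschitz_on_balls_def by blast

lemma lipschitz_on_balls_sum:
  fixes f :: "'i \<Rightarrow> 'a::real_normed_vector \<Rightarrow> 'b::real_normed_vector"
  assumes "\<And>i. i \<in> I \<Longrightarrow> lipschitz_on_balls (f i)"
  shows "lipschitz_on_balls (\<lambda>x. \<Sum>i\<in>I. f i x)"
  using assms
  by (induction I rule: infinite_finite_induct) (auto intro!: lipschitz_on_balls_const lipschitz_on_balls_add)

lemma lipschitz_on_balls_bilinear:
  fixes f :: "'a::real_normed_vector \<Rightarrow> 'b::real_normed_vector" and g :: "'a \<Rightarrow> 'c::real_normed_vector"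
    and p :: "'b \<Rightarrow> 'c \<Rightarrow> 'd::real_normed_vector"
  assumes p: "bounded_bilinear p" and f: "lipschitz_on_balls f" and g: "lipschitz_on_balls g"
  shows "lipschitz_on_balls (\<lambda>x. p (f x) (g x))"
  unfolding lipschitz_on_balls_iff
proof
  interpret p: bounded_bilinear p by fact
  obtain K where K: "K \<ge> 0" "\<And>a b. norm (p a b) \<le> norm a * norm b * K" using p.nonneg_bounded by blast
  fix r
  obtain M where M: "M \<ge> 0" "\<And>x. norm x \<le> r \<Longrightarrow> norm (f x) \<le> M"
    using lipschitz_on_balls_bounded[OF f] by metis
  obtain M' where M': "M' \<ge> 0" "\<And>x. norm x \<le> r \<Longrightarrow> norm (g x) \<le> M'"
    using lipschitz_on_balls_bounded[OF g] by metis
  obtain L where L: "L \<ge> 0" "\<And>x y. norm x \<le> r \<Longrightarrow> norm y \<le> r \<Longrightarrow> dist (f x) (f y) \<le> L * norm (x - y)"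
    using lipschitz_on_ballsD[OF f] by metis
  obtain L' where L': "L' \<ge> 0" "\<And>x y. norm x \<le> r \<Longrightarrow> norm y \<le> r \<Longrightarrow> dist (g x) (g y) \<le> L' * norm (x - y)"
    using lipschitz_on_ballsD[OF g] by metis
  have "dist (p (f x) (g x)) (p (f y) (g y)) \<le> (L * M' * K + M * L' * K) * norm (x - y)"
    if r: "norm x \<le> r" "norm y \<le> r" for x y
  proof -
    have "p (f x) (g x) - p (f y) (g y) = p (f x - f y) (g x) + p (f y) (g x - g y)"
      by (simp add: p.diff_left p.diff_right)
    also have "norm \<dots> \<le> L * norm (x - y) * M' * K + M * (L' * norm (x - y)) * K"
    proof (rule norm_triangle_mono)
      show "norm (p (f x - f y) (g x)) \<le> L * norm (x - y) * M' * K"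
        using L(2)[OF r] M'(2)[OF r(1)] K(1) L(1)
        by (intro order_trans[OF K(2)] mult_right_mono mult_mono) (auto simp: dist_norm)
      show "norm (p (f y) (g x - g y)) \<le> M * (L' * norm (x - y)) * K"
        using L'(2)[OF r] M(2)[OF r(2)] M(1) K(1)
        by (intro order_trans[OF K(2)] mult_right_mono mult_mono) (auto simp: dist_norm)
    qed
    finally show ?thesis by (simp add: dist_norm algebra_simps)
  qed
  then show "\<exists>L. \<forall>x y. norm x \<le> r \<longrightarrow> norm y \<le> r \<longrightarrow> dist (p (f x) (g x)) (p (f y) (g y)) \<le> L * norm (x - y)"
    by blast
qed

text \<open>Mean value inequality on a convex set, with the derivative bounded there by
  compactness.\<close>

lemma C1_on_lipschitz:
  fixes g :: "'a::euclidean_space \<Rightarrow> 'b::real_normed_vector"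
  assumes g: "C1_on S g" and S: "subspace S"
  shows "\<exists>L. L-lipschitz_on (S \<inter> cball 0 r) g"
proof -
  obtain g' :: "'a \<Rightarrow> 'a \<Rightarrow>\<^sub>L 'b"
    where g': "\<And>x. x \<in> S \<Longrightarrow> (g has_derivative blinfun_apply (g' x)) (at x within S)" "continuous_on S g'"
    using g by (auto simp: C1_on_def)
  have "compact (S \<inter> cball 0 r)" by (intro closed_Int_compact closed_subspace S compact_cball)
  then have "bounded (g' ` (S \<inter> cball 0 r))"
    by (intro compact_imp_bounded compact_continuous_image continuous_on_subset[OF g'(2)]) auto
  then obtain M where M: "\<And>x. x \<in> S \<inter> cball 0 r \<Longrightarrow> norm (g' x) \<le> M" unfolding bounded_iff by blast
  have "norm (g x - g y) \<le> max 0 M * norm (x - y)" if "x \<in> S \<inter> cball 0 r" "y \<in> S \<inter> cball 0 r" for x y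
  proof (rule differentiable_bound[where f' = "\<lambda>x. blinfun_apply (g' x)"])
    show "convex (S \<inter> cball 0 r)" by (intro convex_Int subspace_imp_convex S convex_cball)
    show "(g has_derivative blinfun_apply (g' x)) (at x within S \<inter> cball 0 r)" if "x \<in> S \<inter> cball 0 r" for x
      using that by (intro has_derivative_subset[OF g'(1)]) auto
    show "onorm (blinfun_apply (g' x)) \<le> max 0 M" if "x \<in> S \<inter> cball 0 r" for x
      using M[OF that] by (simp add: norm_blinfun.rep_eq)
  qed (use that in auto)
  then have "(max 0 M)-lipschitz_on (S \<inter> cball 0 r) g" by (intro lipschitz_onI) (auto simp: dist_norm)
  then show ?thesis by blast
qed

lemma C1_on_UNIV_lipschitz_on_balls:
  fixes g :: "'a::euclidean_space \<Rightarrow> 'b::real_normed_vector"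
  assumes "C1_on UNIV g" shows "lipschitz_on_balls g"
  using C1_on_lipschitz[OF assms subspace_UNIV] by (simp add: lipschitz_on_balls_def)

lemma C2_E:
  fixes g :: "'a::euclidean_space \<Rightarrow> 'b::real_normed_vector"
  assumes "C2 g"
  obtains g' :: "'a \<Rightarrow> 'a \<Rightarrow>\<^sub>L 'b" and g'' where
    "\<And>x. (g has_derivative blinfun_apply (g' x)) (at x)" "continuous_on UNIV g'"
    "lipschitz_on_balls g" "lipschitz_on_balls g'" "\<And>x. (g' has_derivative g'' x) (at x)"
proof -
  obtain g' :: "'a \<Rightarrow> 'a \<Rightarrow>\<^sub>L 'b" where g': "\<And>x. (g has_derivative blinfun_apply (g' x)) (at x)" "C1_on UNIV g'"
    using assms by (auto simp: C2_def)
  obtain g'' :: "'a \<Rightarrow> 'a \<Rightarrow>\<^sub>L ('a \<Rightarrow>\<^sub>L 'b)" where g'': "\<And>x. (g' has_derivative blinfun_apply (g'' x)) (at x)"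
    using g'(2) by (auto simp: C1_on_def)
  have cont: "continuous_on UNIV g'"
    using has_derivative_continuous[OF g''] by (simp add: continuous_at_imp_continuous_on)
  then have "C1_on UNIV g" using g'(1) by (auto simp: C1_on_def)
  then have "lipschitz_on_balls g" by (rule C1_on_UNIV_lipschitz_on_balls)
  moreover have "lipschitz_on_balls g'" by (rule C1_on_UNIV_lipschitz_on_balls[OF g'(2)])
  ultimately show ?thesis by (rule that[OF g'(1) cont _ _ g''])
qed

section \<open>Gradients, adjoints and stacked vectors as finite sums\<close>

lemma GDERIV_grad:
  fixes f :: "'a::euclidean_space \<Rightarrow> real"
  assumes "(f has_derivative f') (at x)"
  shows "GDERIV f x :> grad f x" and "grad f x = (\<Sum>b\<in>Basis. f' b *\<^sub>R b)"
proof -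
  have lin: "linear f'" using assms has_derivative_linear by blast
  have *: "GDERIV f x :> (\<Sum>b\<in>Basis. f' b *\<^sub>R b)"
  proof -
    have "h \<bullet> (\<Sum>b\<in>Basis. f' b *\<^sub>R b) = f' h" for h
    proof -
      have "f' h = f' (\<Sum>b\<in>Basis. (h \<bullet> b) *\<^sub>R b)" by (simp add: euclidean_representation)
      also have "\<dots> = (\<Sum>b\<in>Basis. (h \<bullet> b) * f' b)" by (simp add: linear_sum[OF lin] linear_scale[OF lin])
      finally show ?thesis by (simp add: inner_sum_right mult.commute)
    qed
    then show ?thesis using assms by (simp add: gderiv_def)
  qed
  have unique: "D = D'" if "GDERIV f x :> D" "GDERIV f x :> D'" for D D'
  proof -
    have "(\<lambda>h. h \<bullet> D) = (\<lambda>h. h \<bullet> D')"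
      using that unfolding gderiv_def by (rule has_derivative_unique)
    then have "\<forall>h. h \<bullet> D = h \<bullet> D'" by (simp add: fun_eq_iff)
    then show ?thesis by (simp add: vector_eq_ldot)
  qed
  have "grad f x = (\<Sum>b\<in>Basis. f' b *\<^sub>R b)" unfolding grad_def using * unique by blast
  with * show "GDERIV f x :> grad f x" "grad f x = (\<Sum>b\<in>Basis. f' b *\<^sub>R b)" by simp_all
qed

text \<open>The expansion shows the adjoint as a linear function of \<open>F\<close>, so that
  transposed Jacobians inherit derivatives and Lipschitz bounds from the Jacobians; the gradient is
  expanded for the same reason.\<close>

lemma adjoint_as_sum:
  fixes F :: "'a::euclidean_space \<Rightarrow> 'b::euclidean_space"
  assumes "linear F"
  shows "adjoint F y = (\<Sum>b\<in>Basis. (F b \<bullet> y) *\<^sub>R b)"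
proof -
  have "adjoint F y = (\<Sum>b\<in>Basis. (adjoint F y \<bullet> b) *\<^sub>R b)" by (simp add: euclidean_representation)
  then show ?thesis by (simp add: adjoint_clauses[OF assms] inner_commute)
qed

lemma transpose_jacobian:
  fixes h :: "real^'d \<Rightarrow> real^'m"
  assumes "(h has_derivative h') (at x)"
  shows "transpose (jacobian h (at x)) *v y = adjoint h' y" "jacobian h (at x) *v v = h' v"
proof -
  have h': "h' = frechet_derivative h (at x)" using assms by (rule frechet_derivative_at)
  have lin: "linear h'" using assms has_derivative_linear by blast
  then have eq: "h' = (\<lambda>v. jacobian h (at x) *v v)"
    unfolding jacobian_def h'[symmetric] by (simp add: fun_eq_iff matrix_works)
  then show "jacobian h (at x) *v v = h' v" by simp
  show "transpose (jacobian h (at x)) *v y = adjoint h' y" by (simp add: eq adjoint_matrix)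
qed

lemma vec_lambda_sum_axis: "(\<chi> i. f i) = (\<Sum>i\<in>UNIV. axis i (f i :: 'a::comm_monoid_add) :: 'a^'n)"
  by (simp add: vec_eq_iff axis_def)

lemma bounded_linear_axis: "bounded_linear (axis i :: 'a::euclidean_space \<Rightarrow> 'a^'n)"
  unfolding linear_conv_bounded_linear[symmetric]
  by (intro linearI) (simp_all add: vec_eq_iff axis_def)

lemma lipschitz_on_balls_vec_lambda:
  fixes f :: "'n::finite \<Rightarrow> 'a::real_normed_vector \<Rightarrow> 'b::euclidean_space"
  assumes "\<And>i. lipschitz_on_balls (f i)"
  shows "lipschitz_on_balls (\<lambda>x. (\<chi> i. f i x) :: 'b^'n)"
  by (subst vec_lambda_sum_axis)
     (intro lipschitz_on_balls_sum lipschitz_on_balls_linear[OF bounded_linear_axis] assms)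

lemma has_derivative_vec_lambda:
  fixes f :: "'n::finite \<Rightarrow> 'a::real_normed_vector \<Rightarrow> 'b::euclidean_space"
  assumes "\<And>i. (f i has_derivative f' i) F"
  shows "((\<lambda>x. (\<chi> i. f i x) :: 'b^'n) has_derivative (\<lambda>v. \<chi> i. f' i v)) F"
  by (subst (1 2) vec_lambda_sum_axis)
     (intro has_derivative_sum bounded_linear.has_derivative[OF bounded_linear_axis] assms)

section \<open>The network Laplacian and the stacked constraints\<close>

lemma grad_eqI:
  fixes f :: "'a::euclidean_space \<Rightarrow> real"
  assumes "GDERIV f x :> D"
  shows "grad f x = D"
proof -
  have "GDERIV f x :> grad f x" using GDERIV_grad(1) assms unfolding gderiv_def by blast
  then have "(\<lambda>v. v \<bullet> grad f x) = (\<lambda>v. v \<bullet> D)"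
    using assms unfolding gderiv_def by (rule has_derivative_unique)
  then have "\<forall>v. v \<bullet> grad f x = v \<bullet> D" by (simp add: fun_eq_iff)
  then show ?thesis by (simp add: vector_eq_ldot)
qed

lemma GDERIV_sum:
  assumes "\<And>i. i \<in> I \<Longrightarrow> GDERIV (f i) x :> D i"
  shows "GDERIV (\<lambda>x. \<Sum>i\<in>I. f i x) x :> (\<Sum>i\<in>I. D i)"
  using assms unfolding gderiv_def inner_sum_right by (rule has_derivative_sum)

lemma grad_stacked_cost:
  fixes f :: "'n::finite \<Rightarrow> real^'d \<Rightarrow> real"
  assumes "\<And>i s. GDERIV (f i) s :> grad (f i) s"
  shows "grad (stacked_cost f) x = (\<chi> i. grad (f i) (x $ i))"
proof (rule grad_eqI)
  have "((\<lambda>x. f i (x $ i)) has_derivative (\<lambda>v. v $ i \<bullet> grad (f i) (x $ i))) (at x)" for i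
    by (rule has_derivative_compose[OF bounded_linear_imp_has_derivative[OF bounded_linear_vec_nth]])
       (use assms in \<open>simp add: gderiv_def\<close>)
  then have "((\<lambda>x. \<Sum>i\<in>UNIV. f i (x $ i)) has_derivative (\<lambda>v. \<Sum>i\<in>UNIV. v $ i \<bullet> grad (f i) (x $ i))) (at x)"
    by (intro has_derivative_sum)
  then show "GDERIV (stacked_cost f) x :> (\<chi> i. grad (f i) (x $ i))"
    by (simp add: gderiv_def stacked_cost_def[abs_def] inner_vec_def)
qed

lemma inner_consensus: "(consensus s :: real^'d^'n) \<bullet> y = s \<bullet> (\<Sum>i\<in>UNIV. y $ i)"
  unfolding inner_sum_right inner_vec_def[of "consensus s :: real^'d^'n"] by (simp add: consensus_def)

lemma norm_consensus: "(norm (consensus s :: real^'d^'n))\<^sup>2 = real CARD('n) * (norm s)\<^sup>2"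
  unfolding power2_norm_eq_inner by (simp add: consensus_def inner_vec_def)

lemma subspace_constr_space: "subspace (constr_space R)"
  by (auto simp: subspace_def constr_space_def)

lemma bounded_linear_stack_op: "bounded_linear (stack_op M)"
  unfolding linear_conv_bounded_linear[symmetric]
  by (intro linearI)
     (simp_all add: stack_op_def vec_eq_iff scaleR_add_right sum.distrib scaleR_sum_right mult.commute)

section \<open>The Laplacian as a quadratic form: kernel, range and inverse\<close>

context
  fixes a :: "real^'n^'n"
  assumes weights: "\<And>i j. a $ i $ j \<ge> 0" "\<And>i. a $ i $ i = 0"
    and undirected: "\<And>i j. a $ i $ j = a $ j $ i"
begin

lemma Lap_component: "Lap a x $ i = (\<Sum>j\<in>UNIV. a $ i $ j *\<^sub>R (x $ i - x $ j))"
proof -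
  have "laplacian a $ i $ j = (if j = i then (\<Sum>k\<in>UNIV. a $ i $ k) else 0) - a $ i $ j" for j
    using weights(2) by (simp add: laplacian_def)
  then have "Lap a x $ i = (\<Sum>j\<in>UNIV. (if j = i then (\<Sum>k\<in>UNIV. a $ i $ k) *\<^sub>R x $ j else 0) - a $ i $ j *\<^sub>R x $ j)"
    by (auto simp: stack_op_def scaleR_diff_left intro!: sum.cong)
  also have "\<dots> = (\<Sum>k\<in>UNIV. a $ i $ k) *\<^sub>R x $ i - (\<Sum>j\<in>UNIV. a $ i $ j *\<^sub>R x $ j)"
    by (simp add: sum_subtractf)
  finally show ?thesis by (simp add: scaleR_diff_right sum_subtractf scaleR_sum_left)
qed

text \<open>The double sum is averaged with its copy under exchange of the two indices, which
  symmetric weights permit. Symmetry and semidefiniteness of the Laplacian can then be read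
  off.\<close>

lemma Lap_form:
  "2 * (x \<bullet> Lap a y) = (\<Sum>i\<in>UNIV. \<Sum>j\<in>UNIV. a $ i $ j * ((x $ i - x $ j) \<bullet> (y $ i - y $ j)))"
proof -
  have 1: "x \<bullet> Lap a y = (\<Sum>i\<in>UNIV. \<Sum>j\<in>UNIV. a $ i $ j * (x $ i \<bullet> (y $ i - y $ j)))"
    by (simp add: inner_vec_def[of x] Lap_component inner_sum_right)
  also have "\<dots> = (\<Sum>i\<in>UNIV. \<Sum>j\<in>UNIV. a $ j $ i * (x $ j \<bullet> (y $ j - y $ i)))"
    by (rule sum.swap)
  finally have 2: "x \<bullet> Lap a y = (\<Sum>i\<in>UNIV. \<Sum>j\<in>UNIV. a $ i $ j * (x $ j \<bullet> (y $ j - y $ i)))"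
    by (simp add: undirected)
  have "2 * (x \<bullet> Lap a y) = (\<Sum>i\<in>UNIV. \<Sum>j\<in>UNIV. a $ i $ j * (x $ i \<bullet> (y $ i - y $ j)) + a $ i $ j * (x $ j \<bullet> (y $ j - y $ i)))"
    unfolding sum.distrib using 1 2 by simp
  then show ?thesis by (simp add: inner_diff_left inner_diff_right algebra_simps)
qed

lemma Lap_symmetric: "x \<bullet> Lap a y = Lap a x \<bullet> y"
  using Lap_form[of x y] Lap_form[of y x] by (simp add: inner_commute)

lemma Lap_nonneg: "x \<bullet> Lap a x \<ge> 0"
proof -
  have "0 \<le> 2 * (x \<bullet> Lap a x)"
    unfolding Lap_form by (intro sum_nonneg mult_nonneg_nonneg weights) simp
  then show ?thesis by simp
qed

lemma Lap_consensus: "Lap a (consensus s) = 0"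
  by (simp add: vec_eq_iff[where x = "Lap a (consensus s)"] Lap_component) (simp add: consensus_def)

lemma sum_Lap: "(\<Sum>i\<in>UNIV. Lap a x $ i) = 0"
proof -
  have "s \<bullet> (\<Sum>i\<in>UNIV. Lap a x $ i) = 0" for s
    using Lap_symmetric[of "consensus s" x] by (simp add: inner_consensus Lap_consensus)
  then show ?thesis using vector_eq_ldot[of "\<Sum>i\<in>UNIV. Lap a x $ i" 0] by simp
qed

text \<open>All summands of the form are nonnegative, so they vanish one by one: x agrees across
  every edge, and by connectedness along paths.\<close>

lemma consensus_of_Lap_form:
  assumes conn: "connected_graph a" and 0: "x \<bullet> Lap a x = 0"
  shows "\<exists>s. x = consensus s"
proof -
  have nn: "0 \<le> a $ i $ j * ((x $ i - x $ j) \<bullet> (x $ i - x $ j))" for i j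
    by (intro mult_nonneg_nonneg weights) simp
  have "(\<Sum>i\<in>UNIV. \<Sum>j\<in>UNIV. a $ i $ j * ((x $ i - x $ j) \<bullet> (x $ i - x $ j))) = 0"
    using Lap_form[of x x] 0 by simp
  then have zero: "a $ i $ j * ((x $ i - x $ j) \<bullet> (x $ i - x $ j)) = 0" for i j
    using nn by (simp add: sum_nonneg_eq_0_iff sum_nonneg)
  have "x $ i = x $ j" if "(i, j) \<in> {(i, j). a $ i $ j > 0}\<^sup>*" for i j
    using that
  proof induction
    case (step j k)
    then show ?case using zero[of j k] by auto
  qed simp
  then have "x $ i = x $ undefined" for i using conn by (auto simp: connected_graph_def)
  then show ?thesis by (intro exI[of _ "x $ undefined"]) (simp add: consensus_def vec_eq_iff)
qed

text \<open>The range of a symmetric operator is the orthogonal complement of its kernel, here of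
  the consensus vectors.\<close>

lemma range_Lap_iff:
  fixes y :: "real^'d^'n"
  assumes conn: "connected_graph a"
  shows "y \<in> range (Lap a) \<longleftrightarrow> (\<Sum>i\<in>UNIV. y $ i) = 0"
proof
  assume y: "(\<Sum>i\<in>UNIV. y $ i) = 0"
  have "linear (Lap a :: real^'d^'n \<Rightarrow> real^'d^'n)" by (intro bounded_linear.linear bounded_linear_stack_op)
  then have "subspace (range (Lap a :: real^'d^'n \<Rightarrow> real^'d^'n))" by (rule linear_subspace_image) (rule subspace_UNIV)
  then show "y \<in> range (Lap a)"
  proof (rule mem_subspace_if_orthogonal)
    fix q :: "real^'d^'n" assume q: "\<And>x. x \<in> range (Lap a) \<Longrightarrow> x \<bullet> q = 0"
    then have "q \<bullet> Lap a q = 0" by (metis inner_commute rangeI)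
    then obtain s where "q = consensus s" using consensus_of_Lap_form[OF conn] by blast
    then show "y \<bullet> q = 0" using y by (simp add: inner_commute[of y] inner_consensus)
  qed
qed (auto simp: sum_Lap)

text \<open>Adding the block-sum operator \<open>J\<close> makes the Laplacian positive definite. On
  vectors with block sum 0 the addition is invisible, so the inverse of the sum inverts the
  Laplacian on its range.\<close>

lemma Lap_inverse_exists:
  assumes conn: "connected_graph a"
  obtains g :: "real^'d^'n \<Rightarrow> real^'d^'n" where "bounded_linear g" "\<And>u w. u \<bullet> g w = g u \<bullet> w"
    "\<And>y. y \<noteq> 0 \<Longrightarrow> y \<bullet> g y > 0" "\<And>y. y \<in> range (Lap a) \<Longrightarrow> Lap a (g y) = y"
proof -
  define J where "J x = (consensus (\<Sum>i\<in>UNIV. x $ i) :: real^'d^'n)" for x :: "real^'d^'n"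
  define M where "M x = Lap a x + J x" for x
  have linL: "linear (Lap a :: real^'d^'n \<Rightarrow> real^'d^'n)" by (intro bounded_linear.linear bounded_linear_stack_op)
  have linJ: "linear J"
    by (intro linearI) (simp_all add: J_def consensus_def vec_eq_iff sum.distrib scaleR_sum_right)
  have linM: "linear M" unfolding M_def by (intro linear_compose_add linL linJ)
  have Jsym: "x \<bullet> J y = J x \<bullet> y" for x y
    by (simp add: J_def inner_consensus inner_commute[of x])  (simp add: inner_commute)
  have Jform: "x \<bullet> J x = (norm (\<Sum>i\<in>UNIV. x $ i))\<^sup>2" for x
    by (simp add: J_def inner_commute[of x] inner_consensus power2_norm_eq_inner)
  have Msym: "x \<bullet> M y = M x \<bullet> y" for x y
    by (simp add: M_def inner_add_left inner_add_right Jsym Lap_symmetric)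
  have Mpos: "x \<bullet> M x > 0" if "x \<noteq> 0" for x
  proof (rule ccontr)
    assume "\<not> x \<bullet> M x > 0"
    moreover have "x \<bullet> M x = x \<bullet> Lap a x + (norm (\<Sum>i\<in>UNIV. x $ i))\<^sup>2"
      by (simp add: M_def inner_add_right Jform)
    moreover have "x \<bullet> Lap a x \<ge> 0" "(norm (\<Sum>i\<in>UNIV. x $ i))\<^sup>2 \<ge> 0" by (rule Lap_nonneg) simp
    ultimately have "x \<bullet> Lap a x = 0" "(norm (\<Sum>i\<in>UNIV. x $ i))\<^sup>2 = 0" by linarith+
    then obtain s where s: "x = consensus s" "(\<Sum>i\<in>UNIV. x $ i) = 0"
      using consensus_of_Lap_form[OF conn] by auto
    then have "x \<bullet> x = 0" by (simp add: inner_consensus)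
    with that show False by simp
  qed
  have "inj M" using Mpos by (force simp: linear_injective_0[OF linM])
  then obtain g where g: "linear g" "\<And>x. g (M x) = x" "\<And>x. M (g x) = x"
    using linear_injective_isomorphism[OF linM] by blast
  show ?thesis
  proof (rule that[of g])
    show "bounded_linear g" using g(1) by (simp add: linear_conv_bounded_linear)
    show "u \<bullet> g w = g u \<bullet> w" for u w
      using Msym[of "g u" "g w"] by (simp add: g(3))
    show "y \<bullet> g y > 0" if "y \<noteq> 0" for y
    proof -
      have "g y \<noteq> 0" using g(3)[of y] that linear_0[OF linM] by metis
      from Mpos[OF this] show ?thesis by (simp add: g(3) inner_commute)
    qed
    fix y :: "real^'d^'n" assume y: "y \<in> range (Lap a)"
    \<comment> \<open>Laplacian values have block sum 0, so the block sum of \<open>y\<close> is N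
      times that of \<open>g y\<close>; both vanish.\<close>
    have "(\<Sum>i\<in>UNIV. M (g y) $ i) = real CARD('n) *\<^sub>R (\<Sum>i\<in>UNIV. g y $ i)"
      by (simp add: M_def sum.distrib sum_Lap J_def) (simp add: consensus_def sum_constant_scaleR del: sum_constant)
    then have "(\<Sum>i\<in>UNIV. g y $ i) = 0" using y by (simp add: g(3) range_Lap_iff[OF conn])
    then have "J (g y) = 0" by (simp add: J_def consensus_def vec_eq_iff)
    with g(3)[of y] show "Lap a (g y) = y" by (simp add: M_def)
  qed
qed

end

text \<open>Rank r means that the stacked Jacobian fills the space of correctly padded vectors.
  Hence \<mu> is itself a value of it at some v, and |\<mu>|^2 is v paired with the vanishing
  adjoint sum.\<close>

lemma full_rank_adjoint_injective:
  fixes h :: "'n::finite \<Rightarrow> real^'d \<Rightarrow> real^'m"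
  assumes h': "\<And>i. (h i has_derivative h' i) (at s)"
    and supp: "\<And>i s k. k \<notin> R i \<Longrightarrow> h i s $ k = 0"
    and rank: "rank (stacked_jacobian h (consensus s)) = constr_dim R"
    and \<mu>: "\<mu> \<in> constr_space R" "(\<Sum>i\<in>UNIV. adjoint (h' i) (\<mu> $ i)) = 0"
  shows "\<mu> = 0"
proof -
  let ?M = "stacked_jacobian h (consensus s) :: real^'d^('n \<times> 'm)"
  have M: "(?M *v v) $ p = h' (fst p) v $ snd p" for v p
  proof -
    have "h' (fst p) v $ snd p = (jacobian (h (fst p)) (at s) *v v) $ snd p"
      using transpose_jacobian(2)[OF h'] by simp
    then show ?thesis
      by (simp add: stacked_jacobian_def consensus_def matrix_vector_mult_def)
  qed
  have h'_supp: "h' i v $ k = 0" if "k \<notin> R i" for i v k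
  proof -
    have "((\<lambda>s. h i s $ k) has_derivative (\<lambda>v. h' i v $ k)) (at s)"
      by (rule bounded_linear.has_derivative[OF bounded_linear_vec_nth h'])
    then have "((\<lambda>s. 0) has_derivative (\<lambda>v. h' i v $ k)) (at s)" using supp[OF that] by simp
    from has_derivative_unique[OF this has_derivative_const] show ?thesis by (rule fun_cong)
  qed
  let ?P = "SIGMA i:UNIV. R i"
  let ?W = "{w :: real^('n \<times> 'm). \<forall>p. p \<notin> ?P \<longrightarrow> w $ p = 0}"
  have "range (\<lambda>v. ?M *v v) = ?W"
  proof (rule subspace_dim_equal)
    show "subspace (range (\<lambda>v. ?M *v v))"
      by (intro linear_subspace_image subspace_UNIV matrix_vector_mul_linear)
    show "subspace ?W" by (auto simp: subspace_def)
    show "range (\<lambda>v. ?M *v v) \<subseteq> ?W" using h'_supp by (auto simp: M)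
    have "dim ?W = card ?P"
      using dim_substandard_cart[of ?P, where 'a = real] by (simp add: dim_vec_eq)
    also have "\<dots> = constr_dim R" by (simp add: constr_dim_def card_SigmaI)
    finally show "dim ?W \<le> dim (range (\<lambda>v. ?M *v v))" using rank by (simp add: rank_dim_range)
  qed
  moreover have "(\<chi> p. \<mu> $ fst p $ snd p) \<in> ?W" using \<mu>(1) by (auto simp: constr_space_def)
  ultimately obtain v where v: "(\<chi> p. \<mu> $ fst p $ snd p) = ?M *v v" by blast
  have h'v: "h' i v = \<mu> $ i" for i
    using M[of v] v[symmetric] by (auto simp: vec_eq_iff)
  have "\<mu> \<bullet> \<mu> = (\<Sum>i\<in>UNIV. h' i v \<bullet> \<mu> $ i)" by (simp add: inner_vec_def[of \<mu>] h'v)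
  also have "\<dots> = v \<bullet> (\<Sum>i\<in>UNIV. adjoint (h' i) (\<mu> $ i))"
    by (simp add: inner_sum_right adjoint_works[OF has_derivative_linear[OF h']])
  finally show ?thesis by (simp add: \<mu>(2))
qed

text \<open>At a common point s the local constraints form one map \<open>H\<close>. On feasible
  points the multiplier term of the Lagrangian \<open>l\<close> vanishes, so \<open>l\<close>
  inherits the growth of the cost, while its gradient is zero at \<open>s0\<close>.\<close>

lemma lagrangian_multiplier_growth:
  fixes f :: "'n::finite \<Rightarrow> real^'d \<Rightarrow> real" and h :: "'n \<Rightarrow> real^'d \<Rightarrow> real^'m"
    and h' :: "'n \<Rightarrow> real^'d \<Rightarrow> (real^'d) \<Rightarrow>\<^sub>L (real^'m)"
  assumes h: "\<And>i s. (h i has_derivative blinfun_apply (h' i s)) (at s)" "\<And>i. continuous_on UNIV (h' i)"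
      "\<And>i. (h' i has_derivative h'' i) (at s0)"
    and f: "\<And>i s. GDERIV (f i) s :> q i s" "\<And>i. (q i has_derivative Q i) (at s0)"
    and supp: "\<And>i s k. k \<notin> R i \<Longrightarrow> h i s $ k = 0"
    and s0: "s0 \<in> feasible h" "open U" "s0 \<in> U"
    and growth: "\<rho> > 0" "\<And>s. s \<in> feasible h \<inter> U \<Longrightarrow>
      (\<Sum>i\<in>UNIV. f i s) \<ge> (\<Sum>i\<in>UNIV. f i s0) + \<rho> / 2 * (norm (s - s0))\<^sup>2"
    and rank: "rank (stacked_jacobian h (consensus s0)) = constr_dim R"
  shows "\<exists>\<mu>\<in>constr_space R. (\<Sum>i\<in>UNIV. q i s0 + adjoint (h' i s0) (\<mu> $ i)) = 0 \<and>
    (\<forall>v. (\<forall>i. h' i s0 v = 0) \<longrightarrow>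
      \<rho> * (norm v)\<^sup>2 \<le> v \<bullet> (\<Sum>i\<in>UNIV. Q i v + (\<Sum>b\<in>Basis. (h'' i v b \<bullet> \<mu> $ i) *\<^sub>R b)))"
proof -
  define H where "H s = (\<chi> i. h i s)" for s
  define H' where "H' s = (\<Sum>i\<in>UNIV. Blinfun (axis i) o\<^sub>L h' i s)" for s
  have H'_apply: "H' s v = (\<chi> i. h' i s v)" for s v
    unfolding H'_def vec_lambda_sum_axis
    by (simp add: blinfun.sum_left bounded_linear_Blinfun_apply bounded_linear_axis)
  have linh': "linear (blinfun_apply (h' i s))" for i s
    by (simp add: blinfun.bounded_linear_right bounded_linear.linear)
  have H'_adj: "adjoint (H' s) z = (\<Sum>i\<in>UNIV. adjoint (h' i s) (z $ i))" for s z
  proof -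
    have "adjoint (H' s) = (\<lambda>z. \<Sum>i\<in>UNIV. adjoint (h' i s) (z $ i))"
      by (rule adjoint_unique)
         (simp add: H'_apply inner_vec_def[where 'a = "real^'m"] inner_sum_right adjoint_works[OF linh'])
    then show ?thesis by simp
  qed
  have der: "(H has_derivative blinfun_apply (H' s)) (at s)" for s
    using has_derivative_vec_lambda[where f = h and f' = "\<lambda>i. blinfun_apply (h' i s)" and F = "at s", OF h(1)] by (simp add: H_def[abs_def] H'_apply[abs_def])
  have cont: "continuous_on UNIV H'" unfolding H'_def by (intro continuous_intros h(2))
  have HZ: "H s \<in> constr_space R" for s by (simp add: H_def constr_space_def supp)
  have H0_iff: "H s = 0 \<longleftrightarrow> s \<in> feasible h" for s by (simp add: H_def feasible_def vec_eq_iff[where x = "\<chi> i. h i s"])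
  have H0: "H s0 = 0" using s0(1) H0_iff by simp
  have inj: "z = 0" if "z \<in> constr_space R" "adjoint (H' s0) z = 0" for z
    by (rule full_rank_adjoint_injective[OF h(1) supp rank that(1)]) (use that(2) H'_adj in auto)
  obtain d where d: "d > 0" "ball s0 d \<subseteq> U" using s0(2,3) open_contains_ball by metis
  have grow: "(\<Sum>i\<in>UNIV. f i s0) + \<rho> / 2 * (norm (s - s0))\<^sup>2 \<le> (\<Sum>i\<in>UNIV. f i s)"
    if "H s = 0" "dist s s0 < d" for s
    using growth(2)[of s] that d(2) by (auto simp: H0_iff dist_commute)
  have min: "(\<Sum>i\<in>UNIV. f i s0) \<le> (\<Sum>i\<in>UNIV. f i s)" if "H s = 0" "dist s s0 < d" for s
  proof -
    have "0 \<le> \<rho> / 2 * (norm (s - s0))\<^sup>2" using growth(1) by simp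
    with grow[OF that] show ?thesis by linarith
  qed
  have grad_F: "GDERIV (\<lambda>s. \<Sum>i\<in>UNIV. f i s) s :> (\<Sum>i\<in>UNIV. q i s)" for s
    by (intro GDERIV_sum f(1))
  obtain \<mu> where \<mu>: "\<mu> \<in> constr_space R" "(\<Sum>i\<in>UNIV. q i s0) + adjoint (H' s0) \<mu> = 0"
    using lagrange_multiplier_exists[OF der cont subspace_constr_space HZ H0 inj, of "\<lambda>s. \<Sum>i\<in>UNIV. f i s"] grad_F d(1) min
    by metis
  define l where "l s = (\<Sum>i\<in>UNIV. f i s) + H s \<bullet> \<mu>" for s
  define g where "g s = (\<Sum>i\<in>UNIV. q i s + (\<Sum>b\<in>Basis. (h' i s b \<bullet> \<mu> $ i) *\<^sub>R b))" for s
  define M where "M v = (\<Sum>i\<in>UNIV. Q i v + (\<Sum>b\<in>Basis. (h'' i v b \<bullet> \<mu> $ i) *\<^sub>R b))" for v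
  have g_eq: "g s = (\<Sum>i\<in>UNIV. q i s) + adjoint (H' s) \<mu>" for s
    by (simp add: g_def H'_adj sum.distrib adjoint_as_sum[OF linh'])
  have l: "GDERIV l s :> g s" for s
  proof -
    have linH': "linear (blinfun_apply (H' s))" by (simp add: blinfun.bounded_linear_right bounded_linear.linear)
    have "((\<lambda>s. (\<Sum>i\<in>UNIV. f i s) + H s \<bullet> \<mu>) has_derivative (\<lambda>v. v \<bullet> (\<Sum>i\<in>UNIV. q i s) + H' s v \<bullet> \<mu>)) (at s)"
      using grad_F[of s]
      by (intro has_derivative_add has_derivative_inner_left der) (auto simp: gderiv_def)
    then show ?thesis
      by (simp add: gderiv_def l_def[abs_def] g_eq inner_add_right adjoint_works[OF linH'])
  qed
  have "(g has_derivative M) (at s0)"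
    unfolding g_def[abs_def] M_def[abs_def]
    by (intro has_derivative_sum has_derivative_add f(2) has_derivative_scaleR_left has_derivative_inner_left
        bounded_linear.has_derivative[OF blinfun.bounded_linear_left h(3)])
  moreover have g0: "g s0 = 0" using \<mu>(2) by (simp add: g_eq)
  ultimately have second: "\<rho> * (norm v)\<^sup>2 \<le> v \<bullet> M v" if v: "H' s0 v = 0" for v
    using quadratic_growth_second_order[OF der cont HZ H0 inj l _ _ d(1) _ v, of M \<rho>] grow
    by (auto simp: l_def H0)
  show ?thesis
  proof (intro bexI[OF _ \<mu>(1)] conjI allI impI)
    show "(\<Sum>i\<in>UNIV. q i s0 + adjoint (h' i s0) (\<mu> $ i)) = 0"
      using g0 by (simp add: g_def adjoint_as_sum[OF linh'])
    fix v assume "\<forall>i. h' i s0 v = 0"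
    then have "H' s0 v = 0" by (simp add: H'_apply vec_eq_iff[where y = 0])
    from second[OF this] show "\<rho> * (norm v)\<^sup>2 \<le> v \<bullet> (\<Sum>i\<in>UNIV. Q i v + (\<Sum>b\<in>Basis. (h'' i v b \<bullet> \<mu> $ i) *\<^sub>R b))"
      by (simp add: M_def)
  qed
qed

section \<open>The equilibrium of the singular-perturbation realization\<close>

lemma norm_prod_bounds:
  fixes u :: "'a::real_normed_vector \<times> 'b::real_normed_vector"
  shows "norm (fst u) \<le> norm u" "norm (snd u) \<le> norm u" "norm u \<le> norm (fst u) + norm (snd u)"
  using norm_fst_le[of "fst u" "snd u"] norm_snd_le[of "snd u" "fst u"]
    sqrt_sum_squares_le_sum[of "norm (fst u)" "norm (snd u)"]
  by (simp_all add: norm_prod_def)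

text \<open>Applied to constant trajectories: a decay estimate that such a trajectory must satisfy
  pins it to the origin.\<close>

lemma zero_if_exp_decay:
  fixes y :: "'a::real_normed_vector"
  assumes bound: "\<And>t. t \<ge> 0 \<Longrightarrow> norm y \<le> c * exp (- \<alpha> * t) * d" and "\<alpha> > 0"
  shows "y = 0"
proof -
  have "filterlim (\<lambda>t. - \<alpha> * t) at_bot at_top"
    by (rule filterlim_tendsto_neg_mult_at_bot[OF tendsto_const]) (use \<open>\<alpha> > 0\<close> in \<open>auto intro: filterlim_ident\<close>)
  then have "((\<lambda>t. exp (- \<alpha> * t)) \<longlongrightarrow> 0) at_top" by (rule filterlim_compose[OF exp_at_bot])
  then have "((\<lambda>t. c * exp (- \<alpha> * t) * d) \<longlongrightarrow> c * 0 * d) at_top" by (intro tendsto_intros)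
  then have "norm y \<le> c * 0 * d"
    by (rule tendsto_lowerbound) (use bound in \<open>auto simp: eventually_at_top_linorder\<close>)
  then show ?thesis by simp
qed

theorem theorem1:
  fixes a :: "real^'n^'n"
    and f :: "'n \<Rightarrow> real^'d \<Rightarrow> real"
    and h :: "'n \<Rightarrow> real^'d \<Rightarrow> real^'m"
    and R :: "'n \<Rightarrow> 'm set"
    and s_star :: "real^'d" and U :: "(real^'d) set" and \<rho> :: real
    and G :: "(real^'d^'n) \<times> (real^'m^'n) \<Rightarrow> (real^'d^'n) \<times> (real^'m^'n)"
    and Gg :: "real^'d^'n \<Rightarrow> real^'d^'n" and Gh :: "real^'m^'n \<Rightarrow> real^'m^'n"
    and Ggi :: "'n \<Rightarrow> real^'d \<Rightarrow> real^'d" and Ghi :: "'n \<Rightarrow> real^'m \<Rightarrow> real^'m"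
    and \<alpha>G K0c K0h :: real
  defines "F \<equiv> \<lambda>s. \<Sum>i\<in>UNIV. f i s"
    and "Y \<equiv> range (Lap a) \<times> constr_space R"
    and "x_star \<equiv> consensus s_star :: real^'d^'n"
  assumes weights: "\<And>i j. a $ i $ j \<ge> 0" "\<And>i. a $ i $ i = 0"
    and undirected: "\<And>i j. a $ i $ j = a $ j $ i"
    and connected: "connected_graph a"
    and h_range: "\<And>i s k. k \<notin> R i \<Longrightarrow> h i s $ k = 0"
    and smooth: "\<And>i. C2 (f i)" "\<And>i. C2 (h i)"
    and hessian_lipschitz: "\<And>i. locally_lipschitz (\<lambda>s. jacobian (grad (f i)) (at s))"
    and jacobian_lipschitz: "\<And>i. locally_lipschitz (\<lambda>s. jacobian (h i) (at s))"
    and s_star: "s_star \<in> feasible h" "open U" "s_star \<in> U" "\<rho> > 0"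
    and minimizer: "local_minimizer_on F (feasible h \<inter> U) s_star"
    and growth: "\<And>s. s \<in> feasible h \<inter> U \<Longrightarrow> F s \<ge> F s_star + \<rho> / 2 * (norm (s - s_star))\<^sup>2"
    and full_rank: "\<And>x. x \<in> consensus ` feasible h \<inter> consensus ` U \<Longrightarrow>
                      rank (stacked_jacobian h x) = constr_dim R"
    and G_maps: "\<And>y. y \<in> Y \<Longrightarrow> G y \<in> Y"
    and G_C1: "C1_on Y G"
    and G_zero: "G 0 = 0"
    and G_stable: "\<alpha>G > 0" "globally_exp_stable G Y \<alpha>G"
    and G_split: "\<And>yg yh. (yg, yh) \<in> Y \<Longrightarrow> G (yg, yh) = (Gg yg, Gh yh)"
    and Gg_split: "\<And>yg. yg \<in> range (Lap a) \<Longrightarrow> Gg yg = block_map Ggi yg"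
    and Gh_split: "\<And>yh. yh \<in> constr_space R \<Longrightarrow> Gh yh = block_map Ghi yh"
    and gains: "K0c > 0" "K0h > 0"
  shows "\<exists>z_star.
    (\<forall>\<tau>>0. locally_unique_equilibrium
       (sp_field a f h Gg Gh (K0c / \<tau>) (K0h / \<tau>)) (sp_space a R) (x_star, z_star)) \<and>
    (\<forall>\<alpha>FL. 0 < \<alpha>FL \<and> \<alpha>FL < min (\<rho> / real CARD('n)) \<alpha>G \<longrightarrow>
     (\<forall>\<alpha>SP. 0 < \<alpha>SP \<and> \<alpha>SP < \<alpha>FL \<longrightarrow>
      (\<exists>\<tau>_star>0. \<forall>\<tau>. 0 < \<tau> \<and> \<tau> < \<tau>_star \<longrightarrow>
       (\<exists>C>0. \<exists>\<delta>>0. \<forall>p0 \<in> sp_space a R.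
         norm (fst p0 - x_star) + norm (snd p0 - z_star) < \<delta> \<longrightarrow>
         (\<exists>\<phi>. is_solution (sp_field a f h Gg Gh (K0c / \<tau>) (K0h / \<tau>)) (sp_space a R) \<phi> \<and>
              \<phi> 0 = p0 \<and>
              (\<forall>\<psi>. is_solution (sp_field a f h Gg Gh (K0c / \<tau>) (K0h / \<tau>)) UNIV \<psi> \<and> \<psi> 0 = p0
                   \<longrightarrow> (\<forall>t\<ge>0. \<psi> t = \<phi> t)) \<and>
              (\<forall>t\<ge>0. norm (fst (\<phi> t) - x_star) + norm (snd (\<phi> t) - z_star)
                     + norm (Lap a (fst (\<phi> t))) + norm (block_map h (fst (\<phi> t)))
                   \<le> C * exp (- \<alpha>SP * t) *
                       (norm (fst p0 - x_star) + norm (snd p0 - z_star))))))))"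
proof -

  \<comment> \<open>Derivatives of the local costs and constraints\<close>
  have "\<forall>i. \<exists>g' g''. (\<forall>x. (f i has_derivative blinfun_apply (g' x)) (at x)) \<and>
      lipschitz_on_balls g' \<and> (\<forall>x. (g' has_derivative g'' x) (at x))"
    using C2_E[OF smooth(1)] by metis
  then obtain f' :: "'n \<Rightarrow> real^'d \<Rightarrow> (real^'d) \<Rightarrow>\<^sub>L real" and f'' where
    f': "\<And>i x. (f i has_derivative blinfun_apply (f' i x)) (at x)" "\<And>i. lipschitz_on_balls (f' i)"
      "\<And>i x. (f' i has_derivative f'' i x) (at x)" by metis
  have "\<forall>i. \<exists>g' g''. (\<forall>x. (h i has_derivative blinfun_apply (g' x)) (at x)) \<and> continuous_on UNIV g' \<and>
      lipschitz_on_balls (h i) \<and> lipschitz_on_balls g' \<and> (\<forall>x. (g' has_derivative g'' x) (at x))"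
    using C2_E[OF smooth(2)] by metis
  then obtain h' :: "'n \<Rightarrow> real^'d \<Rightarrow> (real^'d) \<Rightarrow>\<^sub>L (real^'m)" and h'' where
    h': "\<And>i x. (h i has_derivative blinfun_apply (h' i x)) (at x)" "\<And>i. continuous_on UNIV (h' i)"
      "\<And>i. lipschitz_on_balls (h i)" "\<And>i. lipschitz_on_balls (h' i)"
      "\<And>i x. (h' i has_derivative h'' i x) (at x)" by metis
  have linh': "linear (blinfun_apply (h' i s))" for i s
    by (simp add: blinfun.bounded_linear_right bounded_linear.linear)
  define q where "q i = grad (f i)" for i
  have q_grad: "GDERIV (f i) s :> q i s" and q_eq: "q i = (\<lambda>s. \<Sum>b\<in>Basis. f' i s b *\<^sub>R b)" for i s
    unfolding q_def by (rule GDERIV_grad[OF f'(1)], rule ext, rule GDERIV_grad[OF f'(1)])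
  define Q where "Q i v = (\<Sum>b\<in>Basis. f'' i s_star v b *\<^sub>R b)" for i v
  have Q: "(q i has_derivative Q i) (at s_star)" for i
    unfolding q_eq Q_def[abs_def]
    by (intro has_derivative_sum has_derivative_scaleR_left
        bounded_linear.has_derivative[OF blinfun.bounded_linear_left f'(3)])
  have q_lip: "lipschitz_on_balls (q i)" for i
    unfolding q_eq
    by (intro lipschitz_on_balls_sum lipschitz_on_balls_linear[OF bounded_linear_scaleR_left]
        lipschitz_on_balls_linear[OF blinfun.bounded_linear_left] f'(2))
  define jt where "jt i s w = (\<Sum>b\<in>Basis. (h' i s b \<bullet> w) *\<^sub>R b)" for i s w
  have jt_adj: "jt i s w = adjoint (h' i s) w" for i s w
    by (simp add: jt_def adjoint_as_sum[OF linh'])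
  have jt_lin: "linear (jt i s)" for i s
    unfolding jt_adj[abs_def] by (rule adjoint_linear[OF linh'])
  have h_s: "h i s_star = 0" for i using s_star(1) by (simp add: feasible_def)

  \<comment> \<open>The multiplier and the equilibrium point\<close>
  have rank: "rank (stacked_jacobian h (consensus s_star :: real^'d^'n)) = constr_dim R"
    using full_rank s_star(1,3) by blast
  obtain \<mu> where \<mu>: "\<mu> \<in> constr_space R" "(\<Sum>i\<in>UNIV. q i s_star + jt i s_star (\<mu> $ i)) = 0"
    and second: "\<And>v. (\<And>i. h' i s_star v = 0) \<Longrightarrow>
      \<rho> * (norm v)\<^sup>2 \<le> v \<bullet> (\<Sum>i\<in>UNIV. Q i v + (\<Sum>b\<in>Basis. (h'' i s_star v b \<bullet> \<mu> $ i) *\<^sub>R b))"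
  proof -
    have "\<exists>\<mu>\<in>constr_space R. (\<Sum>i\<in>UNIV. q i s_star + adjoint (h' i s_star) (\<mu> $ i)) = 0 \<and>
      (\<forall>v. (\<forall>i. h' i s_star v = 0) \<longrightarrow> \<rho> * (norm v)\<^sup>2 \<le>
        v \<bullet> (\<Sum>i\<in>UNIV. Q i v + (\<Sum>b\<in>Basis. (h'' i s_star v b \<bullet> \<mu> $ i) *\<^sub>R b)))"
      by (rule lagrangian_multiplier_growth[OF h'(1,2) h'(5) q_grad Q h_range s_star(1,2,3,4) _ rank])
         (use growth F_def in auto)
    then show ?thesis using that unfolding jt_adj by blast
  qed

  \<comment> \<open>The value that balances the x-equation agent by agent. The multiplier condition
    says that its blocks sum to 0, which is membership in the range of the Laplacian.\<close>
  define zc where "zc = - (\<chi> i. q i s_star + jt i s_star (\<mu> $ i))"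
  define z_star where "z_star = (zc, \<mu>)"
  define P where "P = (x_star, z_star)"
  have Lap_lin: "bounded_linear (Lap a :: real^'d^'n \<Rightarrow> real^'d^'n)" by (rule bounded_linear_stack_op)
  note range_iff = range_Lap_iff[OF weights undirected connected]
  have zc: "zc \<in> range (Lap a)"
  proof -
    have "(\<Sum>i\<in>UNIV. zc $ i) = (\<Sum>i\<in>UNIV. - (q i s_star + jt i s_star (\<mu> $ i)))"
      unfolding zc_def by (rule sum.cong) (simp_all only: vector_uminus_component vec_lambda_beta)
    then show ?thesis unfolding range_iff sum_negf \<mu>(2) by simp
  qed
  have sub_range: "subspace (range (Lap a :: real^'d^'n \<Rightarrow> real^'d^'n))"
    by (intro linear_subspace_image subspace_UNIV bounded_linear.linear Lap_lin)
  have subY: "subspace Y"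
    unfolding Y_def by (intro subspace_Times subspace_constr_space sub_range)
  have space: "sp_space a R = UNIV \<times> Y" by (simp add: sp_space_def Y_def)
  have P_mem: "P \<in> UNIV \<times> Y" using zc \<mu>(1) by (simp add: P_def z_star_def Y_def)

  \<comment> \<open>The output map and the linear data of the saddle system\<close>
  define hY where "hY x = (Lap a x, block_map h x)" for x :: "real^'d^'n"
  have hY_mem: "hY x \<in> Y" for x by (simp add: hY_def Y_def constr_space_def block_map_def h_range)
  have block_lip: "lipschitz_on_balls (block_map h)"
    unfolding block_map_def[abs_def]
    by (intro lipschitz_on_balls_vec_lambda lipschitz_on_balls_compose[OF h'(3)]
        linear_lipschitz_on_balls(2) bounded_linear_vec_nth)
  have hY_lip: "lipschitz_on_balls hY"
    unfolding hY_def by (intro lipschitz_on_balls_Pair linear_lipschitz_on_balls(2) Lap_lin block_lip)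
  have xs: "x_star $ i = s_star" for i by (simp add: x_star_def consensus_def)
  have hY0: "hY x_star = 0"
  proof -
    have "Lap a x_star = 0" by (simp add: x_star_def Lap_consensus[OF weights undirected])
    moreover have "block_map h x_star = 0" by (simp add: block_map_def xs h_s vec_eq_iff)
    ultimately show ?thesis by (simp add: hY_def zero_prod_def)
  qed
  define B where "B \<xi> = (Lap a \<xi>, \<chi> i. h' i s_star (\<xi> $ i))" for \<xi> :: "real^'d^'n"
  have B_der: "(hY has_derivative B) (at x_star)"
    unfolding hY_def[abs_def] B_def[abs_def] block_map_def
  proof (intro has_derivative_Pair has_derivative_vec_lambda bounded_linear_imp_has_derivative Lap_lin)
    fix i
    have "(h i has_derivative h' i s_star) (at (x_star $ i))" using h'(1) by (simp add: x_star_def consensus_def)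
    from has_derivative_compose[OF bounded_linear_imp_has_derivative[OF bounded_linear_vec_nth] this]
    show "((\<lambda>x. h i (x $ i)) has_derivative (\<lambda>\<xi>. h' i s_star (\<xi> $ i))) (at x_star)" .
  qed
  have B_lin: "bounded_linear B" using B_der by (rule has_derivative_bounded_linear)
  have B_mem: "B x \<in> Y" for x by (rule derivative_in_subspace[OF B_der hY_mem subY])

  define A where "A y = fst y + (\<chi> i. jt i s_star (snd y $ i))" for y :: "(real^'d^'n) \<times> (real^'m^'n)"
  have B_adj: "adjoint B = (\<lambda>y. Lap a (fst y) + (\<chi> i. jt i s_star (snd y $ i)))"
    by (rule adjoint_unique)
       (simp add: B_def inner_prod_def inner_add_right Lap_symmetric[OF weights undirected] jt_adj
          inner_vec_def[where 'a = "real^'m"] inner_vec_def[where 'a = "real^'d" and 'b = 'n and y = "vec_lambda f" for f] adjoint_works[OF linh'])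
  obtain g :: "real^'d^'n \<Rightarrow> real^'d^'n" where g: "bounded_linear g" "\<And>u w. u \<bullet> g w = g u \<bullet> w"
    "\<And>y. y \<noteq> 0 \<Longrightarrow> y \<bullet> g y > 0" "\<And>y. y \<in> range (Lap a) \<Longrightarrow> Lap a (g y) = y"
    using Lap_inverse_exists[OF weights undirected connected] by blast
  \<comment> \<open>The inverse Laplacian \<open>g\<close> cancels the Laplacian in the adjoint of
    \<open>B\<close>; the gains are included so that \<open>A (K y)\<close> is reproduced
    exactly.\<close>
  define T where "T y = (K0c *\<^sub>R g (fst y), K0h *\<^sub>R snd y)" for y :: "(real^'d^'n) \<times> (real^'m^'n)"
  define K where "K y = (K0c *\<^sub>R fst y, K0h *\<^sub>R snd y)" for y :: "(real^'d^'n) \<times> (real^'m^'n)"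
  define K' where "K' y = ((1 / K0c) *\<^sub>R fst y, (1 / K0h) *\<^sub>R snd y)" for y :: "(real^'d^'n) \<times> (real^'m^'n)"
  have T_lin: "bounded_linear T" unfolding T_def
    by (intro bounded_linear_Pair bounded_linear_compose[OF bounded_linear_scaleR_right]
        bounded_linear_compose[OF g(1)] bounded_linear_fst bounded_linear_snd)
  have K_lin: "bounded_linear K" "bounded_linear K'" unfolding K_def K'_def
    by (intro bounded_linear_Pair bounded_linear_compose[OF bounded_linear_scaleR_right]
        bounded_linear_fst bounded_linear_snd)+
  have K_inv: "K' (K y) = y" "K (K' y) = y" for y using gains by (simp_all add: K_def K'_def)
  have K_mem: "K y \<in> Y" "K' y \<in> Y" if "y \<in> Y" for y
    using that unfolding K_def K'_def Y_def
    by (simp_all add: mem_Times_iff subspace_scale[OF sub_range] subspace_scale[OF subspace_constr_space])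
  have T_sym: "u \<bullet> T w = T u \<bullet> w" for u w by (simp add: T_def inner_prod_def g(2))
  have T_pos: "y \<bullet> T y > 0" if "y \<noteq> 0" for y
  proof -
    have nn: "fst y \<bullet> g (fst y) \<ge> 0" using g(3)[of "fst y"] by (cases "fst y = 0") auto
    have "fst y \<noteq> 0 \<or> snd y \<noteq> 0" using that by (auto simp: prod_eq_iff)
    then show ?thesis using gains nn g(3)[of "fst y"]
      by (auto simp: T_def inner_prod_def intro: add_pos_nonneg add_nonneg_pos)
  qed
  have AK: "A (K y) = adjoint B (T y)" if "y \<in> Y" for y
  proof -
    have "Lap a (g (fst y)) = fst y" using that by (intro g(4)) (auto simp: Y_def)
    then have "Lap a (K0c *\<^sub>R g (fst y)) = K0c *\<^sub>R fst y"
      by (simp add: linear_scale[OF bounded_linear.linear[OF Lap_lin]])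
    then show ?thesis by (simp add: A_def K_def T_def B_adj)
  qed
  have inj: "adjoint B (T y) \<noteq> 0" if y: "y \<in> Y" "y \<noteq> 0" for y
  proof
    assume "adjoint B (T y) = 0"
    then have 0: "K0c *\<^sub>R fst y + (\<chi> i. jt i s_star (K0h *\<^sub>R snd y $ i)) = 0"
      using AK[OF y(1)] by (simp add: A_def K_def)
    have mem: "fst y \<in> range (Lap a)" "snd y \<in> constr_space R" using y(1) by (simp_all add: Y_def mem_Times_iff)
    have "(\<Sum>i\<in>UNIV. fst y $ i) = 0" using mem(1) unfolding range_iff .
    \<comment> \<open>Summation over the agents removes the consensus part, whose block sum is 0,
      and leaves the adjoint sum to which the rank condition applies.\<close>
    then have "(\<Sum>i\<in>UNIV. (K0c *\<^sub>R fst y + (\<chi> i. jt i s_star (K0h *\<^sub>R snd y $ i))) $ i)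
        = (\<Sum>i\<in>UNIV. jt i s_star (K0h *\<^sub>R snd y $ i))"
      by (simp add: sum.distrib scaleR_sum_right[symmetric])
    then have "K0h *\<^sub>R snd y = 0"
      using subspace_scale[OF subspace_constr_space mem(2)] unfolding 0
      by (intro full_rank_adjoint_injective[OF h'(1) h_range rank]) (auto simp: jt_adj)
    then have "snd y = 0" using gains by simp
    moreover have "fst y = 0" using 0 gains \<open>snd y = 0\<close>
      by (simp add: linear_0[OF jt_lin] zero_vec_def[symmetric])
    ultimately show False using y(2) by (simp add: prod_eq_iff)
  qed

  obtain D' where "(G has_derivative blinfun_apply D') (at 0 within Y)"
    using G_C1 subspace_0[OF subY] by (auto simp: C1_on_def)
  then obtain D where D: "(G has_derivative D) (at 0 within Y)" by blast
  have G_lip: "\<exists>L. L-lipschitz_on (Y \<inter> cball 0 r) G" for r by (rule C1_on_lipschitz[OF G_C1 subY])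

  define H where "H \<xi> = (\<chi> i. Q i (\<xi> $ i) + (\<Sum>b\<in>Basis. (h'' i s_star (\<xi> $ i) b \<bullet> \<mu> $ i) *\<^sub>R b))"
    for \<xi> :: "real^'d^'n"
  have H_lin: "bounded_linear H"
  proof -
    have comp: "((\<lambda>x. q i (x $ i)) has_derivative (\<lambda>\<xi>. Q i (\<xi> $ i))) (at x_star)"
      "((\<lambda>x. h' i (x $ i)) has_derivative (\<lambda>\<xi>. h'' i s_star (\<xi> $ i))) (at x_star)" for i
      by (rule has_derivative_compose[OF bounded_linear_imp_has_derivative[OF bounded_linear_vec_nth]],
          use Q h'(5) in \<open>simp add: xs\<close>)+
    \<comment> \<open>\<open>H\<close> is the derivative of the stacked Lagrangian gradient with
      frozen multiplier; linearity comes with that.\<close>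
    have "((\<lambda>x :: real^'d^'n. \<chi> i. q i (x $ i) + jt i (x $ i) (\<mu> $ i)) has_derivative H) (at x_star)"
      unfolding H_def[abs_def] jt_def
      by (intro has_derivative_vec_lambda has_derivative_add has_derivative_sum
          has_derivative_scaleR_left has_derivative_inner_left bounded_linear.has_derivative[OF blinfun.bounded_linear_left] comp)
    then show ?thesis by (rule has_derivative_bounded_linear)
  qed
  have H_pos: "\<rho> / real CARD('n) * (norm n)\<^sup>2 \<le> n \<bullet> H n" if n: "B n = 0" for n
  proof -
    have "n \<bullet> Lap a n = 0" using n by (simp add: B_def zero_prod_def)
    then obtain v where v: "n = consensus v"
      using consensus_of_Lap_form[OF weights undirected connected] by blast
    have "h' i s_star v = 0" for i
      using n by (simp add: B_def v consensus_def zero_prod_def vec_eq_iff[where y = 0])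
    from second[OF this] have "\<rho> * (norm v)\<^sup>2 \<le> n \<bullet> H n"
      by (simp add: v inner_consensus H_def) (simp add: consensus_def)
    then show ?thesis unfolding v norm_consensus by simp
  qed

  \<comment> \<open>The same field with the joint map \<open>G\<close> at \<open>hY\<close>, whose
    values always lie in \<open>Y\<close>, and with transposed Jacobians as finite sums, so that the
    Lipschitz and derivative rules apply term by term.\<close>
  define V where "V \<tau> p = ((\<chi> i. - (q i (fst p $ i) + jt i (fst p $ i) ((K0h / \<tau>) *\<^sub>R h i (fst p $ i) + snd (snd p) $ i)))
      + - ((K0c / \<tau>) *\<^sub>R Lap a (fst p) + fst (snd p)), - (1 / \<tau>) *\<^sub>R K (G (hY (fst p))))"
    for \<tau> and p :: "(real^'d^'n) \<times> (real^'d^'n) \<times> (real^'m^'n)"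
  have field: "sp_field a f h Gg Gh (K0c / \<tau>) (K0h / \<tau>) = V \<tau>" for \<tau>
  proof
    fix p :: "(real^'d^'n) \<times> (real^'d^'n) \<times> (real^'m^'n)"
    obtain x yc yh where p: "p = (x, yc, yh)" by (metis prod_cases3)
    have "G (hY x) = (Gg (Lap a x), Gh (block_map h x))"
      using G_split hY_mem[of x] unfolding hY_def Y_def by simp
    moreover have "grad (stacked_cost f) x = (\<chi> i. q i (x $ i))"
      using grad_stacked_cost[of f x] q_grad by (simp add: q_def)
    moreover have "blkdiag_jacobian_transpose h x y = (\<chi> i. jt i (x $ i) (y $ i))" for y
      unfolding blkdiag_jacobian_transpose_def transpose_jacobian(1)[OF h'(1)] jt_adj ..
    ultimately show "sp_field a f h Gg Gh (K0c / \<tau>) (K0h / \<tau>) p = V \<tau> p"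
      by (simp add: sp_field_def V_def p K_def Let_def block_map_def vec_eq_iff)
  qed
  have comp_lip: "lipschitz_on_balls (\<lambda>p :: (real^'d^'n) \<times> (real^'d^'n) \<times> (real^'m^'n). fst p $ i)"
    "lipschitz_on_balls (\<lambda>p :: (real^'d^'n) \<times> (real^'d^'n) \<times> (real^'m^'n). snd (snd p) $ i)" for i
    by (intro linear_lipschitz_on_balls(2) bounded_linear_compose[OF bounded_linear_vec_nth]
        bounded_linear_compose[OF bounded_linear_snd] bounded_linear_fst bounded_linear_snd)+
  have V_lip: "lipschitz_on_balls (V \<tau>)" for \<tau>
    unfolding V_def[abs_def] jt_def
    by (intro lipschitz_on_balls_Pair lipschitz_on_balls_add lipschitz_on_balls_vec_lambda
        lipschitz_on_balls_linear[OF bounded_linear_minus[OF bounded_linear_ident]]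
        lipschitz_on_balls_sum lipschitz_on_balls_linear[OF bounded_linear_scaleR_left]
        lipschitz_on_balls_linear[OF bounded_linear_scaleR_right]
        lipschitz_on_balls_bilinear[OF bounded_bilinear_inner]
        lipschitz_on_balls_linear[OF blinfun.bounded_linear_left]
        lipschitz_on_balls_linear[OF Lap_lin] lipschitz_on_balls_linear[OF K_lin(1)]
        lipschitz_on_balls_compose_on[OF _ _ G_lip] lipschitz_on_balls_compose[OF hY_lip] hY_mem
        lipschitz_on_balls_compose[OF q_lip] lipschitz_on_balls_compose[OF h'(3)] lipschitz_on_balls_compose[OF h'(4)]
        comp_lip linear_lipschitz_on_balls(2) bounded_linear_compose[OF bounded_linear_fst]
        bounded_linear_fst bounded_linear_snd)
  have V_mem: "V \<tau> p \<in> UNIV \<times> Y" for \<tau> p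
  proof -
    have "- (1 / \<tau>) *\<^sub>R K (G (hY (fst p))) \<in> Y"
      by (intro subspace_scale[OF subY] K_mem(1) G_maps hY_mem)
    then show ?thesis by (simp add: V_def)
  qed
  have V0: "V \<tau> P = 0" for \<tau>
  proof -
    have "G (hY x_star) = 0" by (simp only: hY0 G_zero)
    then have "snd (V \<tau> P) = 0" by (simp add: V_def P_def K_def zero_prod_def)
    moreover have "fst (V \<tau> P) = 0"
      using hY0 by (simp add: V_def P_def z_star_def zc_def hY_def zero_prod_def)
        (simp add: x_star_def consensus_def h_s vec_eq_iff)
    ultimately show ?thesis by (simp add: prod_eq_iff)
  qed
  have V_der: "(V \<tau> has_derivative (\<lambda>(x, z). (- H x - A ((1 / \<tau>) *\<^sub>R K (B x) + z), - (1 / \<tau>) *\<^sub>R K (D (B x))))) (at P)" for \<tau>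
  proof -
    have P1: "fst P $ i = s_star" "snd (snd P) $ i = \<mu> $ i" for i
      by (simp_all add: P_def z_star_def x_star_def consensus_def)
    have d0: "((\<lambda>p :: (real^'d^'n) \<times> (real^'d^'n) \<times> (real^'m^'n). fst p $ i) has_derivative (\<lambda>v. fst v $ i)) (at P)"
      "((\<lambda>p :: (real^'d^'n) \<times> (real^'d^'n) \<times> (real^'m^'n). snd (snd p) $ i) has_derivative (\<lambda>v. snd (snd v) $ i)) (at P)" for i
      by (intro bounded_linear_imp_has_derivative bounded_linear_compose[OF bounded_linear_vec_nth]
        bounded_linear_compose[OF bounded_linear_snd] bounded_linear_fst bounded_linear_snd)+
    have dq: "((\<lambda>p :: (real^'d^'n) \<times> (real^'d^'n) \<times> (real^'m^'n). q i (fst p $ i)) has_derivative (\<lambda>v. Q i (fst v $ i))) (at P)" for i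
      by (rule has_derivative_compose[OF d0(1)]) (use Q in \<open>simp add: P1\<close>)
    have dh: "((\<lambda>p :: (real^'d^'n) \<times> (real^'d^'n) \<times> (real^'m^'n). h i (fst p $ i)) has_derivative (\<lambda>v. h' i s_star (fst v $ i))) (at P)" for i
      by (rule has_derivative_compose[OF d0(1)]) (use h'(1) in \<open>simp add: P1\<close>)
    have dh': "((\<lambda>p :: (real^'d^'n) \<times> (real^'d^'n) \<times> (real^'m^'n). h' i (fst p $ i) b) has_derivative (\<lambda>v. h'' i s_star (fst v $ i) b)) (at P)" for i b
      by (rule bounded_linear.has_derivative[OF blinfun.bounded_linear_left has_derivative_compose[OF d0(1)]])
         (use h'(5) in \<open>simp add: P1\<close>)
    let ?w = "\<lambda>i p. (K0h / \<tau>) *\<^sub>R h i (fst p $ i) + snd (snd p) $ i"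
    let ?w' = "\<lambda>i v. (K0h / \<tau>) *\<^sub>R h' i s_star (fst v $ i) + snd (snd v) $ i"
    have dw: "(?w i has_derivative ?w' i) (at P)" for i
      by (intro has_derivative_add has_derivative_scaleR_right dh d0)
    have wP: "(K0h / \<tau>) *\<^sub>R h i s_star + \<mu> $ i = \<mu> $ i" for i by (simp add: h_s)
    have djt: "((\<lambda>p. jt i (fst p $ i) (?w i p)) has_derivative
        (\<lambda>v. jt i s_star (?w' i v) + (\<Sum>b\<in>Basis. (h'' i s_star (fst v $ i) b \<bullet> \<mu> $ i) *\<^sub>R b))) (at P)" for i
    proof -
      have "((\<lambda>p. jt i (fst p $ i) (?w i p)) has_derivative
        (\<lambda>v. \<Sum>b\<in>Basis. (h' i (fst P $ i) b \<bullet> ?w' i v + h'' i s_star (fst v $ i) b \<bullet> ?w i P) *\<^sub>R b)) (at P)"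
        unfolding jt_def by (intro has_derivative_sum has_derivative_scaleR_left has_derivative_inner dw dh')
      then show ?thesis unfolding P1 wP by (simp only: jt_def scaleR_add_left sum.distrib)
    qed
    have dG: "((\<lambda>p :: (real^'d^'n) \<times> (real^'d^'n) \<times> (real^'m^'n). G (hY (fst p))) has_derivative (\<lambda>v. D (B (fst v)))) (at P)"
    proof -
      have "(hY has_derivative B) (at (fst P))" using B_der by (simp add: P_def)
      from has_derivative_compose[OF bounded_linear_imp_has_derivative[OF bounded_linear_fst] this]
      have 1: "((\<lambda>p :: (real^'d^'n) \<times> (real^'d^'n) \<times> (real^'m^'n). hY (fst p)) has_derivative (\<lambda>v. B (fst v))) (at P)" .
      \<comment> \<open>A derivative within \<open>Y\<close> is enough, because the inner map takes
        all its values there; the composite is differentiable on the full space.\<close>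
      have "(G has_derivative D) (at (hY (fst P)) within range (\<lambda>p :: (real^'d^'n) \<times> (real^'d^'n) \<times> (real^'m^'n). hY (fst p)))"
      proof (rule has_derivative_subset)
        show "(G has_derivative D) (at (hY (fst P)) within Y)" using D by (simp add: P_def hY0)
      qed (use hY_mem in blast)
      from has_derivative_in_compose[OF 1 this] show ?thesis .
    qed
    have "(V \<tau> has_derivative (\<lambda>v. ((\<chi> i. - (Q i (fst v $ i) + (jt i s_star (?w' i v) + (\<Sum>b\<in>Basis. (h'' i s_star (fst v $ i) b \<bullet> \<mu> $ i) *\<^sub>R b))))
        + - ((K0c / \<tau>) *\<^sub>R Lap a (fst v) + fst (snd v)), - (1 / \<tau>) *\<^sub>R K (D (B (fst v)))))) (at P)"
      unfolding V_def[abs_def]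
      by (intro has_derivative_Pair has_derivative_add has_derivative_vec_lambda has_derivative_minus dq djt
          has_derivative_scaleR_right bounded_linear.has_derivative[OF K_lin(1)] dG
          bounded_linear_imp_has_derivative bounded_linear_compose[OF Lap_lin]
          bounded_linear_compose[OF bounded_linear_fst] bounded_linear_fst bounded_linear_snd)
    moreover have "(\<chi> i. - (Q i (x $ i) + (jt i s_star (?w' i (x, z)) + (\<Sum>b\<in>Basis. (h'' i s_star (x $ i) b \<bullet> \<mu> $ i) *\<^sub>R b))))
        + - ((K0c / \<tau>) *\<^sub>R Lap a x + fst z) = - H x - A ((1 / \<tau>) *\<^sub>R K (B x) + z)" for x z
      by (simp add: H_def A_def K_def B_def vec_eq_iff)
    ultimately show ?thesis by (simp add: case_prod_unfold)
  qed

  \<comment> \<open>Local decay of trajectories, isolation of the equilibrium and the final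
    estimate\<close>
  define decays where "decays \<tau> \<gamma> C \<delta> \<longleftrightarrow> (\<forall>p\<in>UNIV \<times> Y. norm (p - P) < \<delta> \<longrightarrow>
    (\<exists>\<phi>. is_solution (V \<tau>) (UNIV \<times> Y) \<phi> \<and> \<phi> 0 = p \<and>
       (\<forall>t\<ge>0. norm (\<phi> t - P) \<le> C * exp (- \<gamma> * t) * norm (p - P))))" for \<tau> \<gamma> C \<delta>
  have main: "\<exists>\<tau>s>0. \<forall>\<tau>. 0 < \<tau> \<and> \<tau> < \<tau>s \<longrightarrow> (\<exists>C>0. \<exists>\<delta>>0. decays \<tau> \<gamma> C \<delta>)"
    if \<gamma>: "0 \<le> \<gamma>" "\<gamma> < \<rho> / real CARD('n)" "\<gamma> < \<alpha>G" for \<gamma>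
    using saddle_exponentially_stable[OF B_lin B_mem subY T_lin T_sym T_pos inj D G_zero G_stable(2,1) H_lin H_pos
      K_lin K_inv K_mem(2) AK V_lip V_mem V0 P_mem V_der \<gamma>]
    unfolding decays_def by metis
  have unique: "\<psi> t = \<phi> t"
    if "is_solution (V \<tau>) X \<phi>" "is_solution (V \<tau>) X' \<psi>" "\<psi> 0 = \<phi> 0" "t \<ge> 0" for \<tau> X X' \<phi> \<psi> t
    by (rule solution_unique[OF V_lip that(2,1,3,4)])

  have isolated: "locally_unique_equilibrium (V \<tau>) (UNIV \<times> Y) P" if "\<tau> > 0" for \<tau>
  proof -
    define \<gamma> where "\<gamma> = min (\<rho> / real CARD('n)) \<alpha>G / 2"
    have \<gamma>: "\<gamma> > 0" "\<gamma> < \<rho> / real CARD('n)" "\<gamma> < \<alpha>G"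
    proof -
      define r where "r = \<rho> / real CARD('n)"
      have "r > 0" using s_star(4) by (simp add: r_def)
      then show "\<gamma> > 0" "\<gamma> < \<rho> / real CARD('n)" "\<gamma> < \<alpha>G"
        using G_stable(1) unfolding \<gamma>_def r_def[symmetric] by (auto simp: min_def)
    qed
    obtain \<tau>s where \<tau>s: "\<tau>s > 0" "\<And>\<tau>. 0 < \<tau> \<and> \<tau> < \<tau>s \<Longrightarrow> \<exists>C>0. \<exists>\<delta>>0. decays \<tau> \<gamma> C \<delta>"
      using main[OF less_imp_le[OF \<gamma>(1)] \<gamma>(2,3)] by blast
    \<comment> \<open>One parameter for which stability is available; the given \<tau> may be
      large.\<close>
    define \<tau>' where "\<tau>' = \<tau>s / 2"
    obtain C \<delta> where \<delta>: "\<delta> > 0" and dec: "decays \<tau>' \<gamma> C \<delta>"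
      using \<tau>s(2)[of \<tau>'] \<tau>s(1) by (auto simp: \<tau>'_def)
    have "p = P" if p: "p \<in> ball P \<delta> \<inter> UNIV \<times> Y" "V \<tau> p = 0" for p
    proof -
      have "snd (V \<tau> p) = 0" using p(2) by simp
      then have "K (G (hY (fst p))) = 0" using \<open>\<tau> > 0\<close> by (simp add: V_def)
      then have "G (hY (fst p)) = 0" using K_inv(1) linear_0[OF bounded_linear.linear[OF K_lin(2)]] by metis
      then have "is_solution G Y (\<lambda>t. hY (fst p))" using hY_mem by (simp add: is_solution_def)
      then obtain c where c: "\<And>t. t \<ge> 0 \<Longrightarrow> norm (hY (fst p)) \<le> c * exp (- \<alpha>G * t) * norm (hY (fst p))"
        using G_stable(2) unfolding globally_exp_stable_def by blast
      have "hY (fst p) = 0" by (rule zero_if_exp_decay[OF c G_stable(1)])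
      then have "Lap a (fst p) = 0" "block_map h (fst p) = 0" by (simp_all add: hY_def zero_prod_def)
      moreover from this have "h i (fst p $ i) = 0" for i
      proof -
        have "block_map h (fst p) $ i = 0" using \<open>block_map h (fst p) = 0\<close> by simp
        then show ?thesis by (simp only: block_map_def vec_lambda_beta)
      qed
      \<comment> \<open>Every term that depends on the parameter contains \<open>L x\<close>,
        \<open>h x\<close> or \<open>G\<close> at the output, all of which are 0 here.\<close>
      ultimately have "V \<tau>' p = V \<tau> p"
        using \<open>hY (fst p) = 0\<close> G_zero by (simp add: V_def K_def)
      then have "V \<tau>' p = 0" using p(2) by simp
      then have const: "is_solution (V \<tau>') UNIV (\<lambda>t. p)" by (simp add: is_solution_def)
      obtain \<phi> where \<phi>: "is_solution (V \<tau>') (UNIV \<times> Y) \<phi>" "\<phi> 0 = p"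
        "\<And>t. t \<ge> 0 \<Longrightarrow> norm (\<phi> t - P) \<le> C * exp (- \<gamma> * t) * norm (p - P)"
      proof -
        have "p \<in> UNIV \<times> Y" "norm (p - P) < \<delta>" using p(1) by (auto simp: dist_norm norm_minus_commute)
        then show ?thesis using dec that unfolding decays_def by blast
      qed
      have "\<phi> t = p" if "t \<ge> 0" for t using unique[OF \<phi>(1) const _ that] \<phi>(2) by simp
      then have "norm (p - P) \<le> C * exp (- \<gamma> * t) * norm (p - P)" if "t \<ge> 0" for t
        using \<phi>(3)[OF that] that by simp
      from zero_if_exp_decay[OF this \<gamma>(1)] show "p = P" by simp
    qed
    then show ?thesis
      unfolding locally_unique_equilibrium_def
      using P_mem V0 \<delta> by (intro conjI exI[of _ "ball P \<delta>"]) auto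
  qed

  have stable: "\<exists>\<tau>_star>0. \<forall>\<tau>. 0 < \<tau> \<and> \<tau> < \<tau>_star \<longrightarrow>
       (\<exists>C>0. \<exists>\<delta>>0. \<forall>p0 \<in> UNIV \<times> Y.
         norm (fst p0 - x_star) + norm (snd p0 - z_star) < \<delta> \<longrightarrow>
         (\<exists>\<phi>. is_solution (V \<tau>) (UNIV \<times> Y) \<phi> \<and> \<phi> 0 = p0 \<and>
              (\<forall>\<psi>. is_solution (V \<tau>) UNIV \<psi> \<and> \<psi> 0 = p0 \<longrightarrow> (\<forall>t\<ge>0. \<psi> t = \<phi> t)) \<and>
              (\<forall>t\<ge>0. norm (fst (\<phi> t) - x_star) + norm (snd (\<phi> t) - z_star)
                     + norm (Lap a (fst (\<phi> t))) + norm (block_map h (fst (\<phi> t)))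
                   \<le> C * exp (- \<gamma> * t) * (norm (fst p0 - x_star) + norm (snd p0 - z_star)))))"
    if \<gamma>: "0 < \<gamma>" "\<gamma> < \<rho> / real CARD('n)" "\<gamma> < \<alpha>G" for \<gamma>
  proof -
    obtain \<tau>s where \<tau>s: "\<tau>s > 0" "\<And>\<tau>. 0 < \<tau> \<and> \<tau> < \<tau>s \<Longrightarrow> \<exists>C>0. \<exists>\<delta>>0. decays \<tau> \<gamma> C \<delta>"
      using main[OF less_imp_le[OF \<gamma>(1)] \<gamma>(2,3)] by blast
    show ?thesis
    proof (rule exI[of _ \<tau>s], rule conjI[OF \<tau>s(1)], intro allI impI)
      fix \<tau> assume "0 < \<tau> \<and> \<tau> < \<tau>s"
      from \<tau>s(2)[OF this] obtain C \<delta> where C: "C > 0" and \<delta>: "\<delta> > 0" and dec: "decays \<tau> \<gamma> C \<delta>" by blast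
      \<comment> \<open>A ball that contains the x-component of every trajectory considered, so that
        a single Lipschitz constant of the outputs serves for all times.\<close>
      define r where "r = norm x_star + C * \<delta>"
      obtain L where L: "L \<ge> 0" "\<And>x y. norm x \<le> r \<Longrightarrow> norm y \<le> r \<Longrightarrow> dist (hY x) (hY y) \<le> L * norm (x - y)"
        using lipschitz_on_ballsD[OF hY_lip] by metis
      \<comment> \<open>Each of the two state errors is at most the distance to the equilibrium, and
        each of the two outputs at most \<open>L\<close> times it.\<close>
      have C': "(2 + 2 * L) * C > 0" using C L(1) by simp
      show "\<exists>C>0. \<exists>\<delta>>0. \<forall>p0 \<in> UNIV \<times> Y.
         norm (fst p0 - x_star) + norm (snd p0 - z_star) < \<delta> \<longrightarrow>
         (\<exists>\<phi>. is_solution (V \<tau>) (UNIV \<times> Y) \<phi> \<and> \<phi> 0 = p0 \<and>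
              (\<forall>\<psi>. is_solution (V \<tau>) UNIV \<psi> \<and> \<psi> 0 = p0 \<longrightarrow> (\<forall>t\<ge>0. \<psi> t = \<phi> t)) \<and>
              (\<forall>t\<ge>0. norm (fst (\<phi> t) - x_star) + norm (snd (\<phi> t) - z_star)
                     + norm (Lap a (fst (\<phi> t))) + norm (block_map h (fst (\<phi> t)))
                   \<le> C * exp (- \<gamma> * t) * (norm (fst p0 - x_star) + norm (snd p0 - z_star))))"
      proof (rule exI[of _ "(2 + 2 * L) * C"], rule conjI[OF C'], rule exI[of _ \<delta>], rule conjI[OF \<delta>], intro ballI impI)
        fix p0 assume p0: "p0 \<in> UNIV \<times> Y" "norm (fst p0 - x_star) + norm (snd p0 - z_star) < \<delta>"
        let ?n = "norm (fst p0 - x_star) + norm (snd p0 - z_star)"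
        have n: "norm (p0 - P) \<le> ?n" using norm_prod_bounds(3)[of "p0 - P"] by (simp add: P_def)
        obtain \<phi> where \<phi>: "is_solution (V \<tau>) (UNIV \<times> Y) \<phi>" "\<phi> 0 = p0"
          "\<And>t. t \<ge> 0 \<Longrightarrow> norm (\<phi> t - P) \<le> C * exp (- \<gamma> * t) * norm (p0 - P)"
        proof -
          have "norm (p0 - P) < \<delta>" using n p0(2) by linarith
          then show ?thesis using dec p0(1) that unfolding decays_def by blast
        qed
        have bound: "norm (fst (\<phi> t) - x_star) + norm (snd (\<phi> t) - z_star)
            + norm (Lap a (fst (\<phi> t))) + norm (block_map h (fst (\<phi> t))) \<le> (2 + 2 * L) * C * exp (- \<gamma> * t) * ?n"
          if t: "t \<ge> 0" for t
        proof -
          let ?d = "norm (\<phi> t - P)"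
          have 1: "norm (fst (\<phi> t) - x_star) \<le> ?d" "norm (snd (\<phi> t) - z_star) \<le> ?d"
            using norm_prod_bounds(1,2)[of "\<phi> t - P"] by (simp_all add: P_def)
          have "?d \<le> C * exp (- \<gamma> * t) * norm (p0 - P)" by (rule \<phi>(3)[OF t])
          also have "\<dots> \<le> C * exp (- \<gamma> * t) * ?n" using C n by (intro mult_left_mono) auto
          finally have d: "?d \<le> C * exp (- \<gamma> * t) * ?n" .
          also have "\<dots> \<le> C * 1 * \<delta>"
            using C \<gamma>(1) t p0(2) by (intro mult_mono) auto
          finally have "norm (fst (\<phi> t)) \<le> r"
            using 1(1) norm_triangle_sub[of "fst (\<phi> t)" x_star] by (simp add: r_def)
          moreover have "norm x_star \<le> r" using C \<delta> by (simp add: r_def)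
          ultimately have "norm (hY (fst (\<phi> t))) \<le> L * norm (fst (\<phi> t) - x_star)"
            using L(2)[of "fst (\<phi> t)" x_star] hY0 by simp
          also have "\<dots> \<le> L * ?d" using L(1) 1(1) by (rule mult_left_mono[rotated])
          finally have "norm (hY (fst (\<phi> t))) \<le> L * ?d" .
          then have "norm (Lap a (fst (\<phi> t))) \<le> L * ?d" "norm (block_map h (fst (\<phi> t))) \<le> L * ?d"
            using norm_prod_bounds(1,2)[of "hY (fst (\<phi> t))"] by (simp_all add: hY_def)
          with 1 have "norm (fst (\<phi> t) - x_star) + norm (snd (\<phi> t) - z_star)
            + norm (Lap a (fst (\<phi> t))) + norm (block_map h (fst (\<phi> t))) \<le> (2 + 2 * L) * ?d"
            by (simp add: algebra_simps)
          also have "\<dots> \<le> (2 + 2 * L) * (C * exp (- \<gamma> * t) * ?n)" using d L(1) by (intro mult_left_mono) auto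
          finally show ?thesis by (simp only: mult.assoc)
        qed
        show "\<exists>\<phi>. is_solution (V \<tau>) (UNIV \<times> Y) \<phi> \<and> \<phi> 0 = p0 \<and>
              (\<forall>\<psi>. is_solution (V \<tau>) UNIV \<psi> \<and> \<psi> 0 = p0 \<longrightarrow> (\<forall>t\<ge>0. \<psi> t = \<phi> t)) \<and>
              (\<forall>t\<ge>0. norm (fst (\<phi> t) - x_star) + norm (snd (\<phi> t) - z_star)
                     + norm (Lap a (fst (\<phi> t))) + norm (block_map h (fst (\<phi> t)))
                   \<le> (2 + 2 * L) * C * exp (- \<gamma> * t) * ?n)"
        proof (intro exI[of _ \<phi>] conjI allI impI \<phi>(1,2) bound)
          fix \<psi> t assume \<psi>: "is_solution (V \<tau>) UNIV \<psi> \<and> \<psi> 0 = p0" "(0::real) \<le> t"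
          show "\<psi> t = \<phi> t" by (rule unique[OF \<phi>(1) conjunct1[OF \<psi>(1)] _ \<psi>(2)]) (use \<psi>(1) \<phi>(2) in simp)
        qed
      qed
    qed
  qed

  show ?thesis
    unfolding field space
  proof (intro exI[of _ z_star] conjI allI impI)
    show "locally_unique_equilibrium (V \<tau>) (UNIV \<times> Y) (x_star, z_star)" if "\<tau> > 0" for \<tau>
      using isolated[OF that] by (simp only: P_def)
  next
    fix \<alpha>FL \<alpha>SP
    assume "0 < \<alpha>FL \<and> \<alpha>FL < min (\<rho> / real CARD('n)) \<alpha>G" "0 < \<alpha>SP \<and> \<alpha>SP < \<alpha>FL"
    then have "0 < \<alpha>SP" "\<alpha>SP < \<rho> / real CARD('n)" "\<alpha>SP < \<alpha>G" by auto
    from stable[OF this]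
    show "\<exists>\<tau>_star>0. \<forall>\<tau>. 0 < \<tau> \<and> \<tau> < \<tau>_star \<longrightarrow>
       (\<exists>C>0. \<exists>\<delta>>0. \<forall>p0 \<in> UNIV \<times> Y.
         norm (fst p0 - x_star) + norm (snd p0 - z_star) < \<delta> \<longrightarrow>
         (\<exists>\<phi>. is_solution (V \<tau>) (UNIV \<times> Y) \<phi> \<and> \<phi> 0 = p0 \<and>
              (\<forall>\<psi>. is_solution (V \<tau>) UNIV \<psi> \<and> \<psi> 0 = p0 \<longrightarrow> (\<forall>t\<ge>0. \<psi> t = \<phi> t)) \<and>
              (\<forall>t\<ge>0. norm (fst (\<phi> t) - x_star) + norm (snd (\<phi> t) - z_star)
                     + norm (Lap a (fst (\<phi> t))) + norm (block_map h (fst (\<phi> t)))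
                   \<le> C * exp (- \<alpha>SP * t) * (norm (fst p0 - x_star) + norm (snd p0 - z_star)))))" .
  qed
qed

end
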